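(* Let $\mathcal{A}$ be a rank $d$ central arrangement of $n$ weighted, cooriented hyperplanes defined by nonzero integer vectors $a_1,\dots,a_n\in\mathfrak{t}^d$, let $\tilde{\mathcal{A}}$ be a simplification of $\mathcal{A}$, and let $\lambda\in(\mathfrak{t}^k)^*$ be a regular value of the moment map $\mu:T^*\mathbb{A}^n\to(\mathfrak{t}^k)^*$. Then the variety $\mathfrak{M}_\lambda(\tilde{\mathcal{A}})$ has polynomial point count, with $$\nu_{\mathfrak{M}_\lambda(\tilde{\mathcal{A}})}(q)=q^{2d}\cdot h_{\mathcal{A}}(q^{-1}).$$
   Context: Setup. Let $T^n$ and $T^d$ be split algebraic tori over $\mathbb{Z}$ with integral Lie algebras (cocharacter lattices) $\mathfrak{t}^n\cong\mathbb{Z}^n$, with basis $x_1,\dots,x_n$ and dual basis $e_1,\dots,e_n$ of $(\mathfrak{t}^n)^*$, and $\mathfrak{t}^d\cong\mathbb{Z}^d$. Let $a_1,\dots,a_n\in\mathfrak{t}^d$ be nonzero vectors such that the map $\mathfrak{t}^n\to\mathfrak{t}^d$, $x_i\mapsto a_i$, has rank $d$. Let $\mathfrak{t}^k$ be its kernel ($k=n-d$), $\iota:\mathfrak{t}^k\to\mathfrak{t}^n$ the inclusion, and $T^k=\ker(T^n\to T^d)$ (possibly disconnected). $T^n$ acts on $T^*\mathbb{A}^n=\mathbb{A}^n\times(\mathbb{A}^n)^*$, with coordinates $(z,w)$, by $t\cdot(z,w)=(tz,t^{-1}w)$, and the restricted $T^k$-action has moment map $\mu(z,w)=\iota^*\sum_i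 (z_iw_i)e_i\in(\mathfrak{t}^k)^*$. Given $r\in(\mathfrak{t}^n)^*$, the associated arrangement consists of the hyperplanes $H_i=\{v\in(\mathfrak{t}^d)^*\mid v\cdot a_i+r_i=0\}$ with normal vectors $a_i$; it is central if $r=0$, and simple if every subset of $m$ hyperplanes with nonempty intersection intersects in codimension $m$. A simplification $\tilde{\mathcal{A}}$ of the central arrangement $\mathcal{A}$ is a simple arrangement given by the same $a_i$ and some choice of $r$. Let $\alpha=\iota^*(r)$, regarded as a character of $T^k$ (the restriction of the character $r$ of $T^n$). For $\lambda\in(\mathfrak{t}^k)^*$ (an integral element, reduced modulo $p$ over fields of characteristic $p$), $\mathfrak{M}_\lambda(\tilde{\mathcal{A}})=\mu^{-1}(\lambda)/\!/_\alpha T^k$ is the GIT quotient with respect to $\alpha$. If $\lambda$ is a regular value of $\mu$, then $T^k$ acts on $\mu^{-1}(\lambda)$ with finite stabilizers and this is a geometric quotient. A variety $X$ over $\mathbb{Z}$ has polynomial point count if there is a polynomial $\nu_X(q)$ such that, whenever $q$ is a power of a sufficiently large prime, $\nu_X(q)$ equals the number of $\mathbb{F}_q$-rational points of $X$. The matroid complex $\Delta_{\mathcal{A}}$ is the simplicial complex of all $S\subseteq\{1,\dots,n\}$ with $\{a_i\mid i\in S\}$ linearly independent (as a family indexed by $S$). With $f_i$ its number of faces of cardinality $i$, $h_{\mathcal{A}}(q)=\sum_{i=0}^df_i\,q^i(1-q)^{d-i}$. *)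

theory Defs
  imports
    "HOL-Analysis.Analysis"
    "HOL-Algebra.QuotRing"
    "HOL-Library.Poly_Mapping"
    "HOL-Computational_Algebra.Polynomial"
    "HOL-Computational_Algebra.Primes"
begin

section \<open>The arrangement\<close>

text \<open>
  The cocharacter lattices of the tori of dimension n and d are \<open>int ^ 'n\<close> and \<open>int ^ 'd\<close>; their
  duals are identified with the same types by means of the dual bases.
\<close>

definition real_vec :: "int ^ 'd \<Rightarrow> real ^ 'd" where
  "real_vec x = (\<chi> j. real_of_int (x $ j))"

definition kernel_lattice :: "('n::finite \<Rightarrow> int ^ 'd) \<Rightarrow> (int ^ 'n) set" where
  "kernel_lattice a = {x. (\<Sum>i\<in>UNIV. x $ i *s a i) = 0}"

definition hyperplane :: "('n \<Rightarrow> int ^ 'd::finite) \<Rightarrow> int ^ 'n \<Rightarrow> 'n \<Rightarrow> (real ^ 'd) set" where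
  "hyperplane a r i = {v. v \<bullet> real_vec (a i) + real_of_int (r $ i) = 0}"

text \<open>
  The hyperplanes form a family: subsets are subsets of the index set, so two coinciding hyperplanes
  with different indices already violate simplicity.
\<close>

definition simple_arrangement :: "('n::finite \<Rightarrow> int ^ 'd::finite) \<Rightarrow> int ^ 'n \<Rightarrow> bool" where
  "simple_arrangement a r \<longleftrightarrow>
     (\<forall>S. (\<Inter>i\<in>S. hyperplane a r i) \<noteq> {} \<longrightarrow>
          aff_dim (\<Inter>i\<in>S. hyperplane a r i) = int CARD('d) - int (card S))"

definition matroid_complex :: "('n \<Rightarrow> int ^ 'd::finite) \<Rightarrow> 'n set set" where
  "matroid_complex a =
     {S. inj_on (\<lambda>i. real_vec (a i)) S \<and> independent ((\<lambda>i. real_vec (a i)) ` S)}"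

definition face_number :: "('n \<Rightarrow> int ^ 'd::finite) \<Rightarrow> nat \<Rightarrow> nat" where
  "face_number a i = card {S \<in> matroid_complex a. card S = i}"

definition h_poly :: "('n \<Rightarrow> int ^ 'd::finite) \<Rightarrow> real poly" where
  "h_poly a = (\<Sum>i\<le>CARD('d).
      of_nat (face_number a i) * [:0, 1:] ^ i * [:1, - 1:] ^ (CARD('d) - i))"

section \<open>The moment map\<close>

text \<open>
  For an abelian group \<open>M\<close>, \<open>lattice_dual K\<close> with values in \<open>M\<close> represents \<open>Hom(K, M)\<close>; values
  outside \<open>K\<close> are irrelevant. As the kernel lattice is free of finite rank, \<open>M = \<complex>\<close> gives the
  complexification of its dual.
\<close>

definition lattice_dual :: "(int ^ 'n) set \<Rightarrow> (int ^ 'n \<Rightarrow> 'm::ab_group_add) set" where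
  "lattice_dual K = {f. \<forall>x\<in>K. \<forall>y\<in>K. f (x + y) = f x + f y}"

text \<open>
  \<open>moment z w\<close> is the functional sending \<open>x\<close> to the sum of the \<open>x\<^sub>i z\<^sub>i w\<^sub>i\<close>; restricting it to
  the kernel lattice (the pull-back along the inclusion) gives the moment map. It is used both for
  complex points and for the tautological point with values in the polynomial ring.
\<close>

definition moment :: "('n::finite \<Rightarrow> 'b::comm_ring_1) \<Rightarrow> ('n \<Rightarrow> 'b) \<Rightarrow> int ^ 'n \<Rightarrow> 'b" where
  "moment z w x = (\<Sum>i\<in>UNIV. of_int (x $ i) * z i * w i)"

definition complex_moment :: "(complex ^ 'n::finite) \<times> (complex ^ 'n) \<Rightarrow> int ^ 'n \<Rightarrow> complex" where
  "complex_moment p x = moment (($) (fst p)) (($) (snd p)) x"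

definition regular_value :: "('n::finite \<Rightarrow> int ^ 'd) \<Rightarrow> (int ^ 'n \<Rightarrow> int) \<Rightarrow> bool" where
  "regular_value a lam \<longleftrightarrow>
     (\<forall>p. (\<forall>x\<in>kernel_lattice a. complex_moment p x = of_int (lam x)) \<longrightarrow>
       (\<forall>\<phi>\<in>lattice_dual (kernel_lattice a). \<exists>u. \<forall>x\<in>kernel_lattice a.
          frechet_derivative (\<lambda>p. complex_moment p x) (at p) u = \<phi> x))"

section \<open>Field-valued points of Proj\<close>

text \<open>
  A graded ring is given by a commutative ring \<open>R\<close> and additive subgroups \<open>S m\<close> of \<open>R\<close> with
  \<open>\<one> \<in> S 0\<close> and \<open>S l \<cdot> S m \<subseteq> S (l + m)\<close>. It stands for the external direct sum of the \<open>S m\<close>,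
  since different \<open>S m\<close> may intersect inside \<open>R\<close>. A homogeneous ideal is the family \<open>P\<close> of its graded
  pieces; its primality can be tested on homogeneous elements.
\<close>

definition homogeneous_ideal ::
  "('a, 'b) ring_scheme \<Rightarrow> (nat \<Rightarrow> 'a set) \<Rightarrow> (nat \<Rightarrow> 'a set) \<Rightarrow> bool" where
  "homogeneous_ideal R S P \<longleftrightarrow>
     (\<forall>m. P m \<subseteq> S m \<and> additive_subgroup (P m) R) \<and>
     (\<forall>l m. \<forall>f\<in>S l. \<forall>g\<in>P m. f \<otimes>\<^bsub>R\<^esub> g \<in> P (l + m))"

definition homogeneous_prime ::
  "('a, 'b) ring_scheme \<Rightarrow> (nat \<Rightarrow> 'a set) \<Rightarrow> (nat \<Rightarrow> 'a set) \<Rightarrow> bool" where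
  "homogeneous_prime R S P \<longleftrightarrow>
     homogeneous_ideal R S P \<and> \<one>\<^bsub>R\<^esub> \<notin> P 0 \<and>
     (\<forall>l m. \<forall>f\<in>S l. \<forall>g\<in>S m. f \<otimes>\<^bsub>R\<^esub> g \<in> P (l + m) \<longrightarrow> f \<in> P l \<or> g \<in> P m)"

definition proj_points :: "('a, 'b) ring_scheme \<Rightarrow> (nat \<Rightarrow> 'a set) \<Rightarrow> (nat \<Rightarrow> 'a set) set" where
  "proj_points R S = {P. homogeneous_prime R S P \<and> (\<exists>m>0. P m \<noteq> S m)}"

text \<open>
  The local ring of Proj at \<open>P\<close> consists of the fractions \<open>g / f\<close> with \<open>g \<in> S m\<close>, \<open>f \<in> S m - P m\<close>,
  and its maximal ideal of those with \<open>g \<in> P m\<close>. Below, \<open>\<theta> (m, g, f)\<close> is the image of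
  \<open>g / f\<close> under a ring homomorphism from the residue field at \<open>P\<close> to \<open>F\<close>. That \<open>\<theta>\<close> depends only
  on the fraction follows from \<open>\<theta> (gh / fh) = \<theta> (g / f) \<theta> (h / h)\<close>, and additivity need only
  be asked for a common denominator.
\<close>

definition fractions_at ::
  "(nat \<Rightarrow> 'a set) \<Rightarrow> (nat \<Rightarrow> 'a set) \<Rightarrow> (nat \<times> 'a \<times> 'a) set" where
  "fractions_at S P = {(m, g, f). g \<in> S m \<and> f \<in> S m - P m}"

definition residue_field_homs ::
  "('a, 'b) ring_scheme \<Rightarrow> (nat \<Rightarrow> 'a set) \<Rightarrow> (nat \<Rightarrow> 'a set) \<Rightarrow> ('f, 'c) ring_scheme \<Rightarrow>
   (nat \<times> 'a \<times> 'a \<Rightarrow> 'f) set" where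
  "residue_field_homs R S P F = {\<theta> \<in> fractions_at S P \<rightarrow>\<^sub>E carrier F.
     (\<forall>m. \<forall>f\<in>S m - P m. \<theta> (m, f, f) = \<one>\<^bsub>F\<^esub>) \<and>
     (\<forall>m. \<forall>g\<in>S m. \<forall>g'\<in>S m. \<forall>f\<in>S m - P m.
        \<theta> (m, g \<oplus>\<^bsub>R\<^esub> g', f) = \<theta> (m, g, f) \<oplus>\<^bsub>F\<^esub> \<theta> (m, g', f)) \<and>
     (\<forall>l m. \<forall>g\<in>S l. \<forall>f\<in>S l - P l. \<forall>g'\<in>S m. \<forall>f'\<in>S m - P m.
        \<theta> (l + m, g \<otimes>\<^bsub>R\<^esub> g', f \<otimes>\<^bsub>R\<^esub> f') = \<theta> (l, g, f) \<otimes>\<^bsub>F\<^esub> \<theta> (m, g', f')) \<and>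
     (\<forall>m. \<forall>g\<in>P m. \<forall>f\<in>S m - P m. \<theta> (m, g, f) = \<zero>\<^bsub>F\<^esub>)}"

text \<open>
  A morphism from Spec \<open>F\<close> to a scheme, \<open>F\<close> a field, is a point of the scheme together with a
  homomorphism from the residue field at that point to \<open>F\<close>.
\<close>

definition proj_field_points ::
  "('a, 'b) ring_scheme \<Rightarrow> (nat \<Rightarrow> 'a set) \<Rightarrow> ('f, 'c) ring_scheme \<Rightarrow>
   ((nat \<Rightarrow> 'a set) \<times> (nat \<times> 'a \<times> 'a \<Rightarrow> 'f)) set" where
  "proj_field_points R S F = (SIGMA P : proj_points R S. residue_field_homs R S P F)"

section \<open>The GIT quotient\<close>

text \<open>
  The polynomial ring over the integers in the coordinates \<open>z\<^sub>i\<close> (variable \<open>Inl i\<close>) and \<open>w\<^sub>i\<close>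
  (variable \<open>Inr i\<close>).
\<close>

type_synonym 'n cot_poly = "(('n + 'n) \<Rightarrow>\<^sub>0 nat) \<Rightarrow>\<^sub>0 int"

definition coord :: "'n + 'n \<Rightarrow> 'n cot_poly" where
  "coord v = Poly_Mapping.single (Poly_Mapping.single v 1) 1"

definition univ_ring :: "'a::comm_ring_1 ring" where
  "univ_ring = \<lparr>carrier = UNIV, mult = (*), one = 1, zero = 0, add = (+)\<rparr>"

definition fibre_ideal ::
  "('n::finite \<Rightarrow> int ^ 'd) \<Rightarrow> (int ^ 'n \<Rightarrow> int) \<Rightarrow> 'n cot_poly set" where
  "fibre_ideal a lam = genideal univ_ring
     ((\<lambda>x. moment (\<lambda>i. coord (Inl i)) (\<lambda>i. coord (Inr i)) x - of_int (lam x)) ` kernel_lattice a)"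

definition fibre_ring ::
  "('n::finite \<Rightarrow> int ^ 'd) \<Rightarrow> (int ^ 'n \<Rightarrow> int) \<Rightarrow> 'n cot_poly set ring" where
  "fibre_ring a lam = univ_ring Quot fibre_ideal a lam"

text \<open>
  The torus \<open>T\<^sup>n\<close> has character lattice \<open>int ^ 'n\<close>, and the character \<open>v\<close> of \<open>T\<^sup>d\<close> pulls back
  to the character with components \<open>v \<cdot> a\<^sub>i\<close>. The group scheme \<open>T\<^sup>k\<close>, being the kernel of
  \<open>T\<^sup>n \<rightarrow> T\<^sup>d\<close>, is diagonalizable, and its character group is the quotient of \<open>int ^ 'n\<close> by the
  subgroup of these pull-backs. This quotient may have torsion: \<open>T\<^sup>k\<close> may be disconnected.
\<close>

definition trivial_characters :: "('n::finite \<Rightarrow> int ^ 'd::finite) \<Rightarrow> (int ^ 'n) set" where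
  "trivial_characters a = range (\<lambda>v. \<chi> i. \<Sum>j\<in>UNIV. v $ j * a i $ j)"

text \<open>
  Substituting \<open>(t z, t\<^sup>-\<^sup>1 w)\<close> for \<open>(z, w)\<close> multiplies a monomial by the character of \<open>T\<^sup>n\<close> given by
  its \<open>z\<close>-exponents minus its \<open>w\<close>-exponents.
\<close>

definition weight :: "(('n + 'n) \<Rightarrow>\<^sub>0 nat) \<Rightarrow> int ^ 'n" where
  "weight e = (\<chi> i. int (Poly_Mapping.lookup e (Inl i)) - int (Poly_Mapping.lookup e (Inr i)))"

text \<open>
  An action of a diagonalizable group scheme on an affine scheme is a grading of the coordinate
  ring by the character group. The functions \<open>f\<close> with \<open>f (t \<cdot> x) = \<chi> (t) f (x)\<close> for \<open>t\<close> in \<open>T\<^sup>k\<close>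
  (scheme-theoretically) are those of weight \<open>\<chi>\<close>. The ideal of the fibre is generated by functions
  of weight 0, so the quotient ring is graded by the images of the weight spaces.
\<close>

definition weight_space ::
  "('n::finite \<Rightarrow> int ^ 'd::finite) \<Rightarrow> int ^ 'n \<Rightarrow> 'n cot_poly set" where
  "weight_space a ch = {f. \<forall>e\<in>Poly_Mapping.keys f. weight e - ch \<in> trivial_characters a}"

definition semi_invariants ::
  "('n::finite \<Rightarrow> int ^ 'd::finite) \<Rightarrow> (int ^ 'n \<Rightarrow> int) \<Rightarrow> int ^ 'n \<Rightarrow> nat \<Rightarrow> 'n cot_poly set set" where
  "semi_invariants a lam r m =
     (\<lambda>f. fibre_ideal a lam +>\<^bsub>univ_ring\<^esub> f) ` weight_space a (of_nat m *s r)"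

text \<open>
  The GIT quotient is Proj of the ring of semi-invariants for the non-negative multiples of the
  character \<open>r\<close> restricted to \<open>T\<^sup>k\<close>. It is represented by its functor of field-valued points.
\<close>

definition hypertoric_points ::
  "('n::finite \<Rightarrow> int ^ 'd::finite) \<Rightarrow> int ^ 'n \<Rightarrow> (int ^ 'n \<Rightarrow> int) \<Rightarrow> ('f, 'c) ring_scheme \<Rightarrow>
   ((nat \<Rightarrow> 'n cot_poly set set) \<times>
    (nat \<times> 'n cot_poly set \<times> 'n cot_poly set \<Rightarrow> 'f)) set" where
  "hypertoric_points a r lam F = proj_field_points (fibre_ring a lam) (semi_invariants a lam r) F"

section \<open>Polynomial point count\<close>

text \<open>
  \<open>X F\<close> is the set of \<open>F\<close>-valued points. Every finite field is isomorphic to one whose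
  carrier is a set of natural numbers, so it suffices to let \<open>F\<close> range over these; the bound \<open>N\<close>
  has to be chosen before \<open>F\<close>.
\<close>

definition polynomial_point_count :: "(nat ring \<Rightarrow> 'x set) \<Rightarrow> real poly \<Rightarrow> bool" where
  "polynomial_point_count X \<nu> \<longleftrightarrow>
     (\<exists>N. \<forall>p e (F :: nat ring).
        Factorial_Ring.prime p \<and> p > N \<and> e > 0 \<and> Ring.field F \<and>
        finite (carrier F) \<and> card (carrier F) = p ^ e \<longrightarrow>
        finite (X F) \<and> real (card (X F)) = poly \<nu> (real (p ^ e)))"

end

theory Submission
  imports Defs "HOL-Algebra.Multiplicative_Group" "HOL-Algebra.Free_Abelian_Groups"
begin

text \<open>
  Let \<open>F\<close> be a finite field with \<open>q\<close> elements, of large characteristic. Regularity of \<open>\<lambda>\<close> makes every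
  point of the fibre stable, so that Proj is in bijection with Spec of the ring of invariants on
  \<open>F\<close>-points: every homomorphism to \<open>F\<close> on the invariants is nonzero on a product of two
  semi-invariants of opposite nonzero degrees, and this determines its extension to positive degrees.
  A point of the invariant ring is a homomorphism on the monoid of invariant monomials. It has
  coordinates \<open>u\<^sub>i = z\<^sub>i w\<^sub>i\<close> in an affine space \<open>L\<close> of dimension \<open>d\<close>, and \<open>Z = {i. u\<^sub>i = 0}\<close> is always
  independent. The points above \<open>u\<close> are characters of the rank \<open>d\<close> lattice of invariant weights,
  except that each \<open>i \<in> Z\<close> allows three cases (\<open>z\<^sub>i \<noteq> 0\<close>, \<open>w\<^sub>i \<noteq> 0\<close>, or both zero, which lowers the rank by
  one); so there are \<open>(2q - 1)^|Z| (q - 1)^(d - |Z|)\<close> of them. Expanding this as a sum over the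
  subsets of \<open>Z\<close> and counting the \<open>u \<in> L\<close> that vanish on a given independent set gives the sum of
  \<open>q^d (q - 1)^(d - |S|)\<close> over the faces \<open>S\<close> of the matroid complex.
\<close>

section \<open>Relations among the normal vectors\<close>

text \<open>Counting is done in the ring of invariants and not by orbits of \<open>F\<close>-points:
  \<open>T^k\<close> may be disconnected and stabilizers finite but nontrivial, so an
  \<open>F\<close>-point of the quotient need not lift to an \<open>F\<close>-point of the fibre.
  The zero set \<open>Z\<close> is independent for this reason. If \<lambda> vanished on every
  relation supported in a dependent set \<open>S\<close>, some complex point of the fibre would have
  \<open>z\<close> and \<open>w\<close> both zero on \<open>S\<close>, and the moment map would be
  critical there. So some relation supported in \<open>S\<close> has a nonzero integer as its
  \<lambda>-value; a prime larger than all these integers keeps them nonzero in \<open>F\<close>.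
  Independence of \<open>Z\<close> also yields the semi-invariants of opposite degrees: a multiple
  \<open>D r\<close> can be changed by a trivial character to a weight that is zero on
  \<open>Z\<close>, and the monomials of this weight and of its negative multiply to a product of
  nonzero \<open>z_i w_i\<close>. The factor \<open>2q - 1\<close> arises as
  \<open>2(q - 1) + 1\<close> from the three cases at \<open>i\<close>, but is expanded as
  \<open>q + (q - 1)\<close>: the power \<open>q^|S|\<close> then meets the
  \<open>q^(d - |S|)\<close> points \<open>u\<close> vanishing on \<open>S\<close>, which leaves
  \<open>q^d\<close> for every face.\<close>

definition int_subgroup :: "(int ^ 'n) set \<Rightarrow> bool" where
  "int_subgroup G \<longleftrightarrow> 0 \<in> G \<and> (\<forall>x\<in>G. \<forall>y\<in>G. x - y \<in> G)"

lemma int_subgroup_0: "int_subgroup G \<Longrightarrow> 0 \<in> G"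
  and int_subgroup_diff: "int_subgroup G \<Longrightarrow> x \<in> G \<Longrightarrow> y \<in> G \<Longrightarrow> x - y \<in> G"
  by (auto simp: int_subgroup_def)

lemma int_subgroup_neg: "int_subgroup G \<Longrightarrow> x \<in> G \<Longrightarrow> - x \<in> G"
  using int_subgroup_diff[of G 0 x] int_subgroup_0[of G] by simp

lemma int_subgroup_add: "int_subgroup G \<Longrightarrow> x \<in> G \<Longrightarrow> y \<in> G \<Longrightarrow> x + y \<in> G"
  using int_subgroup_diff[of G x "- y"] int_subgroup_neg[of G y] by simp

lemma int_subgroup_scale: assumes "int_subgroup G" "x \<in> G" shows "k *s x \<in> G"
proof -
  have *: "int m *s x \<in> G" for m
  proof (induction m)
    case 0 show ?case using assms by (simp add: int_subgroup_0)
  next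
    case (Suc m)
    have "int (Suc m) *s x = int m *s x + x" by (simp add: vec_eq_iff algebra_simps)
    then show ?case using Suc assms int_subgroup_add by metis
  qed
  show ?thesis
  proof (cases "k \<ge> 0")
    case True then show ?thesis using *[of "nat k"] by simp
  next
    case False
    then have "- (int (nat (- k)) *s x) \<in> G" using * int_subgroup_neg[OF assms(1)] by blast
    moreover have "- (int (nat (- k)) *s x) = k *s x" using False by (simp add: vec_eq_iff)
    ultimately show ?thesis by simp
  qed
qed

lemma int_subgroup_sum:
  assumes "int_subgroup G" "\<And>i. i \<in> I \<Longrightarrow> f i \<in> G" shows "sum f I \<in> G"
  using assms(2) by (induction I rule: infinite_finite_induct) (auto simp: assms(1) int_subgroup_0 int_subgroup_add)

lemma int_subgroup_vanish1: "int_subgroup G \<Longrightarrow> int_subgroup {x \<in> G. x $ i = 0}"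
  by (auto simp: int_subgroup_def)

text \<open>Linear independence of the coordinate functionals at the indices in \<open>Z\<close> on
  \<open>G\<close>, in the form of an integral dual family. The vector belonging to \<open>i\<close>
  is the direction along which characters of \<open>G\<close> are split at \<open>i\<close>.\<close>

definition coords_indep :: "(int ^ 'n) set \<Rightarrow> 'n set \<Rightarrow> bool" where
  "coords_indep G Z \<longleftrightarrow> (\<forall>i\<in>Z. \<exists>x\<in>G. x $ i > 0 \<and> (\<forall>j\<in>Z - {i}. x $ j = 0))"

lemma coords_indep_subset: "coords_indep G Z \<Longrightarrow> Z' \<subseteq> Z \<Longrightarrow> coords_indep G Z'"
  unfolding coords_indep_def by fast

lemma coords_indep_vanish1:
  "coords_indep G Z \<Longrightarrow> i \<in> Z \<Longrightarrow> coords_indep {x \<in> G. x $ i = 0} (Z - {i})"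
  unfolding coords_indep_def by fastforce

lemma int_subgroup_kernel_lattice: "int_subgroup (kernel_lattice a)"
  by (auto simp: int_subgroup_def kernel_lattice_def sum_subtractf vector_sub_rdistrib)

lemma kernel_lattice_iff:
  "x \<in> kernel_lattice a \<longleftrightarrow> (\<forall>j. (\<Sum>i\<in>UNIV. x $ i * a i $ j) = 0)"
  by (simp add: kernel_lattice_def vec_eq_iff)

text \<open>Linear independence of the family \<open>a i\<close>, \<open>i \<in> S\<close>, over the
  integers. Stated through relations, it keeps equal vectors with different indices apart and
  involves no field of scalars.\<close>

definition rel_free :: "('n::finite \<Rightarrow> int ^ 'd) \<Rightarrow> 'n set \<Rightarrow> bool" where
  "rel_free a S \<longleftrightarrow> (\<forall>x\<in>kernel_lattice a. (\<forall>i. i \<notin> S \<longrightarrow> x $ i = 0) \<longrightarrow> x = 0)"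

lemma rel_free_subset:
  assumes "rel_free a S" "T \<subseteq> S" shows "rel_free a T"
  unfolding rel_free_def
proof (intro ballI impI)
  fix x assume "x \<in> kernel_lattice a" "\<forall>i. i \<notin> T \<longrightarrow> x $ i = 0"
  moreover from this have "\<forall>i. i \<notin> S \<longrightarrow> x $ i = 0" using assms(2) by (metis subsetD)
  ultimately show "x = 0" using assms(1) unfolding rel_free_def by blast
qed

text \<open>Rational scalars mediate between the lattice and linear algebra: unlike real
  coefficients, they have a common denominator and so lead back to lattice elements.\<close>

definition rat_vec :: "int ^ 'd \<Rightarrow> rat ^ 'd" where
  "rat_vec x = (\<chi> j. of_int (x $ j))"

lemma clear_denominators:
  assumes "finite I"
  shows "\<exists>D::int. D > 0 \<and> (\<forall>i\<in>I. \<exists>k::int. of_int D * c i = (of_int k :: rat))"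
  using assms
proof induction
  case empty show ?case by (auto intro: exI[of _ 1])
next
  case (insert i I)
  then obtain D :: int where D: "D > 0" "\<forall>i\<in>I. \<exists>k::int. of_int D * c i = (of_int k :: rat)" by blast
  obtain p q where pq: "c i = Fract p q" "q > 0" by (cases "c i") auto
  have "of_int (D * q) * c i = (of_int (D * p) :: rat)"
    using pq by (simp add: Fract_of_int_quotient)
  moreover have "\<exists>k::int. of_int (D * q) * c j = (of_int k :: rat)" if j: "j \<in> I" for j
  proof -
    obtain k :: int where "of_int D * c j = (of_int k :: rat)" using D j by blast
    then have "of_int (D * q) * c j = (of_int (q * k) :: rat)" by (simp add: algebra_simps)
    then show ?thesis by blast
  qed
  ultimately have "\<forall>j\<in>insert i I. \<exists>k::int. of_int (D * q) * c j = (of_int k :: rat)" by blast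
  moreover have "D * q > 0" using D pq by simp
  ultimately show ?case by blast
qed

lemma rel_free_rat:
  fixes a :: "'n::finite \<Rightarrow> int ^ 'd::finite"
  assumes "rel_free a S"
  shows "inj_on (\<lambda>i. rat_vec (a i)) S" "vec.independent ((\<lambda>i. rat_vec (a i)) ` S)"
proof -
  show inj: "inj_on (\<lambda>i. rat_vec (a i)) S"
  proof (rule inj_onI, rule ccontr)
    fix i j assume ij: "i \<in> S" "j \<in> S" "rat_vec (a i) = rat_vec (a j)" "i \<noteq> j"
    define x :: "int ^ 'n" where "x = axis i 1 - axis j 1"
    have "a i = a j" using ij by (simp add: rat_vec_def vec_eq_iff)
    then have "x \<in> kernel_lattice a"
      by (simp add: x_def kernel_lattice_iff axis_def left_diff_distrib sum_subtractf if_distrib[of "\<lambda>c. c * _"] cong: if_cong)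
    moreover have "x \<noteq> 0" using ij by (auto simp: x_def axis_def vec_eq_iff intro: exI[of _ i])
    moreover have "\<forall>k. k \<notin> S \<longrightarrow> x $ k = 0" using ij by (auto simp: x_def axis_def)
    ultimately show False using assms by (auto simp: rel_free_def)
  qed
  show "vec.independent ((\<lambda>i. rat_vec (a i)) ` S)"
  proof
    assume "vec.dependent ((\<lambda>i. rat_vec (a i)) ` S)"
    then obtain u i0 where i0: "i0 \<in> S" "u (rat_vec (a i0)) \<noteq> 0" and
      u: "(\<Sum>v\<in>(\<lambda>i. rat_vec (a i)) ` S. u v *s v) = 0"
      by (subst (asm) vec.dependent_finite) auto
    define c where "c i = (if i \<in> S then u (rat_vec (a i)) else 0)" for i
    have "(\<Sum>i\<in>S. u (rat_vec (a i)) *s rat_vec (a i)) = 0" using u by (simp add: sum.reindex[OF inj])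
    then have "(\<Sum>i\<in>S. c i *s rat_vec (a i)) = 0" by (simp add: c_def)
    then have "(\<Sum>i\<in>UNIV. c i *s rat_vec (a i)) = 0"
      by (subst sum.mono_neutral_right[of UNIV S]) (auto simp: c_def)
    then have c: "(\<Sum>i\<in>UNIV. c i * of_int (a i $ j)) = 0" for j
      by (auto simp: vec_eq_iff rat_vec_def)
    obtain D :: int where D: "D > 0" "\<forall>i. \<exists>k::int. of_int D * c i = (of_int k :: rat)"
      using clear_denominators[of UNIV c] by auto
    from D(2) obtain k where k: "\<And>i. of_int D * c i = (of_int (k i) :: rat)" by metis
    define x where "x = (\<chi> i. k i)"
    have "x \<in> kernel_lattice a"
      unfolding kernel_lattice_iff
    proof
      fix j
      have "of_int (\<Sum>i\<in>UNIV. x $ i * a i $ j) = of_int D * (\<Sum>i\<in>UNIV. c i * (of_int (a i $ j) :: rat))"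
        by (simp add: x_def sum_distrib_left flip: k mult.assoc)
      also have "\<dots> = of_int 0" using c by simp
      finally show "(\<Sum>i\<in>UNIV. x $ i * a i $ j) = 0" by (simp only: of_int_eq_iff)
    qed
    moreover have "x $ i = 0" if "i \<notin> S" for i
      using k[of i] that by (simp add: c_def x_def)
    moreover have "x $ i0 \<noteq> 0" using k[of i0] i0 D by (auto simp: c_def x_def)
    ultimately show False using assms by (auto simp: rel_free_def)
  qed
qed

lemma rel_free_card:
  fixes a :: "'n::finite \<Rightarrow> int ^ 'd::finite"
  assumes "rel_free a S" shows "card S \<le> CARD('d)"
  using rel_free_rat[OF assms] vec.independent_card_le_dim[of "(\<lambda>i. rat_vec (a i)) ` S" UNIV]
  by (simp add: card_image card_cart_basis)

lemma trivial_characters_iff: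
  "x \<in> trivial_characters a \<longleftrightarrow> (\<exists>v. \<forall>i. x $ i = (\<Sum>j\<in>UNIV. v $ j * a i $ j))"
  by (simp add: trivial_characters_def vec_eq_iff image_iff)

lemma int_subgroup_trivial_characters: "int_subgroup (trivial_characters a)"
proof -
  have "0 \<in> trivial_characters a" unfolding trivial_characters_iff by (rule exI[of _ 0]) simp
  moreover have "x - y \<in> trivial_characters a" if xy: "x \<in> trivial_characters a" "y \<in> trivial_characters a" for x y
  proof -
    obtain v w where "\<And>i. x $ i = (\<Sum>j\<in>UNIV. v $ j * a i $ j)" "\<And>i. y $ i = (\<Sum>j\<in>UNIV. w $ j * a i $ j)"
      using xy unfolding trivial_characters_iff by blast
    then have "\<forall>i. (x - y) $ i = (\<Sum>j\<in>UNIV. (v - w) $ j * a i $ j)"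
      by (simp add: left_diff_distrib sum_subtractf)
    then show ?thesis unfolding trivial_characters_iff by blast
  qed
  ultimately show ?thesis by (auto simp: int_subgroup_def)
qed

lemma trivial_characters_orthogonal:
  assumes "y \<in> trivial_characters a" "x \<in> kernel_lattice a"
  shows "(\<Sum>i\<in>UNIV. x $ i * y $ i) = 0"
proof -
  obtain v where v: "\<And>i. y $ i = (\<Sum>j\<in>UNIV. v $ j * a i $ j)" using assms unfolding trivial_characters_iff by blast
  have "(\<Sum>i\<in>UNIV. x $ i * y $ i) = (\<Sum>i\<in>UNIV. \<Sum>j\<in>UNIV. v $ j * (x $ i * a i $ j))"
    by (simp add: v sum_distrib_left mult_ac)
  also have "\<dots> = (\<Sum>j\<in>UNIV. v $ j * (\<Sum>i\<in>UNIV. x $ i * a i $ j))"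
    by (subst sum.swap) (simp add: sum_distrib_left)
  finally show ?thesis using assms(2) by (simp add: kernel_lattice_iff)
qed

text \<open>By independence some rational functional is 1 on \<open>a i\<close> and 0 on the other
  \<open>a j\<close>, \<open>j \<in> S\<close>. A positive multiple of it is integral, and its
  pull-back is the required trivial character.\<close>

lemma rel_free_coords_indep:
  fixes a :: "'n::finite \<Rightarrow> int ^ 'd::finite"
  assumes "rel_free a S"
  shows "coords_indep (trivial_characters a) S"
  unfolding coords_indep_def
proof
  fix i assume i: "i \<in> S"
  \<comment> \<open>Here \<open>1\<close> is the all-ones vector: the extension \<open>g\<close> has
    values in \<open>rat ^ 'd\<close>, and any single row \<open>k0\<close> of its matrix serves as
    the functional.\<close>
  define t :: "rat ^ 'd \<Rightarrow> rat ^ 'd" where "t v = (if v = rat_vec (a i) then 1 else 0)" for v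
  from vec.linear_independent_extend[OF rel_free_rat(2)[OF assms], of t]
  obtain g where g: "Vector_Spaces.linear (*s) (*s) g" "\<And>j. j \<in> S \<Longrightarrow> g (rat_vec (a j)) = t (rat_vec (a j))"
    by auto
  fix k0 :: 'd
  define w where "w k = matrix g $ k0 $ k" for k
  have w: "(\<Sum>k\<in>UNIV. w k * of_int (a j $ k)) = (if j = i then 1 else 0)" if "j \<in> S" for j
  proof -
    have "(matrix g *v rat_vec (a j)) $ k0 = t (rat_vec (a j)) $ k0"
      using g(2)[OF that] matrix_works[OF g(1)] by simp
    moreover have "rat_vec (a j) = rat_vec (a i) \<longleftrightarrow> j = i"
      using inj_onD[OF rel_free_rat(1)[OF assms]] that i by blast
    ultimately show ?thesis by (simp add: matrix_vector_mult_def w_def rat_vec_def t_def split: if_splits)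
  qed
  obtain D :: int where D: "D > 0" "\<forall>k. \<exists>m::int. of_int D * w k = (of_int m :: rat)"
    using clear_denominators[of UNIV w] by auto
  from D(2) obtain m where m: "\<And>k. of_int D * w k = (of_int (m k) :: rat)" by metis
  define x :: "int ^ 'n" where "x = (\<chi> i. \<Sum>j\<in>UNIV. (\<chi> k. m k) $ j * a i $ j)"
  have "x \<in> trivial_characters a" unfolding x_def trivial_characters_def by blast
  moreover have "x $ j = (if j = i then D else 0)" if "j \<in> S" for j
  proof -
    have "(of_int (x $ j) :: rat) = of_int D * (\<Sum>k\<in>UNIV. w k * of_int (a j $ k))"
      by (simp add: x_def sum_distrib_left flip: m mult.assoc)
    also have "\<dots> = of_int (if j = i then D else 0)" using w[OF that] by simp
    finally show ?thesis by (simp only: of_int_eq_iff)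
  qed
  ultimately show "\<exists>x\<in>trivial_characters a. 0 < x $ i \<and> (\<forall>j\<in>S - {i}. x $ j = 0)"
    using i D(1) by (intro bexI[of _ x]) auto
qed

lemma rel_free_extend:
  fixes a :: "'n::finite \<Rightarrow> int ^ 'd::finite"
  assumes "rel_free a S" "S \<subseteq> T"
  shows "\<exists>B. S \<subseteq> B \<and> B \<subseteq> T \<and> rel_free a B \<and> (\<forall>j\<in>T - B. \<not> rel_free a (insert j B))"
proof -
  define A where "A = {B. S \<subseteq> B \<and> B \<subseteq> T \<and> rel_free a B}"
  have "finite A" "A \<noteq> {}" using assms by (auto simp: A_def)
  from finite_has_maximal[OF this] obtain B where B: "B \<in> A" and max: "\<forall>B'\<in>A. B \<subseteq> B' \<longrightarrow> B = B'"
    by (elim bexE)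
  have "\<not> rel_free a (insert j B)" if "j \<in> T - B" for j
    using B bspec[OF max, of "insert j B"] that by (auto simp: A_def)
  then show ?thesis using B by (auto simp: A_def)
qed

lemma not_rel_free_insert:
  assumes "rel_free a B" "\<not> rel_free a (insert j B)"
  shows "\<exists>x\<in>kernel_lattice a. x $ j > 0 \<and> (\<forall>k. k \<notin> insert j B \<longrightarrow> x $ k = 0)"
proof -
  obtain x where x: "x \<in> kernel_lattice a" "\<And>k. k \<notin> insert j B \<Longrightarrow> x $ k = 0" "x \<noteq> 0"
    using assms(2) by (auto simp: rel_free_def)
  have "x $ j \<noteq> 0"
  proof
    assume "x $ j = 0"
    then have "\<forall>k. k \<notin> B \<longrightarrow> x $ k = 0" using x(2) by (metis insertE)
    then show False using assms(1) x(1,3) by (auto simp: rel_free_def)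
  qed
  moreover have "- x \<in> kernel_lattice a" using x(1) int_subgroup_neg int_subgroup_kernel_lattice by blast
  ultimately show ?thesis
    using x by (cases "x $ j > 0") (force intro: bexI[of _ x], force intro: bexI[of _ "- x"])
qed

text \<open>The fundamental circuits of a basis \<open>B\<close>: \<open>Y j\<close> expresses
  \<open>a j\<close> through \<open>B\<close>, scaled so that all leading coefficients are the same
  number \<open>C\<close>. They generate the kernel lattice only after inverting \<open>C\<close>,
  so \<open>C\<close> has to be nonzero in any field where they are used to solve equations.\<close>

definition kernel_basis :: "('n::finite \<Rightarrow> int ^ 'd) \<Rightarrow> 'n set \<Rightarrow> int \<Rightarrow> ('n \<Rightarrow> int ^ 'n) \<Rightarrow> bool" where
  "kernel_basis a B C Y \<longleftrightarrow> rel_free a B \<and> C > 0 \<and>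
     (\<forall>j. j \<notin> B \<longrightarrow> Y j \<in> kernel_lattice a \<and> Y j $ j = C \<and> (\<forall>k. k \<notin> B \<longrightarrow> k \<noteq> j \<longrightarrow> Y j $ k = 0))"

lemma kernel_basisD:
  assumes "kernel_basis a B C Y"
  shows "rel_free a B" "C > 0" "\<And>j. j \<notin> B \<Longrightarrow> Y j \<in> kernel_lattice a"
    "\<And>j. j \<notin> B \<Longrightarrow> Y j $ j = C" "\<And>j k. j \<notin> B \<Longrightarrow> k \<notin> B \<Longrightarrow> k \<noteq> j \<Longrightarrow> Y j $ k = 0"
  using assms by (auto simp: kernel_basis_def)

text \<open>\<open>B\<close> is grown from a maximal free subset \<open>B0\<close> of
  \<open>S\<close>, so for \<open>j \<in> S - B\<close> the circuit of \<open>j\<close> already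
  closes up inside \<open>insert j B0\<close>, hence inside \<open>S\<close>. The support condition
  serves dependent \<open>S\<close>, the inclusion \<open>S \<subseteq> B\<close> serves independent
  ones.\<close>

lemma ex_kernel_basis:
  fixes a :: "'n::finite \<Rightarrow> int ^ 'd::finite"
  shows "\<exists>B C Y. kernel_basis a B C Y \<and> (\<forall>j\<in>S - B. \<forall>k. k \<notin> S \<longrightarrow> Y j $ k = 0) \<and> (rel_free a S \<longrightarrow> S \<subseteq> B)"
proof -
  have "rel_free a {}" by (auto simp: rel_free_def vec_eq_iff)
  from rel_free_extend[OF this, of S] obtain B0 where B0: "B0 \<subseteq> S" "rel_free a B0"
    "\<And>j. j \<in> S - B0 \<Longrightarrow> \<not> rel_free a (insert j B0)" by blast
  from rel_free_extend[OF B0(2), of UNIV] obtain B where B: "B0 \<subseteq> B" "rel_free a B"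
    "\<And>j. j \<notin> B \<Longrightarrow> \<not> rel_free a (insert j B)" by auto
  have ex: "\<exists>x\<in>kernel_lattice a. x $ j > 0 \<and> (\<forall>k. k \<notin> insert j B \<longrightarrow> x $ k = 0) \<and> (j \<in> S \<longrightarrow> (\<forall>k. k \<notin> S \<longrightarrow> x $ k = 0))"
    if j: "j \<notin> B" for j
  proof (cases "j \<in> S")
    case True
    then have "j \<in> S - B0" using j B by blast
    from not_rel_free_insert[OF B0(2) B0(3)[OF this]] obtain x where
      x: "x \<in> kernel_lattice a" "x $ j > 0" "\<And>k. k \<notin> insert j B0 \<Longrightarrow> x $ k = 0" by blast
    have "x $ k = 0" if "k \<notin> insert j B" for k using x(3)[of k] that B(1) by blast
    moreover have "x $ k = 0" if "k \<notin> S" for k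
    proof (rule x(3)) show "k \<notin> insert j B0" using that B0(1) True by auto qed
    ultimately show ?thesis using x(1,2) by blast
  next
    case False then show ?thesis using not_rel_free_insert[OF B(2) B(3)[OF j]] by blast
  qed
  then obtain X where X: "\<And>j. j \<notin> B \<Longrightarrow> X j \<in> kernel_lattice a" "\<And>j. j \<notin> B \<Longrightarrow> X j $ j > 0"
    "\<And>j k. j \<notin> B \<Longrightarrow> k \<notin> insert j B \<Longrightarrow> X j $ k = 0" "\<And>j k. j \<notin> B \<Longrightarrow> j \<in> S \<Longrightarrow> k \<notin> S \<Longrightarrow> X j $ k = 0"
    by metis
  \<comment> \<open>Scaling each circuit up to the product of all leading coefficients gives them a
    common one and leaves the supports unchanged.\<close>
  define C where "C = (\<Prod>j\<in>-B. X j $ j)"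
  have C: "C > 0" using X(2) by (auto simp: C_def intro: prod_pos)
  define Y where "Y j = (C div (X j $ j)) *s X j" for j
  have dvd: "X j $ j dvd C" if "j \<notin> B" for j using that by (auto simp: C_def intro: dvd_prodI)
  have 5: "S \<subseteq> B" if "rel_free a S"
  proof -
    have "S \<subseteq> B0"
    proof
      fix j assume "j \<in> S"
      have "rel_free a (insert j B0)"
        using rel_free_subset[OF that] \<open>j \<in> S\<close> B0(1) by simp
      then show "j \<in> B0" using B0(3) \<open>j \<in> S\<close> by blast
    qed
    then show ?thesis using B(1) by blast
  qed
  have 1: "Y j \<in> kernel_lattice a" if "j \<notin> B" for j
    unfolding Y_def by (rule int_subgroup_scale[OF int_subgroup_kernel_lattice X(1)[OF that]])
  have 2: "Y j $ j = C" if "j \<notin> B" for j using dvd[OF that] by (simp add: Y_def)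
  have 3: "Y j $ k = 0" if "j \<notin> B" "k \<notin> B" "k \<noteq> j" for j k using X(3)[of j k] that by (simp add: Y_def)
  have 4: "Y j $ k = 0" if "j \<in> S - B" "k \<notin> S" for j k using X(4)[of j k] that by (simp add: Y_def)
  have "kernel_basis a B C Y" using B(2) C 1 2 3 by (simp add: kernel_basis_def)
  then show ?thesis using 4 5 by blast
qed

text \<open>Both sides agree off \<open>B\<close>, where each coordinate is nonzero in only one
  \<open>Y j\<close>. Their difference is therefore a relation supported in the free set
  \<open>B\<close>, hence zero.\<close>

lemma kernel_basis_span:
  assumes kb: "kernel_basis a B C Y" and x: "x \<in> kernel_lattice a"
  shows "C *s x = (\<Sum>j\<in>-B. x $ j *s Y j)"
proof -
  note K = int_subgroup_kernel_lattice[of a]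
  note B = kernel_basisD(1)[OF kb] and Y = kernel_basisD(3-5)[OF kb]
  have "C *s x - (\<Sum>j\<in>-B. x $ j *s Y j) \<in> kernel_lattice a"
    using Y(1) x by (intro int_subgroup_diff[OF K] int_subgroup_scale[OF K] int_subgroup_sum[OF K]) auto
  moreover have "(C *s x - (\<Sum>j\<in>-B. x $ j *s Y j)) $ k = 0" if k: "k \<notin> B" for k
  proof -
    have "(\<Sum>j\<in>-B. x $ j * Y j $ k) = (\<Sum>j\<in>-B. if j = k then x $ k * C else 0)"
      using Y(2,3) k by (intro sum.cong) auto
    then show ?thesis using k by simp
  qed
  ultimately have "C *s x - (\<Sum>j\<in>-B. x $ j *s Y j) = 0" using B unfolding rel_free_def by blast
  then show ?thesis by simp
qed

text \<open>The rationals bound \<open>card B\<close> from above and the rank hypothesis over the reals bounds it from below.\<close>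

lemma basis_real:
  fixes a :: "'n::finite \<Rightarrow> int ^ 'd::finite"
  assumes rank: "rank (\<chi> j i. real_of_int (a i $ j) :: real ^ 'n ^ 'd) = CARD('d)"
    and kb: "kernel_basis a B C Y"
  shows "card B = CARD('d)" "B \<in> matroid_complex a"
proof -
  note B = kernel_basisD(1)[OF kb] and C = kernel_basisD(2)[OF kb] and Y = kernel_basisD(3-5)[OF kb]
  let ?v = "\<lambda>i. real_vec (a i)"
  have mem: "?v j \<in> span (?v ` B)" for j
  proof (cases "j \<in> B")
    case True then show ?thesis by (simp add: span_base)
  next
    case False
    have rel: "(\<Sum>i\<in>UNIV. real_of_int (Y j $ i) *\<^sub>R ?v i) = 0"
    proof (subst vec_eq_iff, intro allI)
      fix k
      have "(\<Sum>i\<in>UNIV. real_of_int (Y j $ i) *\<^sub>R ?v i) $ k = real_of_int (\<Sum>i\<in>UNIV. Y j $ i * a i $ k)"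
        by (simp add: real_vec_def)
      also have "\<dots> = 0" using Y(1)[OF False] by (simp only: kernel_lattice_iff of_int_0)
      finally show "(\<Sum>i\<in>UNIV. real_of_int (Y j $ i) *\<^sub>R ?v i) $ k = 0 $ k" by simp
    qed
    have "(\<Sum>i\<in>UNIV. real_of_int (Y j $ i) *\<^sub>R ?v i) = (\<Sum>i\<in>insert j B. real_of_int (Y j $ i) *\<^sub>R ?v i)"
      using Y(3)[OF False] by (intro sum.mono_neutral_right) auto
    also have "\<dots> = real_of_int C *\<^sub>R ?v j + (\<Sum>i\<in>B. real_of_int (Y j $ i) *\<^sub>R ?v i)"
      using False Y(2) by simp
    finally have "real_of_int C *\<^sub>R ?v j = - (\<Sum>i\<in>B. real_of_int (Y j $ i) *\<^sub>R ?v i)"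
      using rel by (simp add: eq_neg_iff_add_eq_0)
    then have "?v j = (- inverse (real_of_int C)) *\<^sub>R (\<Sum>i\<in>B. real_of_int (Y j $ i) *\<^sub>R ?v i)"
      using C by (metis (no_types, lifting) of_int_0_less_iff less_irrefl real_vector_affinity_eq scaleR_minus_left scaleR_minus_right vector_fraction_eq_iff scaleR_one scaleR_scaleR left_inverse)
    then show ?thesis by (simp only:) (intro span_scale span_sum span_base imageI)
  qed
  have "columns (\<chi> j i. real_of_int (a i $ j) :: real ^ 'n ^ 'd) = range ?v"
    by (auto simp: columns_def column_def real_vec_def)
  then have d: "dim (range ?v) = CARD('d)" using rank by (simp add: column_rank_def)
  have "dim (range ?v) \<le> card (?v ` B)" using mem by (intro dim_le_card) auto
  moreover have le: "card (?v ` B) \<le> card B" by (rule card_image_le) simp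
  ultimately have cB: "card (?v ` B) = card B" "card B = CARD('d)" using rel_free_card[OF B] d by auto
  then show "card B = CARD('d)" by simp
  have "inj_on ?v B" using cB by (intro eq_card_imp_inj_on) auto
  moreover have "independent (?v ` B)"
    using cB d mem by (intro card_le_dim_spanning[of _ "range ?v"]) auto
  ultimately show "B \<in> matroid_complex a" by (simp add: matroid_complex_def)
qed

lemma matroid_complex_subset: "T \<in> matroid_complex a \<Longrightarrow> S \<subseteq> T \<Longrightarrow> S \<in> matroid_complex a"
  unfolding matroid_complex_def using inj_on_subset independent_mono image_mono by (metis (no_types, lifting) mem_Collect_eq)

text \<open>Real dependence does not give an integral relation directly. Instead a free
  \<open>S\<close> is completed to a free \<open>B\<close> with circuits for all other indices;
  \<open>B\<close> spans over the reals by the rank hypothesis, has \<open>d\<close> elements, and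
  so is independent over the reals together with its subset \<open>S\<close>.\<close>

lemma matroid_complex_iff_rel_free:
  fixes a :: "'n::finite \<Rightarrow> int ^ 'd::finite"
  assumes rank: "rank (\<chi> j i. real_of_int (a i $ j) :: real ^ 'n ^ 'd) = CARD('d)"
  shows "S \<in> matroid_complex a \<longleftrightarrow> rel_free a S"
proof
  assume "rel_free a S"
  from ex_kernel_basis[of a S] obtain B C Y where kb: "kernel_basis a B C Y" and "S \<subseteq> B"
    using \<open>rel_free a S\<close> by blast
  from basis_real(2)[OF rank kb] show "S \<in> matroid_complex a"
    using matroid_complex_subset \<open>S \<subseteq> B\<close> by blast
next
  let ?v = "\<lambda>i. real_vec (a i)"
  assume S: "S \<in> matroid_complex a"
  then have inj: "inj_on ?v S" and ind: "independent (?v ` S)" by (auto simp: matroid_complex_def)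
  show "rel_free a S"
    unfolding rel_free_def
  proof (intro ballI impI)
    fix x assume x: "x \<in> kernel_lattice a" and supp: "\<forall>i. i \<notin> S \<longrightarrow> x $ i = 0"
    have "(\<Sum>i\<in>S. real_of_int (x $ i) *\<^sub>R ?v i) = (\<Sum>i\<in>UNIV. real_of_int (x $ i) *\<^sub>R ?v i)"
      using supp by (intro sum.mono_neutral_left) auto
    also have "\<dots> = 0"
    proof (subst vec_eq_iff, intro allI)
      fix k
      have "(\<Sum>i\<in>UNIV. real_of_int (x $ i) *\<^sub>R ?v i) $ k = real_of_int (\<Sum>i\<in>UNIV. x $ i * a i $ k)"
        by (simp add: real_vec_def)
      also have "\<dots> = 0" using x by (simp only: kernel_lattice_iff of_int_0)
      finally show "(\<Sum>i\<in>UNIV. real_of_int (x $ i) *\<^sub>R ?v i) $ k = 0 $ k" by simp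
    qed
    finally have 0: "(\<Sum>v\<in>?v ` S. real_of_int (x $ the_inv_into S ?v v) *\<^sub>R v) = 0"
      by (simp add: sum.reindex[OF inj] the_inv_into_f_f[OF inj])
    have "x $ i = 0" if "i \<in> S" for i
    proof -
      have "real_of_int (x $ the_inv_into S ?v (?v i)) = 0"
        using independentD[OF ind _ order_refl 0] that by auto
      then show ?thesis using the_inv_into_f_f[OF inj that] by simp
    qed
    then show "x = 0" using supp by (metis vec_eq_iff zero_index)
  qed
qed

section \<open>Regular values of the moment map and dependent index sets\<close>

lemma lattice_dual_scale:
  fixes f :: "int ^ 'n \<Rightarrow> int"
  assumes f: "f \<in> lattice_dual K" and K: "int_subgroup K" and x: "x \<in> K"
  shows "f (int m *s x) = int m * f x"
proof (induction m)
  case 0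
  have "f (0 + 0) = f 0 + f 0" using f int_subgroup_0[OF K] unfolding lattice_dual_def by blast
  then show ?case by simp
next
  case (Suc m)
  have "f (int m *s x + x) = f (int m *s x) + f x" using f int_subgroup_scale[OF K] x unfolding lattice_dual_def by blast
  moreover have "int (Suc m) *s x = int m *s x + x" by (simp add: vec_eq_iff algebra_simps)
  ultimately show ?case using Suc by (simp add: algebra_simps)
qed

lemma lattice_dual_0:
  fixes f :: "int ^ 'n \<Rightarrow> int"
  assumes "f \<in> lattice_dual K" "int_subgroup K" shows "f 0 = 0"
  using lattice_dual_scale[OF assms int_subgroup_0[OF assms(2)], of 0] by simp

lemma lattice_dual_diff:
  fixes f :: "int ^ 'n \<Rightarrow> int"
  assumes f: "f \<in> lattice_dual K" and K: "int_subgroup K" and xy: "x \<in> K" "y \<in> K"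
  shows "f (x - y) = f x - f y"
proof -
  have "f ((x - y) + y) = f (x - y) + f y"
    using f xy int_subgroup_diff[OF K] unfolding lattice_dual_def by blast
  then show ?thesis by simp
qed

lemma complex_moment_derivative:
  "frechet_derivative (\<lambda>p. complex_moment p x) (at p) =
    (\<lambda>u. \<Sum>i\<in>UNIV. of_int (x $ i) * (fst p $ i * snd u $ i + fst u $ i * snd p $ i))"
proof (rule sym, rule frechet_derivative_at)
  have fst': "((\<lambda>p. fst p $ i) has_derivative (\<lambda>u. fst u $ i)) (at p)"
   and snd': "((\<lambda>p. snd p $ i) has_derivative (\<lambda>u. snd u $ i)) (at p)"
    for i and p :: "(complex ^ 'a) \<times> (complex ^ 'a)"
    by (intro bounded_linear_imp_has_derivative bounded_linear_compose[OF bounded_linear_vec_nth] bounded_linear_fst bounded_linear_snd)+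
  show "((\<lambda>p. complex_moment p x) has_derivative
     (\<lambda>u. \<Sum>i\<in>UNIV. of_int (x $ i) * (fst p $ i * snd u $ i + fst u $ i * snd p $ i))) (at p)"
    unfolding complex_moment_def moment_def
    by (rule has_derivative_eq_rhs, (rule derivative_intros fst' snd' has_derivative_mult)+) (simp add: algebra_simps)
qed

text \<open>If \<open>lam\<close> vanishes on all relations supported in \<open>S\<close>, it is
  represented by a complex vector \<open>u\<close> that is zero on \<open>S\<close>. This gives a
  point of the fibre with both coordinates zero on \<open>S\<close>, at which the derivative of the
  moment map annihilates every relation supported in \<open>S\<close> and so is not
  surjective.\<close>

lemma regular_value_witness:
  fixes a :: "'n::finite \<Rightarrow> int ^ 'd::finite"
  assumes lam: "lam \<in> lattice_dual (kernel_lattice a)" and regular: "regular_value a lam"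
    and S: "\<not> rel_free a S"
  shows "\<exists>x\<in>kernel_lattice a. (\<forall>i. i \<notin> S \<longrightarrow> x $ i = 0) \<and> lam x \<noteq> 0"
proof (rule ccontr)
  assume contra: "\<not> ?thesis"
  note K = int_subgroup_kernel_lattice[of a]
  from ex_kernel_basis[of a S] obtain B C Y where kb: "kernel_basis a B C Y"
    and YS: "\<And>j k. j \<in> S - B \<Longrightarrow> k \<notin> S \<Longrightarrow> Y j $ k = 0" by blast
  note C = kernel_basisD(2)[OF kb] and Y = kernel_basisD(3-5)[OF kb]
  \<comment> \<open>This solves the equation of each circuit \<open>Y j\<close> for
    \<open>u j\<close>, with \<open>u\<close> set to 0 on \<open>B\<close>. For
    \<open>j \<in> S - B\<close> the circuit is supported in \<open>S\<close>, so
    \<open>lam (Y j)\<close>, and with it \<open>u j\<close>, is zero by assumption.\<close>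
  define u :: "'n \<Rightarrow> complex" where "u j = (if j \<in> B then 0 else of_int (lam (Y j)) / of_int C)" for j
  have uS: "u j = 0" if "j \<in> S" for j
    using contra Y(1)[of j] YS[of j] that by (auto simp: u_def)
  define H where "H x = (\<Sum>i\<in>UNIV. of_int (x $ i) * u i) - of_int (lam x)" for x :: "int ^ 'n"
  have H_diff: "H (x - y) = H x - H y" if "x \<in> kernel_lattice a" "y \<in> kernel_lattice a" for x y
    using lattice_dual_diff[OF lam K that] by (simp add: H_def left_diff_distrib sum_subtractf)
  have "H 0 = 0" using lattice_dual_0[OF lam K] by (simp add: H_def)
  then have Q: "int_subgroup {x \<in> kernel_lattice a. H x = 0}"
    using K H_diff by (auto simp: int_subgroup_def)
  have HY: "H (Y j) = 0" if j: "j \<notin> B" for j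
  proof -
    have "(\<Sum>i\<in>UNIV. of_int (Y j $ i) * u i) = (\<Sum>i\<in>UNIV. if i = j then of_int C * u j else 0)"
      using Y(2,3)[OF j] by (intro sum.cong) (auto simp: u_def)
    then show ?thesis using j C by (simp add: H_def u_def)
  qed
  have H0: "H x = 0" if x: "x \<in> kernel_lattice a" for x
  proof -
    have "(\<Sum>j\<in>-B. x $ j *s Y j) \<in> {x \<in> kernel_lattice a. H x = 0}"
      using HY Y(1) by (intro int_subgroup_sum[OF Q] int_subgroup_scale[OF Q]) auto
    then have "H (int (nat C) *s x) = 0" using kernel_basis_span[OF kb x] C by simp
    moreover have "H (int (nat C) *s x) = of_int C * H x"
      using lattice_dual_scale[OF lam K x, of "nat C"] C
      by (simp add: H_def right_diff_distrib sum_distrib_left mult.assoc)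
    ultimately show ?thesis using C by simp
  qed
  \<comment> \<open>Off \<open>S\<close> the second coordinate is 1, so the products
    \<open>z_i w_i\<close> are the \<open>u i\<close>; on \<open>S\<close> both coordinates
    vanish.\<close>
  define p :: "(complex ^ 'n) \<times> (complex ^ 'n)" where "p = (\<chi> i. u i, \<chi> i. if i \<in> S then 0 else 1)"
  have "complex_moment p x = of_int (lam x)" if "x \<in> kernel_lattice a" for x
  proof -
    have "complex_moment p x = (\<Sum>i\<in>UNIV. of_int (x $ i) * u i)"
      unfolding complex_moment_def moment_def using uS by (intro sum.cong) (auto simp: p_def)
    then show ?thesis using H0[OF that] by (simp add: H_def)
  qed
  then have reg: "\<forall>\<phi>\<in>lattice_dual (kernel_lattice a). \<exists>u. \<forall>x\<in>kernel_lattice a.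
          frechet_derivative (\<lambda>p. complex_moment p x) (at p) u = \<phi> x"
    using regular unfolding regular_value_def by blast
  obtain x where x: "x \<in> kernel_lattice a" "\<And>i. i \<notin> S \<Longrightarrow> x $ i = 0" "x \<noteq> 0"
    using S by (auto simp: rel_free_def)
  then obtain i0 where i0: "x $ i0 \<noteq> 0" by (auto simp: vec_eq_iff)
  \<comment> \<open>This functional is nonzero at the relation \<open>x\<close>, while every
    directional derivative at \<open>p\<close> is zero at \<open>x\<close>, because both coordinates
    of \<open>p\<close> vanish on the support of \<open>x\<close>.\<close>
  have "(\<lambda>y::int ^ 'n. complex_of_int (y $ i0)) \<in> lattice_dual (kernel_lattice a)"
    by (simp add: lattice_dual_def)
  from bspec[OF reg this] x(1) obtain v where v: "frechet_derivative (\<lambda>p. complex_moment p x) (at p) v = of_int (x $ i0)" by blast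
  have "frechet_derivative (\<lambda>p. complex_moment p x) (at p) v = 0"
    unfolding complex_moment_derivative
  proof (rule sum.neutral, rule ballI)
    fix i show "of_int (x $ i) * (fst p $ i * snd v $ i + fst v $ i * snd p $ i) = 0"
      using x(2)[of i] uS[of i] by (cases "i \<in> S") (auto simp: p_def)
  qed
  then show False using v i0 by simp
qed

section \<open>Counting characters with sign conditions\<close>

context field
begin

text \<open>
  Let \<open>m x\<close> be the product of the \<open>z\<^sub>i\<close> to the power \<open>x\<^sub>i\<close> for \<open>x\<^sub>i > 0\<close> and of the \<open>w\<^sub>i\<close> to the power
  \<open>- x\<^sub>i\<close> for \<open>x\<^sub>i < 0\<close>. Then \<open>m x \<cdot> m y\<close> is \<open>m (x + y)\<close> times powers of those \<open>z\<^sub>i w\<^sub>i\<close> for which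
  \<open>x\<^sub>i\<close> and \<open>y\<^sub>i\<close> have opposite signs. With \<open>z\<^sub>i w\<^sub>i = 0\<close> for \<open>i \<in> Z\<close> and \<open>z\<^sub>i w\<^sub>i = 1\<close> otherwise, this is
  the multiplication rule below.
\<close>

definition sign_homs :: "(int ^ 'n) set \<Rightarrow> 'n set \<Rightarrow> (int ^ 'n \<Rightarrow> 'a) set" where
  "sign_homs G Z = {f \<in> G \<rightarrow>\<^sub>E carrier R. f 0 = \<one> \<and>
     (\<forall>x\<in>G. \<forall>y\<in>G. f x \<otimes> f y = (if \<forall>i\<in>Z. x $ i * y $ i \<ge> 0 then f (x + y) else \<zero>))}"

lemma sign_homsD:
  assumes "f \<in> sign_homs G Z"
  shows "\<And>x. x \<in> G \<Longrightarrow> f x \<in> carrier R" "f \<in> extensional G" "f 0 = \<one>"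
    "\<And>x y. x \<in> G \<Longrightarrow> y \<in> G \<Longrightarrow> (\<And>i. i \<in> Z \<Longrightarrow> x $ i * y $ i \<ge> 0) \<Longrightarrow> f (x + y) = f x \<otimes> f y"
    "\<And>x y i. x \<in> G \<Longrightarrow> y \<in> G \<Longrightarrow> i \<in> Z \<Longrightarrow> x $ i * y $ i < 0 \<Longrightarrow> f x \<otimes> f y = \<zero>"
  using assms unfolding sign_homs_def PiE_def by (fastforce simp: not_le)+

lemma sign_homsI:
  assumes "\<And>x. x \<in> G \<Longrightarrow> f x \<in> carrier R" "f \<in> extensional G" "f 0 = \<one>"
    "\<And>x y. x \<in> G \<Longrightarrow> y \<in> G \<Longrightarrow> (\<And>i. i \<in> Z \<Longrightarrow> x $ i * y $ i \<ge> 0) \<Longrightarrow> f x \<otimes> f y = f (x + y)"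
    "\<And>x y i. x \<in> G \<Longrightarrow> y \<in> G \<Longrightarrow> i \<in> Z \<Longrightarrow> x $ i * y $ i < 0 \<Longrightarrow> f x \<otimes> f y = \<zero>"
  shows "f \<in> sign_homs G Z"
  using assms unfolding sign_homs_def PiE_def by (auto simp: not_le)

lemma pow_eq_zeroD: "x \<in> carrier R \<Longrightarrow> x [^] (k::nat) = \<zero> \<Longrightarrow> x = \<zero>"
  by (induction k) (auto simp: integral_iff)

lemma pow_nz: "x \<in> carrier R \<Longrightarrow> x \<noteq> \<zero> \<Longrightarrow> x [^] (k::nat) \<noteq> \<zero>"
  using pow_eq_zeroD by blast

lemma sign_homs_scale:
  assumes f: "f \<in> sign_homs G Z" and G: "int_subgroup G" and x: "x \<in> G"
  shows "f (int k *s x) = f x [^] k"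
proof (induction k)
  case 0 show ?case using sign_homsD(3)[OF f] by simp
next
  case (Suc k)
  have "f (int k *s x + x) = f (int k *s x) \<otimes> f x"
    using int_subgroup_scale[OF G x] x by (intro sign_homsD(4)[OF f]) (auto simp: mult.assoc)
  moreover have "int (Suc k) *s x = int k *s x + x" by (simp add: vec_eq_iff algebra_simps)
  ultimately show ?case using Suc by (simp del: of_nat_Suc)
qed

text \<open>No sign conflict arises between \<open>x\<close> and \<open>- x\<close>, so
  \<open>f (- x)\<close> is an inverse of \<open>f x\<close>.\<close>

lemma sign_homs_nz:
  assumes f: "f \<in> sign_homs G Z" and G: "int_subgroup G" and x: "x \<in> G" and z: "\<And>i. i \<in> Z \<Longrightarrow> x $ i = 0"
  shows "f x \<noteq> \<zero>"
proof
  assume "f x = \<zero>"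
  have "f (x + - x) = f x \<otimes> f (- x)"
    using int_subgroup_neg[OF G x] x z by (intro sign_homsD(4)[OF f]) auto
  then show False
    using \<open>f x = \<zero>\<close> sign_homsD(3)[OF f] sign_homsD(1)[OF f int_subgroup_neg[OF G x]] by simp
qed

text \<open>With coefficients that balance the coordinate at \<open>i\<close>, a positive multiple
  of \<open>y\<close> is a positive multiple of \<open>x\<close> plus a vector \<open>w\<close> with
  \<open>w $ i = 0\<close>. The two summands never conflict on \<open>Z\<close>, so the zero at
  \<open>x\<close> spreads to \<open>y\<close>.\<close>

lemma sign_homs_vanish:
  assumes f: "f \<in> sign_homs G Z" and G: "int_subgroup G" and i: "i \<in> Z"
    and x: "x \<in> G" "\<And>j. j \<in> Z - {i} \<Longrightarrow> x $ j = 0" "f x = \<zero>"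
    and y: "y \<in> G" "x $ i * y $ i > 0"
  shows "f y = \<zero>"
proof -
  define m where "m = nat \<bar>y $ i\<bar>"
  define d where "d = nat \<bar>x $ i\<bar>"
  define w where "w = int d *s y - int m *s x"
  have m: "m > 0" using y(2) by (auto simp: m_def)
  have wG: "w \<in> G" unfolding w_def using G x y int_subgroup_diff int_subgroup_scale by metis
  have mG: "int m *s x \<in> G" using G x int_subgroup_scale by metis
  have wi: "w $ i = 0"
    using y(2) by (cases "x $ i > 0") (auto simp: w_def d_def m_def zero_less_mult_iff)
  have "f (int m *s x + w) = f (int m *s x) \<otimes> f w"
    using mG wG
  proof (rule sign_homsD(4)[OF f])
    fix j assume "j \<in> Z" then show "(int m *s x) $ j * w $ j \<ge> 0"
      using wi x(2) by (cases "j = i") auto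
  qed
  moreover have "f (int m *s x) = \<zero>"
    using sign_homs_scale[OF f G x(1), of m] x(3) m by (simp add: nat_pow_zero)
  moreover have "int m *s x + w = int d *s y" by (simp add: w_def)
  ultimately have "f y [^] d = \<zero>"
    using sign_homs_scale[OF f G y(1), of d] sign_homsD(1)[OF f wG] by simp
  then show ?thesis using sign_homsD(1)[OF f y(1)] pow_eq_zeroD by blast
qed


text \<open>This is the case where \<open>z_i\<close> and \<open>w_i\<close> are both zero. The
  zeros at \<open>x\<close> and \<open>- x\<close> spread to every \<open>y\<close> with
  \<open>y $ i \<noteq> 0\<close>, so restriction loses nothing. Extension by zero is again
  multiplicative because coordinates of equal sign at \<open>i\<close> cannot cancel in a
  sum.\<close>

lemma sign_homs_bij_zero:
  assumes G: "int_subgroup G" and i: "i \<in> Z"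
    and x: "x \<in> G" "\<And>j. j \<in> Z - {i} \<Longrightarrow> x $ j = 0" "x $ i \<noteq> 0"
  shows "bij_betw (\<lambda>f. restrict f {y \<in> G. y $ i = 0})
     {f \<in> sign_homs G Z. f x = \<zero> \<and> f (- x) = \<zero>} (sign_homs {y \<in> G. y $ i = 0} (Z - {i}))"
    (is "bij_betw ?r ?A ?B")
proof (rule bij_betwI[where g = "\<lambda>f. \<lambda>y\<in>G. if y $ i = 0 then f y else \<zero>"])
  have G0: "0 \<in> G" and Gadd: "\<And>y z. y \<in> G \<Longrightarrow> z \<in> G \<Longrightarrow> y + z \<in> G"
    using G int_subgroup_0 int_subgroup_add by blast+
  show "?r \<in> ?A \<rightarrow> ?B"
  proof
    fix f assume "f \<in> ?A"
    then have f: "f \<in> sign_homs G Z" by simp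
    show "?r f \<in> ?B"
    proof (rule sign_homsI)
      fix y z assume yz: "y \<in> {y \<in> G. y $ i = 0}" "z \<in> {y \<in> G. y $ i = 0}" "\<And>j. j \<in> Z - {i} \<Longrightarrow> 0 \<le> y $ j * z $ j"
      then have "\<And>j. j \<in> Z \<Longrightarrow> 0 \<le> y $ j * z $ j" by force
      then show "?r f y \<otimes> ?r f z = ?r f (y + z)" using sign_homsD(4)[OF f, of y z] yz Gadd by simp
    qed (use sign_homsD[OF f] G0 in auto)
  qed
  show "(\<lambda>f. \<lambda>y\<in>G. if y $ i = 0 then f y else \<zero>) \<in> ?B \<rightarrow> ?A"
  proof
    fix f assume f: "f \<in> ?B"
    let ?f = "\<lambda>y\<in>G. if y $ i = 0 then f y else \<zero>"
    have "?f \<in> sign_homs G Z"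
    proof (rule sign_homsI)
      show "?f y \<in> carrier R" if "y \<in> G" for y using sign_homsD(1)[OF f, of y] that by auto
      show "?f 0 = \<one>" using sign_homsD(3)[OF f] G0 by simp
      fix y z assume y: "y \<in> G" and z: "z \<in> G"
      have c: "?f y \<in> carrier R" "?f z \<in> carrier R" using sign_homsD(1)[OF f] y z by auto
      show "?f y \<otimes> ?f z = ?f (y + z)" if s: "\<And>j. j \<in> Z \<Longrightarrow> 0 \<le> y $ j * z $ j"
      proof (cases "y $ i = 0 \<and> z $ i = 0")
        case True then show ?thesis using sign_homsD(4)[OF f, of y z] y z s Gadd by auto
      next
        case False
        then have "y $ i + z $ i \<noteq> 0" using s[OF i] by (auto simp: zero_le_mult_iff)
        then show ?thesis using False c y z Gadd by (auto split: if_splits)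
      qed
      show "?f y \<otimes> ?f z = \<zero>" if "j \<in> Z" "y $ j * z $ j < 0" for j
      proof (cases "y $ i = 0 \<and> z $ i = 0")
        case True 
        then have "j \<in> Z - {i}" using that by auto
        then show ?thesis using sign_homsD(5)[OF f, of y z j] True y z that by auto
      next
        case False then show ?thesis using c y z by auto
      qed
    qed auto
    then show "?f \<in> ?A" using x int_subgroup_neg[OF G] by auto
  qed
  show "(\<lambda>y\<in>G. if y $ i = 0 then ?r f y else \<zero>) = f" if "f \<in> ?A" for f
  proof (rule extensionalityI[of _ G])
    have f: "f \<in> sign_homs G Z" "f x = \<zero>" "f (- x) = \<zero>" using that by auto
    show "f \<in> extensional G" using sign_homsD(2) f by blast
    fix y assume y: "y \<in> G"
    have "f y = \<zero>" if "y $ i \<noteq> 0"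
    proof (cases "x $ i * y $ i > 0")
      case True then show ?thesis using sign_homs_vanish[OF f(1) G i x(1,2) f(2) y] by blast
    next
      case False
      then have "(- x) $ i * y $ i > 0" using x(3) that by (auto simp: zero_less_mult_iff mult_less_0_iff not_less)
      then show ?thesis using sign_homs_vanish[OF f(1) G i _ _ f(3) y] x int_subgroup_neg[OF G] by auto
    qed
    then show "(\<lambda>y\<in>G. if y $ i = 0 then ?r f y else \<zero>) y = f y" using y by auto
  qed auto
  show "?r (\<lambda>y\<in>G. if y $ i = 0 then f y else \<zero>) = f" if "f \<in> ?B" for f
    using sign_homsD(2)[OF that] by (auto intro!: extensionalityI[of _ "{y \<in> G. y $ i = 0}"])
qed

text \<open>Inverting \<open>f x\<close> extends \<open>f\<close> from a half space to all of \<open>G\<close> and removes the condition at \<open>i\<close>.\<close>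

lemma sign_homs_bij_half:
  fixes G :: "(int ^ 'n::finite) set"
  assumes G: "int_subgroup G" and i: "i \<in> Z"
    and x: "x \<in> G" "\<And>j. j \<in> Z - {i} \<Longrightarrow> x $ j = 0" "x $ i \<noteq> 0"
  shows "bij_betw (\<lambda>f. \<lambda>y\<in>G. if x $ i * y $ i \<ge> 0 then f y else \<zero>)
     (sign_homs G (Z - {i})) {f \<in> sign_homs G Z. f x \<noteq> \<zero>}"
    (is "bij_betw ?r ?B ?A")
proof -
  have G0: "0 \<in> G" and Gadd: "\<And>y z. y \<in> G \<Longrightarrow> z \<in> G \<Longrightarrow> y + z \<in> G"
    using G int_subgroup_0 int_subgroup_add by blast+
  have Gs: "int k *s x \<in> G" for k using int_subgroup_scale[OF G x(1)] .
  \<comment> \<open>Since \<open>|x $ i| \<ge> 1\<close>, adding \<open>|y $ i|\<close> copies of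
    \<open>x\<close> always moves \<open>y\<close> into the half space on which \<open>h\<close> is
    kept.\<close>
  define N where "N y = nat \<bar>y $ i\<bar>" for y :: "int ^ 'n"
  define lift where "lift y = y + int (N y) *s x" for y :: "int ^ 'n"
  have xx: "x $ i * x $ i > 0" using x(3) by (simp add: zero_less_mult_iff) linarith
  have lift_pos: "x $ i * (y + int k *s x) $ i \<ge> 0" if "k \<ge> N y" for y k
  proof -
    have "\<bar>y $ i\<bar> \<le> int k" using that by (simp add: N_def)
    moreover have "\<bar>x $ i * y $ i\<bar> \<le> (x $ i * x $ i) * \<bar>y $ i\<bar>"
    proof -
      have "\<bar>x $ i\<bar> \<le> \<bar>x $ i\<bar> * \<bar>x $ i\<bar>" using x(3) mult_left_mono[of 1 "\<bar>x $ i\<bar>" "\<bar>x $ i\<bar>"] by simp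
      then have "\<bar>x $ i\<bar> * \<bar>y $ i\<bar> \<le> (\<bar>x $ i\<bar> * \<bar>x $ i\<bar>) * \<bar>y $ i\<bar>" by (rule mult_right_mono) simp
      then show ?thesis by (simp add: abs_mult)
    qed
    ultimately have "\<bar>x $ i * y $ i\<bar> \<le> (x $ i * x $ i) * int k"
      using xx by (meson less_imp_le mult_left_mono order_trans)
    then show ?thesis by (simp add: algebra_simps abs_le_iff)
  qed
  have pos: "x $ i * (int k *s x) $ i \<ge> 0" for k
    using mult_nonneg_nonneg[of "int k" "x $ i * x $ i"] xx by (simp add: algebra_simps)
  have pos2: "(int k *s x) $ j * (int l *s x) $ j \<ge> 0" for k l j
    using mult_nonneg_nonneg[of "int k * int l" "x $ j * x $ j"] by (simp add: algebra_simps)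
  show ?thesis
  proof (rule bij_betw_imageI)
    show "inj_on ?r ?B"
    proof (rule inj_onI)
      fix f g assume f: "f \<in> ?B" and g: "g \<in> ?B" and eq: "?r f = ?r g"
      have e: "f y = g y" if "y \<in> G" "x $ i * y $ i \<ge> 0" for y
        using fun_cong[OF eq, of y] that by simp
      show "f = g"
      proof (rule extensionalityI[of _ G])
        fix y assume y: "y \<in> G"
        let ?k = "int (N y) *s x"
        have "f (y + ?k) = f y \<otimes> f ?k" using y Gs x by (intro sign_homsD(4)[OF f]) auto
        moreover have "g (y + ?k) = g y \<otimes> g ?k" using y Gs x by (intro sign_homsD(4)[OF g]) auto
        moreover have "f (y + ?k) = g (y + ?k)" using lift_pos[of y "N y"] y Gs Gadd by (intro e) auto
        moreover have "f ?k = g ?k" using Gs pos by (intro e)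
        moreover have "f ?k \<noteq> \<zero>" using x Gs by (intro sign_homs_nz[OF f G]) auto
        ultimately show "f y = g y"
          using sign_homsD(1)[OF f] sign_homsD(1)[OF g] y Gs m_rcancel by metis
      qed (use sign_homsD(2) f g in blast)+
    qed
    show "?r ` ?B = ?A"
    proof (intro equalityI subsetI)
      fix h assume "h \<in> ?r ` ?B"
      then obtain f where f: "f \<in> ?B" and h: "h = ?r f" by blast
      have "?r f \<in> sign_homs G Z"
      proof (rule sign_homsI)
        show c: "?r f y \<in> carrier R" if "y \<in> G" for y using sign_homsD(1)[OF f, of y] that by auto
        show "?r f 0 = \<one>" using sign_homsD(3)[OF f] G0 by simp
        fix y z assume y: "y \<in> G" and z: "z \<in> G"
        note c = c[OF y] c[OF z]
        show "?r f y \<otimes> ?r f z = ?r f (y + z)" if s: "\<And>j. j \<in> Z \<Longrightarrow> 0 \<le> y $ j * z $ j"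
        proof (cases "x $ i * y $ i \<ge> 0 \<and> x $ i * z $ i \<ge> 0")
          case True
          then have "x $ i * (y + z) $ i \<ge> 0" by (simp add: distrib_left)
          then show ?thesis using True sign_homsD(4)[OF f, of y z] y z s Gadd by auto
        next
          case False
          then have "\<not> x $ i * (y + z) $ i \<ge> 0"
            using s[OF i] x(3) by (auto simp: zero_le_mult_iff mult_less_0_iff not_le)
          then show ?thesis using False c y z Gadd by (auto split: if_splits)
        qed
        show "?r f y \<otimes> ?r f z = \<zero>" if j: "j \<in> Z" "y $ j * z $ j < 0" for j
        proof (cases "j = i")
          case True
          then have "\<not> (x $ i * y $ i \<ge> 0 \<and> x $ i * z $ i \<ge> 0)"
            using j x(3) by (auto simp: zero_le_mult_iff mult_less_0_iff)
          then show ?thesis using c y z by auto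
        next
          case False
          then show ?thesis using sign_homsD(5)[OF f y z, of j] j y z c sign_homsD(1)[OF f] by auto
        qed
      qed auto
      moreover have "f x \<noteq> \<zero>" using x by (intro sign_homs_nz[OF f G]) auto
      ultimately show "h \<in> ?A" using h x xx by auto
    next
      fix h assume "h \<in> ?A"
      then have h: "h \<in> sign_homs G Z" and hx: "h x \<noteq> \<zero>" by auto
      have hk: "h (int k *s x) \<noteq> \<zero>" "h (int k *s x) \<in> carrier R" "h (int k *s x) \<otimes> inv h (int k *s x) = \<one>"
         "inv h (int k *s x) \<in> carrier R" for k
      proof -
        show 1: "h (int k *s x) \<noteq> \<zero>" using sign_homs_scale[OF h G x(1)] pow_nz hx sign_homsD(1)[OF h x(1)] by simp
        show 2: "h (int k *s x) \<in> carrier R" using sign_homsD(1)[OF h] Gs by simp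
        from 1 2 have "h (int k *s x) \<in> Units R" by (simp add: field_Units)
        then show "h (int k *s x) \<otimes> inv h (int k *s x) = \<one>" "inv h (int k *s x) \<in> carrier R" by auto
      qed
      \<comment> \<open>Multiplicativity forces this value: \<open>lift y\<close> lies in the half
        space, and \<open>h\<close> is nonzero at every non-negative multiple of
        \<open>x\<close>.\<close>
      define f where "f = (\<lambda>y\<in>G. h (lift y) \<otimes> inv h (int (N y) *s x))"
      have Gl: "lift y \<in> G" if "y \<in> G" for y using that Gs Gadd by (simp add: lift_def)
      have fc: "f y \<in> carrier R" if "y \<in> G" for y
        using that hk sign_homsD(1)[OF h] Gl by (simp add: f_def)
      \<comment> \<open>The quotient does not depend on how far \<open>y\<close> is moved: any shift
        \<open>k \<ge> N y\<close> gives the same value.\<close>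
      have key: "f y \<otimes> h (int k *s x) = h (y + int k *s x)" if y: "y \<in> G" and k: "k \<ge> N y" for y k
      proof -
        let ?a = "N y"
        obtain l where l: "k = N y + l" using k le_Suc_ex by blast
        have "h (int ?a *s x + int (k - ?a) *s x) = h (int ?a *s x) \<otimes> h (int (k - ?a) *s x)"
          using Gs pos2 by (intro sign_homsD(4)[OF h])
        moreover have "int ?a *s x + int (k - ?a) *s x = int k *s x"
          by (simp add: l vec_eq_iff algebra_simps)
        moreover have "h (lift y + int (k - ?a) *s x) = h (lift y) \<otimes> h (int (k - ?a) *s x)"
        proof (rule sign_homsD(4)[OF h])
          fix j assume j: "j \<in> Z"
          show "0 \<le> lift y $ j * (int (k - ?a) *s x) $ j"
          proof (cases "j = i")
            case True
            have "int (k - ?a) * (x $ i * lift y $ i) \<ge> 0" using lift_pos[of y ?a] by (simp add: lift_def)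
            then show ?thesis using True by (simp add: algebra_simps)
          qed (use x j in auto)
        qed (use Gl Gs y in auto)
        moreover have "lift y + int (k - ?a) *s x = y + int k *s x"
          by (simp add: l lift_def vec_eq_iff algebra_simps)
        moreover have "h (lift y) \<in> carrier R" using sign_homsD(1)[OF h] Gl y by simp
        ultimately show ?thesis
          using hk y by (simp add: f_def) (metis m_assoc m_comm r_one m_closed)
      qed
      have "f \<in> ?B"
      proof (rule sign_homsI)
        show "f 0 = \<one>" using hk(3)[of 0] sign_homsD(3)[OF h] G0 by (simp add: f_def lift_def N_def)
        fix y z assume y: "y \<in> G" and z: "z \<in> G"
        \<comment> \<open>One shift that suffices for both \<open>y\<close> and \<open>z\<close>;
          the sum of the shifted vectors carries \<open>k + k\<close> copies of \<open>x\<close>,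
          which suffices for \<open>y + z\<close>.\<close>
        define k where "k = N y + N z"
        have k: "k \<ge> N y" "k \<ge> N z" "k + k \<ge> N (y + z)"
          unfolding k_def N_def vector_add_component by linarith+
        have hkk: "h (int (k + k) *s x) = h (int k *s x) \<otimes> h (int k *s x)"
          using sign_homs_scale[OF h G x(1)] nat_pow_mult[of "h x" k k] sign_homsD(1)[OF h x(1)] by metis
        have prod: "(f y \<otimes> f z) \<otimes> h (int (k + k) *s x) = h (y + int k *s x) \<otimes> h (z + int k *s x)"
          unfolding hkk key[OF y k(1), symmetric] key[OF z k(2), symmetric]
          using fc[OF y] fc[OF z] hk by (simp add: m_ac)
        have yk: "y + int k *s x \<in> G" "z + int k *s x \<in> G" using y z Gs Gadd by auto
        have pi: "0 \<le> (y + int k *s x) $ i * (z + int k *s x) $ i"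
          using lift_pos[OF k(1)] lift_pos[OF k(2)] x(3) by (auto simp: zero_le_mult_iff)
        show "f y \<otimes> f z = f (y + z)" if s: "\<And>j. j \<in> Z - {i} \<Longrightarrow> 0 \<le> y $ j * z $ j"
        proof -
          have "h ((y + int k *s x) + (z + int k *s x)) = h (y + int k *s x) \<otimes> h (z + int k *s x)"
          proof (rule sign_homsD(4)[OF h])
            fix j assume j: "j \<in> Z" then show "0 \<le> (y + int k *s x) $ j * (z + int k *s x) $ j"
              using pi s x by (cases "j = i") auto
          qed (use yk in auto)
          moreover have "(y + int k *s x) + (z + int k *s x) = (y + z) + int (k + k) *s x"
            by (simp add: vec_eq_iff algebra_simps)
          ultimately have "(f y \<otimes> f z) \<otimes> h (int (k + k) *s x) = f (y + z) \<otimes> h (int (k + k) *s x)"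
            using prod key[OF _ k(3)] Gadd y z by simp
          then show ?thesis using fc[OF y] fc[OF z] fc[OF Gadd[OF y z]] hk m_rcancel by blast
        qed
        show "f y \<otimes> f z = \<zero>" if j: "j \<in> Z - {i}" "y $ j * z $ j < 0" for j
        proof -
          have "h (y + int k *s x) \<otimes> h (z + int k *s x) = \<zero>"
            using j x by (intro sign_homsD(5)[OF h yk, of j]) auto
          then show ?thesis using prod integral hk fc y z m_closed by metis
        qed
      qed (use fc in \<open>auto simp: f_def\<close>)
      moreover have "?r f = h"
      proof (rule extensionalityI[of _ G])
        show "h \<in> extensional G" using sign_homsD(2)[OF h] .
        fix y assume y: "y \<in> G"
        show "?r f y = h y"
        proof (cases "x $ i * y $ i \<ge> 0")
          case True
          let ?k = "int (N y) *s x"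
          have "h (y + ?k) = h y \<otimes> h ?k"
          proof (rule sign_homsD(4)[OF h y Gs])
            fix j assume j: "j \<in> Z"
            show "0 \<le> y $ j * ?k $ j"
            proof (cases "j = i")
              case t: True
              have "int (N y) * (x $ i * y $ i) \<ge> 0" by (rule mult_nonneg_nonneg[OF of_nat_0_le_iff True])
              then show ?thesis using t by (simp add: algebra_simps)
            qed (use x j in auto)
          qed
          then have "f y \<otimes> h ?k = h y \<otimes> h ?k" using key[OF y order_refl] by simp
          then have "f y = h y" using fc[OF y] sign_homsD(1)[OF h y] hk m_rcancel by blast
          then show ?thesis using True y by simp
        next
          case False
          then have "h x \<otimes> h y = \<zero>" using sign_homsD(5)[OF h x(1) y i] by simp
          then have "h y = \<zero>" using hx integral sign_homsD(1)[OF h] x(1) y by blast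
          then show ?thesis using False y by simp
        qed
      qed auto
      ultimately show "h \<in> ?r ` ?B" by blast
    qed
  qed
qed


text \<open>Since \<open>x\<close> and \<open>- x\<close> have opposite signs at \<open>i\<close>,
  the values \<open>f x\<close> and \<open>f (- x)\<close> multiply to zero. Thus exactly one of the
  cases \<open>f x \<noteq> 0\<close>, \<open>f (- x) \<noteq> 0\<close>, both zero occurs; the
  first two are half-space cases with the same count.\<close>

lemma card_sign_homs_step:
  assumes G: "int_subgroup G" and i: "i \<in> Z" and ind: "coords_indep G Z"
    and fin: "finite (sign_homs G (Z - {i}))" "finite (sign_homs {x \<in> G. x $ i = 0} (Z - {i}))"
  shows "finite (sign_homs G Z)"
    "card (sign_homs G Z) = 2 * card (sign_homs G (Z - {i})) + card (sign_homs {x \<in> G. x $ i = 0} (Z - {i}))"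
proof -
  from ind i obtain x where x: "x \<in> G" "x $ i > 0" "\<And>j. j \<in> Z - {i} \<Longrightarrow> x $ j = 0"
    unfolding coords_indep_def by blast
  let ?P = "{f \<in> sign_homs G Z. f x \<noteq> \<zero>}" and ?M = "{f \<in> sign_homs G Z. f (- x) \<noteq> \<zero>}"
    and ?O = "{f \<in> sign_homs G Z. f x = \<zero> \<and> f (- x) = \<zero>}"
  have mx: "- x \<in> G" using G x(1) int_subgroup_neg by blast
  have P: "bij_betw (\<lambda>f. \<lambda>y\<in>G. if x $ i * y $ i \<ge> 0 then f y else \<zero>) (sign_homs G (Z - {i})) ?P"
    using x by (intro sign_homs_bij_half[OF G i]) auto
  have M: "bij_betw (\<lambda>f. \<lambda>y\<in>G. if (- x) $ i * y $ i \<ge> 0 then f y else \<zero>) (sign_homs G (Z - {i})) ?M"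
    using x mx by (intro sign_homs_bij_half[OF G i]) auto
  have O: "bij_betw (\<lambda>f. restrict f {y \<in> G. y $ i = 0}) ?O (sign_homs {x \<in> G. x $ i = 0} (Z - {i}))"
    using x by (intro sign_homs_bij_zero[OF G i]) auto
  have f: "finite ?P" "finite ?M" "finite ?O"
    using bij_betw_finite[OF P] bij_betw_finite[OF M] bij_betw_finite[OF O] fin by auto
  have eq: "sign_homs G Z = ?P \<union> (?M \<union> ?O)" by blast
  show "finite (sign_homs G Z)" by (subst eq) (use f in blast)
  have disj: "?P \<inter> (?M \<union> ?O) = {}" "?M \<inter> ?O = {}"
  proof -
    have "f x \<otimes> f (- x) = \<zero>" if "f \<in> sign_homs G Z" for f
      using sign_homsD(5)[OF that x(1) mx i] x(2) by simp
    then show "?P \<inter> (?M \<union> ?O) = {}" 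
      using integral sign_homsD(1) x(1) mx by blast
  qed blast
  have "card (sign_homs G Z) = card ?P + (card ?M + card ?O)"
    using f disj by (subst eq) (simp add: card_Un_disjoint)
  then show "card (sign_homs G Z) = 2 * card (sign_homs G (Z - {i})) + card (sign_homs {x \<in> G. x $ i = 0} (Z - {i}))"
    using bij_betw_same_card[OF P] bij_betw_same_card[OF M] bij_betw_same_card[OF O] by simp
qed

section \<open>Without sign conditions: group characters of a lattice\<close>

lemma sign_homs_units:
  assumes f: "f \<in> sign_homs G {}" and G: "int_subgroup G" and x: "x \<in> G"
  shows "f x \<in> carrier (mult_of R)"
  using sign_homs_nz[OF f G x] sign_homsD(1)[OF f x] by simp

lemma sign_homs_int_scale:
  assumes f: "f \<in> sign_homs G {}" and G: "int_subgroup G" and x: "x \<in> G"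
  shows "f (k *s x) = f x [^]\<^bsub>mult_of R\<^esub> (k::int)"
proof -
  interpret M: group "mult_of R" by (rule field_mult_group)
  have nn: "f (int m *s x) = f x [^]\<^bsub>mult_of R\<^esub> int m" for m
    using sign_homs_scale[OF f G x] by (simp add: int_pow_int nat_pow_mult_of)
  show ?thesis
  proof (cases "k \<ge> 0")
    case True then show ?thesis using nn[of "nat k"] by simp
  next
    case False
    define m where "m = nat (- k)"
    have k: "k = - int m" using False by (simp add: m_def)
    have "f (k *s x + int m *s x) = f (k *s x) \<otimes> f (int m *s x)"
      using int_subgroup_scale[OF G x] by (intro sign_homsD(4)[OF f]) auto
    moreover have "k *s x + int m *s x = 0" by (simp add: k vec_eq_iff)
    ultimately have "f (k *s x) \<otimes>\<^bsub>mult_of R\<^esub> f (int m *s x) = \<one>\<^bsub>mult_of R\<^esub>"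
      using sign_homsD(3)[OF f] by simp
    then have "f (k *s x) = inv\<^bsub>mult_of R\<^esub> f (int m *s x)"
      using sign_homs_units[OF f G] int_subgroup_scale[OF G x] by (intro M.inv_equality[symmetric]) auto
    then show ?thesis
      using nn sign_homs_units[OF f G x] by (simp add: k M.int_pow_neg)
  qed
qed

text \<open>\<open>G\<close> is the direct sum of the vectors with \<open>i\<close>-th coordinate 0
  and the multiples of one vector \<open>z\<close>. A character is its restriction to the first
  summand together with an arbitrary unit as its value at \<open>z\<close>.\<close>

lemma sign_homs_bij_extend:
  fixes G :: "(int ^ 'n::finite) set"
  assumes G: "int_subgroup G" and x: "x \<in> G" "x $ i > 0"
  shows "\<exists>g. bij_betw g (sign_homs G {}) (sign_homs {y \<in> G. y $ i = 0} {} \<times> (carrier R - {\<zero>}))"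
proof -
  interpret M: group "mult_of R" by (rule field_mult_group)
  interpret M: comm_group "mult_of R" 
    by unfold_locales (auto simp: m_comm)
  \<comment> \<open>\<open>c\<close> generates the group of \<open>i\<close>-th coordinates of
    elements of \<open>G\<close>: a remainder modulo \<open>c\<close> would again be such a
    coordinate. The vector attaining it is \<open>z\<close>; below, \<open>k y\<close> is the
    coefficient of \<open>y\<close> along \<open>z\<close> and \<open>\<pi> y\<close> the remaining
    part.\<close>
  define c where "c = (LEAST m. m > 0 \<and> (\<exists>y\<in>G. y $ i = int m))"
  have "\<exists>m. m > 0 \<and> (\<exists>y\<in>G. y $ i = int m)"
    using x by (intro exI[of _ "nat (x $ i)"]) auto
  from LeastI_ex[OF this] obtain z where z: "z \<in> G" "z $ i = int c" and c: "c > 0"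
    by (auto simp: c_def)
  have dvd: "int c dvd y $ i" if y: "y \<in> G" for y
  proof (rule ccontr)
    assume nd: "\<not> int c dvd y $ i"
    define w where "w = y - (y $ i div int c) *s z"
    have "w \<in> G" unfolding w_def using G y z int_subgroup_scale int_subgroup_diff by metis
    moreover have "w $ i = y $ i mod int c" by (simp add: w_def z minus_div_mult_eq_mod)
    moreover have "y $ i mod int c > 0" "y $ i mod int c < int c"
    proof -
      have "0 \<le> y $ i mod int c" "y $ i mod int c \<noteq> 0" using c nd by (auto simp: dvd_eq_mod_eq_0)
      then show "y $ i mod int c > 0" by linarith
      show "y $ i mod int c < int c" using c by simp
    qed
    ultimately have "nat (y $ i mod int c) > 0 \<and> (\<exists>w\<in>G. w $ i = int (nat (y $ i mod int c)))" by auto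
    then have "c \<le> nat (y $ i mod int c)" unfolding c_def by (rule Least_le)
    then show False using \<open>y $ i mod int c < int c\<close> \<open>y $ i mod int c > 0\<close> by linarith
  qed
  define k where "k y = y $ i div int c" for y :: "int ^ 'n"
  define \<pi> where "\<pi> y = y - k y *s z" for y
  have k_add: "k (y + w) = k y + k w" if "y \<in> G" "w \<in> G" for y w
    using dvd[OF that(1)] by (simp add: k_def div_plus_div_distrib_dvd_left)
  have kz: "k z = 1" using c by (simp add: k_def z)
  have k0: "k y = 0" if "y $ i = 0" for y using that by (simp add: k_def)
  let ?G0 = "{y \<in> G. y $ i = 0}"
  have pG: "\<pi> y \<in> ?G0" if "y \<in> G" for y
    using that z dvd[OF that] int_subgroup_scale[OF G z(1)] int_subgroup_diff[OF G that]
    by (auto simp: \<pi>_def k_def)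
  have p_add: "\<pi> (y + w) = \<pi> y + \<pi> w" if "y \<in> G" "w \<in> G" for y w
    using k_add[OF that] by (simp add: \<pi>_def vec_eq_iff algebra_simps)
  have Gadd: "\<And>y w. y \<in> G \<Longrightarrow> w \<in> G \<Longrightarrow> y + w \<in> G" using int_subgroup_add[OF G] .
  have G0: "0 \<in> G" using int_subgroup_0[OF G] .
  have "bij_betw (\<lambda>f. (restrict f ?G0, f z)) (sign_homs G {}) (sign_homs ?G0 {} \<times> (carrier R - {\<zero>}))"
  proof (rule bij_betwI[where g = "\<lambda>(f, u). \<lambda>y\<in>G. f (\<pi> y) \<otimes> u [^]\<^bsub>mult_of R\<^esub> k y"])
    show "(\<lambda>f. (restrict f ?G0, f z)) \<in> sign_homs G {} \<rightarrow> sign_homs ?G0 {} \<times> (carrier R - {\<zero>})"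
    proof
      fix f assume f: "f \<in> sign_homs G {}"
      have "restrict f ?G0 \<in> sign_homs ?G0 {}"
      proof (rule sign_homsI)
        show "restrict f ?G0 y \<otimes> restrict f ?G0 w = restrict f ?G0 (y + w)" if "y \<in> ?G0" "w \<in> ?G0" for y w
          using sign_homsD(4)[OF f, of y w] that Gadd by simp
      qed (use sign_homsD(1,3)[OF f] G0 in auto)
      then show "(restrict f ?G0, f z) \<in> sign_homs ?G0 {} \<times> (carrier R - {\<zero>})"
        using sign_homs_units[OF f G z(1)] by simp
    qed
    show "(\<lambda>(f, u). \<lambda>y\<in>G. f (\<pi> y) \<otimes> u [^]\<^bsub>mult_of R\<^esub> k y) \<in> sign_homs ?G0 {} \<times> (carrier R - {\<zero>}) \<rightarrow> sign_homs G {}"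
    proof (rule Pi_I)
      fix fu assume "fu \<in> sign_homs ?G0 {} \<times> (carrier R - {\<zero>})"
      then obtain f u where fu: "fu = (f, u)" and f: "f \<in> sign_homs ?G0 {}" and u: "u \<in> carrier R" "u \<noteq> \<zero>" by auto
      have pow: "u [^]\<^bsub>mult_of R\<^esub> (m::int) \<in> carrier R" for m
        using M.int_pow_closed[of u m] u by simp
      have fp: "f (\<pi> y) \<in> carrier R" if "y \<in> G" for y using sign_homsD(1)[OF f pG[OF that]] .
      have "(\<lambda>y\<in>G. f (\<pi> y) \<otimes> u [^]\<^bsub>mult_of R\<^esub> k y) \<in> sign_homs G {}"
      proof (rule sign_homsI)
        fix y w assume y: "y \<in> G" and w: "w \<in> G"
        have "f (\<pi> (y + w)) = f (\<pi> y) \<otimes> f (\<pi> w)"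
          unfolding p_add[OF y w] using pG[OF y] pG[OF w] by (intro sign_homsD(4)[OF f]) auto
        moreover have "u [^]\<^bsub>mult_of R\<^esub> k (y + w) = u [^]\<^bsub>mult_of R\<^esub> k y \<otimes> u [^]\<^bsub>mult_of R\<^esub> k w"
          using M.int_pow_mult[of u] u by (simp add: k_add[OF y w])
        ultimately show "(\<lambda>y\<in>G. f (\<pi> y) \<otimes> u [^]\<^bsub>mult_of R\<^esub> k y) y \<otimes> (\<lambda>y\<in>G. f (\<pi> y) \<otimes> u [^]\<^bsub>mult_of R\<^esub> k y) w
          = (\<lambda>y\<in>G. f (\<pi> y) \<otimes> u [^]\<^bsub>mult_of R\<^esub> k y) (y + w)"
          using y w Gadd fp pow by (simp add: m_ac)
      next
        have "\<pi> 0 = 0" "k 0 = 0" by (auto simp: \<pi>_def k_def)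
        then show "(\<lambda>y\<in>G. f (\<pi> y) \<otimes> u [^]\<^bsub>mult_of R\<^esub> k y) 0 = \<one>"
          using G0 sign_homsD(3)[OF f] by simp
      qed (use fp pow in auto)
      then show "(\<lambda>(f, u). \<lambda>y\<in>G. f (\<pi> y) \<otimes> u [^]\<^bsub>mult_of R\<^esub> k y) fu \<in> sign_homs G {}"
        by (simp add: fu)
    qed
    show "(\<lambda>(f, u). \<lambda>y\<in>G. f (\<pi> y) \<otimes> u [^]\<^bsub>mult_of R\<^esub> k y) (restrict f ?G0, f z) = f"
      if f: "f \<in> sign_homs G {}" for f
    proof (rule extensionalityI[of _ G])
      fix y assume y: "y \<in> G"
      have "f (\<pi> y + k y *s z) = f (\<pi> y) \<otimes> f (k y *s z)"
        using pG[OF y] int_subgroup_scale[OF G z(1)] by (intro sign_homsD(4)[OF f]) auto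
      then show "(\<lambda>(f, u). \<lambda>y\<in>G. f (\<pi> y) \<otimes> u [^]\<^bsub>mult_of R\<^esub> k y) (restrict f ?G0, f z) y = f y"
        using y pG[OF y] sign_homs_int_scale[OF f G z(1)] by (simp add: \<pi>_def)
    qed (use sign_homsD(2)[OF f] in auto)
    show "(\<lambda>f. (restrict f ?G0, f z)) ((\<lambda>(f, u). \<lambda>y\<in>G. f (\<pi> y) \<otimes> u [^]\<^bsub>mult_of R\<^esub> k y) fu) = fu"
      if fu: "fu \<in> sign_homs ?G0 {} \<times> (carrier R - {\<zero>})" for fu
    proof -
      obtain f u where fu': "fu = (f, u)" "f \<in> sign_homs ?G0 {}" "u \<in> carrier R" "u \<noteq> \<zero>" using fu by auto
      let ?f = "\<lambda>y\<in>G. f (\<pi> y) \<otimes> u [^]\<^bsub>mult_of R\<^esub> k y"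
      have "restrict ?f ?G0 = f"
      proof (rule extensionalityI[of _ ?G0])
        fix y assume y: "y \<in> ?G0"
        then have "\<pi> y = y" "k y = 0" using k0 by (auto simp: \<pi>_def)
        then show "restrict ?f ?G0 y = f y" using y sign_homsD(1)[OF fu'(2) y] by simp
      qed (use sign_homsD(2)[OF fu'(2)] in auto)
      moreover have "?f z = u"
      proof -
        have "\<pi> z = 0" by (simp add: \<pi>_def kz)
        then show ?thesis using z sign_homsD(3)[OF fu'(2)] M.int_pow_1[of u] fu' by (simp add: kz)
      qed
      ultimately show ?thesis by (simp add: fu')
    qed
  qed
  then show ?thesis by blast
qed

lemma card_sign_homs_extend:
  assumes G: "int_subgroup G" and x: "x \<in> G" "x $ i > 0" and F: "finite (carrier R)"
  shows "finite (sign_homs G {}) \<longleftrightarrow> finite (sign_homs {y \<in> G. y $ i = 0} {})"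
    "card (sign_homs G {}) = (card (carrier R) - 1) * card (sign_homs {y \<in> G. y $ i = 0} {})"
proof -
  obtain g where g: "bij_betw g (sign_homs G {}) (sign_homs {y \<in> G. y $ i = 0} {} \<times> (carrier R - {\<zero>}))"
    using sign_homs_bij_extend[OF G x] by blast
  have ne: "carrier R - {\<zero>} \<noteq> {}" using one_closed one_not_zero by blast
  show "finite (sign_homs G {}) \<longleftrightarrow> finite (sign_homs {y \<in> G. y $ i = 0} {})"
    using bij_betw_finite[OF g] ne F by (auto simp: finite_cartesian_product_iff)
  show "card (sign_homs G {}) = (card (carrier R) - 1) * card (sign_homs {y \<in> G. y $ i = 0} {})"
    using bij_betw_same_card[OF g] F by (simp add: card_cartesian_product card_Diff_singleton)
qed

text \<open>The coordinates in \<open>B\<close> are independent on \<open>G\<close> and separate its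
  elements, so \<open>G\<close> has rank \<open>card B\<close>. Each coordinate splits off one
  infinite cyclic summand and contributes a factor \<open>q - 1\<close>.\<close>

lemma card_sign_homs_free:
  fixes G :: "(int ^ 'n::finite) set"
  assumes "int_subgroup G" "coords_indep G B" "\<And>x. x \<in> G \<Longrightarrow> (\<And>i. i \<in> B \<Longrightarrow> x $ i = 0) \<Longrightarrow> x = 0"
    and F: "finite (carrier R)"
  shows "finite (sign_homs G {}) \<and> card (sign_homs G {}) = (card (carrier R) - 1) ^ card B"
  using finite[of B] assms(1-3)
proof (induction B arbitrary: G rule: finite_induct)
  case empty
  then have G: "G = {0}" using int_subgroup_0 by blast
  have "sign_homs {0} {} = {\<lambda>x\<in>{0 :: int ^ 'n}. \<one>}"
    by (auto simp: sign_homs_def PiE_def fun_eq_iff extensional_def)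
  then show ?case by (simp add: G)
next
  case (insert i B)
  let ?G0 = "{y \<in> G. y $ i = 0}"
  obtain x where x: "x \<in> G" "x $ i > 0" using insert.prems(2) by (auto simp: coords_indep_def)
  have "coords_indep ?G0 (insert i B - {i})" using coords_indep_vanish1[OF insert.prems(2)] by blast
  then have "finite (sign_homs ?G0 {}) \<and> card (sign_homs ?G0 {}) = (card (carrier R) - 1) ^ card B"
    using insert by (intro insert.IH int_subgroup_vanish1) auto
  then show ?case using card_sign_homs_extend[OF insert.prems(1) x F] insert by simp
qed

text \<open>Each \<open>i\<close> in \<open>Z\<close> multiplies the count by
  \<open>2 + 1 / (q - 1) = (2q - 1) / (q - 1)\<close>, the last term coming from the sublattice
  \<open>x $ i = 0\<close> of rank one less. Denominators are multiplied out so that the rank of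
  \<open>G\<close> need not be mentioned.\<close>

lemma card_sign_homs:
  assumes "int_subgroup G" "coords_indep G Z" "finite (sign_homs G {})" and F: "finite (carrier R)"
  shows "finite (sign_homs G Z) \<and>
    (card (carrier R) - 1) ^ card Z * card (sign_homs G Z) = (2 * card (carrier R) - 1) ^ card Z * card (sign_homs G {})"
  using finite[of Z] assms(1-3)
proof (induction Z arbitrary: G rule: finite_induct)
  case empty then show ?case by simp
next
  case (insert i Z)
  let ?G0 = "{y \<in> G. y $ i = 0}" and ?q = "card (carrier R)"
  obtain x where x: "x \<in> G" "x $ i > 0" using insert.prems(2) by (auto simp: coords_indep_def)
  have Z: "insert i Z - {i} = Z" using insert by auto
  have ind: "coords_indep ?G0 Z" using coords_indep_vanish1[OF insert.prems(2), of i] Z by simp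
  have ind': "coords_indep G Z" using insert.prems(2) coords_indep_subset by blast
  note ext = card_sign_homs_extend[OF insert.prems(1) x F]
  have 1: "finite (sign_homs G Z)" "(?q - 1) ^ card Z * card (sign_homs G Z) = (2 * ?q - 1) ^ card Z * card (sign_homs G {})"
    using insert.IH[OF insert.prems(1) ind' insert.prems(3)] by auto
  have 2: "finite (sign_homs ?G0 Z)" "(?q - 1) ^ card Z * card (sign_homs ?G0 Z) = (2 * ?q - 1) ^ card Z * card (sign_homs ?G0 {})"
    using insert.IH[OF int_subgroup_vanish1[OF insert.prems(1)] ind] ext(1) insert.prems(3) by auto
  note step = card_sign_homs_step[OF insert.prems(1) _ insert.prems(2), of i, unfolded Z, OF _ 1(1) 2(1)]
  have q: "?q \<ge> 1" using F one_closed by (auto simp: Suc_le_eq card_gt_0_iff)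
  have "(?q - 1) ^ card (insert i Z) * card (sign_homs G (insert i Z))
     = (?q - 1) * (2 * ((?q - 1) ^ card Z * card (sign_homs G Z)) + (?q - 1) ^ card Z * card (sign_homs ?G0 Z))"
    using insert step(2) by (simp add: algebra_simps)
  also have "\<dots> = (2 * ?q - 1) ^ card Z * (2 * (?q - 1) * card (sign_homs G {}) + (?q - 1) * card (sign_homs ?G0 {}))"
    unfolding 1(2) 2(2) by (simp only: distrib_left mult_ac)
  also have "\<dots> = (2 * ?q - 1) ^ card Z * ((2 * ?q - 1) * card (sign_homs G {}))"
  proof -
    have "2 * (?q - 1) + 1 = 2 * ?q - 1" using q by linarith
    then have "2 * (?q - 1) * card (sign_homs G {}) + card (sign_homs G {}) = (2 * ?q - 1) * card (sign_homs G {})"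
      by (metis add_mult_distrib mult_1)
    then show ?thesis by (simp add: ext(2))
  qed
  finally show ?case using step(1) insert by (simp add: algebra_simps)
qed

end

section \<open>Points of the level set\<close>

context ring
begin

definition zmul :: "int \<Rightarrow> 'a \<Rightarrow> 'a" where
  "zmul k x = x [^]\<^bsub>add_monoid R\<^esub> k"

lemma zmul_closed [simp]: "x \<in> carrier R \<Longrightarrow> zmul k x \<in> carrier R"
  using group.int_pow_closed[OF a_group, of x k] by (simp add: zmul_def)

lemma zmul_0 [simp]: "zmul 0 x = \<zero>"
  using int_pow_0[of "add_monoid R" x] by (simp add: zmul_def)

lemma zmul_1 [simp]: "x \<in> carrier R \<Longrightarrow> zmul 1 x = x"
  using group.int_pow_1[OF a_group, of x] by (simp add: zmul_def)

lemma zmul_add: "x \<in> carrier R \<Longrightarrow> zmul (k + l) x = zmul k x \<oplus> zmul l x"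
  using group.int_pow_mult[OF a_group, of x k l] by (simp add: zmul_def)

lemma zmul_mult: "x \<in> carrier R \<Longrightarrow> zmul (k * l) x = zmul k (zmul l x)"
  using group.int_pow_pow[OF a_group, of x l k] by (simp add: zmul_def mult.commute)

lemma zmul_neg: "x \<in> carrier R \<Longrightarrow> zmul (- k) x = \<ominus> zmul k x"
  using group.int_pow_neg[OF a_group, of x k] by (simp add: zmul_def a_inv_def)

lemma zmul_zero [simp]: "zmul k \<zero> = \<zero>"
  using group.int_pow_one[OF a_group, of k] by (simp add: zmul_def)

lemma zmul_m_assoc:
  assumes "x \<in> carrier R" "y \<in> carrier R" shows "zmul k x \<otimes> y = zmul k (x \<otimes> y)"
proof -
  have *: "zmul (int m) x \<otimes> y = zmul (int m) (x \<otimes> y)" for m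
    by (induction m) (use assms in \<open>auto simp: zmul_add l_distr\<close>)
  show ?thesis
  proof (cases "k \<ge> 0")
    case True then show ?thesis using *[of "nat k"] by simp
  next
    case False
    then have "k = - int (nat (- k))" by simp
    then show ?thesis using * assms zmul_neg l_minus by (metis zmul_closed m_closed)
  qed
qed

lemma zmul_one_mult: "x \<in> carrier R \<Longrightarrow> zmul k \<one> \<otimes> x = zmul k x"
  by (simp add: zmul_m_assoc)

definition pairing :: "int ^ 'n \<Rightarrow> ('n \<Rightarrow> 'a) \<Rightarrow> 'a" where
  "pairing x u = (\<Oplus>i\<in>UNIV. zmul (x $ i) (u i))"

lemma pairing_closed [simp]: "(\<And>i. u i \<in> carrier R) \<Longrightarrow> pairing x u \<in> carrier R"
  unfolding pairing_def by (intro finsum_closed) auto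

lemma pairing_add:
  fixes x :: "int ^ 'n::finite"
  shows "(\<And>i. u i \<in> carrier R) \<Longrightarrow> pairing (x + y) u = pairing x u \<oplus> pairing y u"
  unfolding pairing_def by (simp add: zmul_add finsum_addf)

lemma pairing_cong:
  fixes x :: "int ^ 'n::finite"
  assumes "\<And>i. u i \<in> carrier R" "\<And>i. v i \<in> carrier R" "\<And>i. x $ i \<noteq> 0 \<Longrightarrow> u i = v i"
  shows "pairing x u = pairing x v"
  unfolding pairing_def
proof (rule finsum_cong')
  fix i show "zmul (x $ i) (u i) = zmul (x $ i) (v i)" using assms(3) by (cases "x $ i = 0") auto
qed (use assms in auto)

lemma pairing_zero:
  fixes x :: "int ^ 'n::finite"
  assumes "\<And>i. u i \<in> carrier R" "\<And>i. x $ i \<noteq> 0 \<Longrightarrow> u i = \<zero>"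
  shows "pairing x u = \<zero>"
proof -
  have "pairing x u = pairing x (\<lambda>_. \<zero>)" using assms by (intro pairing_cong) auto
  then show ?thesis by (simp add: pairing_def)
qed

lemma pairing_axis:
  fixes u :: "'n::finite \<Rightarrow> 'a"
  assumes "\<And>i. u i \<in> carrier R"
  shows "pairing (axis i k) u = zmul k (u i)"
proof -
  have "pairing (axis i k) u = (\<Oplus>j\<in>UNIV. if i = j then zmul k (u j) else \<zero>)"
    unfolding pairing_def by (intro finsum_cong') (auto simp: assms axis_def)
  also have "\<dots> = zmul k (u i)" using assms by (intro finsum_singleton) auto
  finally show ?thesis .
qed

lemma pairing_0:
  fixes u :: "'n::finite \<Rightarrow> 'a"
  assumes "\<And>i. u i \<in> carrier R" shows "pairing 0 u = \<zero>"
  using pairing_zero[of u 0] assms by simp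

lemma pairing_diff:
  fixes x :: "int ^ 'n::finite"
  assumes "\<And>i. u i \<in> carrier R" shows "pairing (x - y) u = pairing x u \<ominus> pairing y u"
proof -
  have "pairing x u = pairing (x - y) u \<oplus> pairing y u" using pairing_add[of u "x - y" y] assms by simp
  then show ?thesis using pairing_closed assms by (simp add: a_minus_def a_assoc r_neg)
qed

lemma pairing_scale:
  fixes x :: "int ^ 'n::finite"
  assumes "\<And>i. u i \<in> carrier R" shows "pairing (k *s x) u = zmul k (pairing x u)"
proof -
  have *: "pairing (int m *s x) u = zmul (int m) (pairing x u)" for m
  proof (induction m)
    case 0 show ?case using pairing_0[OF assms] by simp
  next
    case (Suc m)
    have "int (Suc m) *s x = int m *s x + x" by (simp add: vec_eq_iff algebra_simps)
    then have "pairing (int (Suc m) *s x) u = pairing (int m *s x) u \<oplus> pairing x u" using pairing_add assms by metis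
    moreover have "zmul (int (Suc m)) (pairing x u) = zmul (int m) (pairing x u) \<oplus> pairing x u"
      using zmul_add[of "pairing x u" "int m" 1] assms by (simp add: add.commute)
    ultimately show ?case using Suc by simp
  qed
  show ?thesis
  proof (cases "k \<ge> 0")
    case True then show ?thesis using *[of "nat k"] by simp
  next
    case False
    define m where "m = nat (- k)"
    have k: "k = - int m" using False by (simp add: m_def)
    have "k *s x = 0 - int m *s x" by (simp add: k vec_eq_iff)
    then have "pairing (k *s x) u = \<zero> \<ominus> zmul (int m) (pairing x u)"
      using pairing_diff[of u 0 "int m *s x"] pairing_0[of u] * assms by simp
    then show ?thesis using assms by (simp add: k zmul_neg a_minus_def)
  qed
qed

text \<open>The vectors on which both sides agree form a subgroup that contains the unit
  vectors.\<close>

lemma additive_eq_pairing: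
  fixes H :: "int ^ 'n::finite \<Rightarrow> 'a"
  assumes H: "\<And>x. H x \<in> carrier R" "\<And>x y. H (x + y) = H x \<oplus> H y"
  shows "H x = pairing x (\<lambda>i. H (axis i 1))"
proof -
  let ?u = "\<lambda>i. H (axis i 1)"
  have H0: "H 0 = \<zero>" using H(2)[of 0 0] H(1)[of 0] by (metis add.l_cancel_one add_0)
  have Hd: "H (x - y) = H x \<ominus> H y" for x y
    using H(2)[of "x - y" y] H(1) by (simp add: a_minus_def a_assoc r_neg)
  have "int_subgroup {x. H x = pairing x ?u}"
    using H0 Hd by (auto simp: int_subgroup_def pairing_0 pairing_diff H(1))
  moreover have "axis i 1 \<in> {x. H x = pairing x ?u}" for i using pairing_axis[of ?u i 1] H(1) by simp
  ultimately have "(\<Sum>i\<in>UNIV. x $ i *s axis i 1) \<in> {x. H x = pairing x ?u}"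
    by (intro int_subgroup_sum int_subgroup_scale)
  then show ?thesis by (simp add: basis_expansion)
qed

end

text \<open>Here \<open>u i\<close> stands for the product \<open>z\<^sub>i w\<^sub>i\<close>.\<close>

definition level_set ::
  "('f, 'c) ring_scheme \<Rightarrow> ('n::finite \<Rightarrow> int ^ 'd) \<Rightarrow> (int ^ 'n \<Rightarrow> int) \<Rightarrow> ('n \<Rightarrow> 'f) set" where
  "level_set R a lam = {u. range u \<subseteq> carrier R \<and>
     (\<forall>x\<in>kernel_lattice a. ring.pairing R x u = ring.zmul R (lam x) \<one>\<^bsub>R\<^esub>)}"

context field
begin

text \<open>The order \<open>p ^ e\<close> of the additive group annihilates \<open>\<one>\<close>.
  If \<open>k\<close> did so too, then by Bezout \<open>\<one>\<close> would be zero, since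
  \<open>k\<close> is coprime to \<open>p ^ e\<close>.\<close>

lemma zmul_one_nz:
  assumes "Factorial_Ring.prime p" "card (carrier R) = p ^ e" "\<not> int p dvd k"
  shows "zmul k \<one> \<noteq> \<zero>"
proof
  assume 0: "zmul k \<one> = \<zero>"
  have "\<one> [^]\<^bsub>add_monoid R\<^esub> order (add_monoid R) = \<one>\<^bsub>add_monoid R\<^esub>"
    by (rule group.pow_order_eq_1[OF a_group]) simp
  then have pe: "zmul (int (p ^ e)) \<one> = \<zero>"
    using assms(2) int_pow_int[of "add_monoid R" \<one> "p ^ e"] by (simp add: zmul_def order_def)
  have "coprime k (int (p ^ e))"
    using prime_imp_coprime[of "int p" k] assms(1,3) by (simp add: coprime_commute)
  then obtain m n where "m * k + n * int (p ^ e) = 1"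
    using bezout_int[of k "int (p ^ e)"] by (auto simp: coprime_iff_gcd_eq_1)
  then have "\<one> = zmul (m * k + n * int (p ^ e)) \<one>" by simp
  also have "\<dots> = \<zero>" using 0 pe by (simp only: zmul_add zmul_mult one_closed zmul_zero) simp
  finally show False by simp
qed

lemma finite_level_set:
  fixes a :: "'n::finite \<Rightarrow> int ^ 'd::finite"
  assumes "finite (carrier R)" shows "finite (level_set R a lam)"
proof (rule finite_subset)
  show "level_set R a lam \<subseteq> (UNIV \<rightarrow>\<^sub>E carrier R)" by (auto simp: level_set_def)
  show "finite ((UNIV :: 'n set) \<rightarrow>\<^sub>E carrier R)" using assms by (intro finite_PiE) auto
qed

text \<open>Used in the contrapositive: a relation whose value under \<open>lam\<close> is nonzero
  in the field cannot be supported in the zero set of a point of the level set.\<close>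

lemma level_set_rel_free:
  fixes a :: "'n::finite \<Rightarrow> int ^ 'd::finite"
  assumes u: "u \<in> level_set R a lam" and x: "x \<in> kernel_lattice a" "\<And>i. x $ i \<noteq> 0 \<Longrightarrow> u i = \<zero>"
  shows "zmul (lam x) \<one> = \<zero>"
  using u x pairing_zero[of u x] unfolding level_set_def by fastforce

text \<open>When \<open>C\<close> is invertible, the equations of the circuits solve for the
  coordinates outside \<open>B\<close>, so the values on \<open>B\<close> are free parameters; those
  on \<open>S\<close> are prescribed to be zero.\<close>

lemma card_level_set:
  fixes a :: "'n::finite \<Rightarrow> int ^ 'd::finite"
  assumes lam: "lam \<in> lattice_dual (kernel_lattice a)"
    and kb: "kernel_basis a B C Y" and S: "S \<subseteq> B" and C: "zmul C \<one> \<noteq> \<zero>"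
  shows "card {u \<in> level_set R a lam. \<forall>i\<in>S. u i = \<zero>} = card (carrier R) ^ card (B - S)"
proof -
  note K = int_subgroup_kernel_lattice[of a]
  note C0 = kernel_basisD(2)[OF kb] and Y = kernel_basisD(3-5)[OF kb]
  let ?c = "zmul C \<one>"
  have c: "?c \<in> carrier R" "?c \<in> Units R" using C by (auto simp: field_Units)
  \<comment> \<open>The circuit without its entry at \<open>j\<close> involves only coordinates in
    \<open>B\<close>, so its equation determines \<open>u j\<close>, with coefficient
    \<open>C\<close>.\<close>
  define Y' where "Y' j = Y j - C *s axis j 1" for j
  have Y': "Y' j $ k = 0" if "j \<notin> B" "k \<notin> B" for j k
    using Y(2)[OF that(1)] Y(3)[OF that] by (cases "k = j") (auto simp: Y'_def axis_def)
  have pY: "pairing (Y j) u = pairing (Y' j) u \<oplus> ?c \<otimes> u j" if "\<And>i. u i \<in> carrier R" for j u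
  proof -
    have "pairing (Y' j + C *s axis j 1) u = pairing (Y' j) u \<oplus> zmul C (u j)"
      using that by (simp add: pairing_add pairing_scale pairing_axis)
    then show ?thesis using that by (simp add: Y'_def zmul_one_mult)
  qed
  have cancel: "x = \<zero>" if "zmul C x = \<zero>" "x \<in> carrier R" for x
    using that C c(1) integral zmul_one_mult by metis
  let ?L = "{u \<in> level_set R a lam. \<forall>i\<in>S. u i = \<zero>}"
  have "bij_betw (\<lambda>u. restrict u (B - S)) ?L ((B - S) \<rightarrow>\<^sub>E carrier R)"
  proof (rule bij_betw_imageI)
    show "inj_on (\<lambda>u. restrict u (B - S)) ?L"
    proof (rule inj_onI)
      fix u v assume u: "u \<in> ?L" and v: "v \<in> ?L" and eq: "restrict u (B - S) = restrict v (B - S)"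
      have uc: "\<And>i. u i \<in> carrier R" and vc: "\<And>i. v i \<in> carrier R"
        using u v by (auto simp: level_set_def)
      have uv: "u i = v i" if "i \<in> B" for i
        using u v fun_cong[OF eq, of i] that by (cases "i \<in> S") auto
      have "u j = v j" if j: "j \<notin> B" for j
      proof -
        have "pairing (Y j) u = pairing (Y j) v"
          using u v Y(1)[OF j] by (simp add: level_set_def)
        moreover have "pairing (Y' j) u = pairing (Y' j) v"
          using Y'[OF j] uv uc vc by (intro pairing_cong) auto
        ultimately have "?c \<otimes> u j = ?c \<otimes> v j"
          using pY[of u j] pY[of v j] uc vc c by simp
        then show ?thesis using C c uc vc m_lcancel by blast
      qed
      then show "u = v" using uv by blast
    qed
    show "(\<lambda>u. restrict u (B - S)) ` ?L = (B - S) \<rightarrow>\<^sub>E carrier R"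
    proof (intro equalityI subsetI)
      fix y assume "y \<in> (\<lambda>u. restrict u (B - S)) ` ?L"
      then obtain u where "u \<in> ?L" "y = restrict u (B - S)" by blast
      then show "y \<in> (B - S) \<rightarrow>\<^sub>E carrier R" by (simp add: level_set_def image_subset_iff restrict_PiE_iff)
    next
      fix y assume y: "y \<in> (B - S) \<rightarrow>\<^sub>E carrier R"
      define u0 where "u0 i = (if i \<in> B - S then y i else \<zero>)" for i
      have u0: "u0 i \<in> carrier R" for i using y by (auto simp: u0_def)
      define u where "u j = (if j \<in> B then u0 j else inv ?c \<otimes> (zmul (lam (Y j)) \<one> \<ominus> pairing (Y' j) u0))" for j
      have uc: "u i \<in> carrier R" for i using u0 c by (auto simp: u_def)
      let ?Q = "{x \<in> kernel_lattice a. pairing x u = zmul (lam x) \<one>}"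
      have "int_subgroup ?Q"
        unfolding int_subgroup_def
      proof (intro conjI ballI)
        show "0 \<in> ?Q" using int_subgroup_0[OF K] pairing_0[OF uc] lattice_dual_0[OF lam K] by simp
        fix x x' assume x: "x \<in> ?Q" "x' \<in> ?Q"
        have "zmul (lam (x - x')) \<one> = zmul (lam x) \<one> \<ominus> zmul (lam x') \<one>"
          using lattice_dual_diff[OF lam K] x zmul_add[of \<one> "lam x" "- lam x'"]
          by (simp add: zmul_neg a_minus_def)
        then show "x - x' \<in> ?Q" using x int_subgroup_diff[OF K] by (auto simp: pairing_diff[OF uc])
      qed
      note Q = this
      have YQ: "Y j \<in> ?Q" if j: "j \<notin> B" for j
      proof -
        have "pairing (Y' j) u = pairing (Y' j) u0"
          using Y'[OF j] u0 uc by (intro pairing_cong) (auto simp: u_def)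
        moreover have "?c \<otimes> u j = zmul (lam (Y j)) \<one> \<ominus> pairing (Y' j) u0"
          using c j u0 by (simp add: u_def flip: m_assoc)
        ultimately have "pairing (Y j) u = zmul (lam (Y j)) \<one>"
          using pY[of u j] uc u0 a_lcomm[of "pairing (Y' j) u0" "zmul (lam (Y j)) \<one>" "\<ominus> pairing (Y' j) u0"]
          by (simp add: a_minus_def r_neg)
        then show ?thesis using Y(1)[OF j] by simp
      qed
      have "pairing x u = zmul (lam x) \<one>" if x: "x \<in> kernel_lattice a" for x
      proof -
        \<comment> \<open>Only \<open>C *s x\<close> is known to be an integral combination of the
          circuits, so the equation for \<open>x\<close> is first obtained multiplied by
          \<open>C\<close> and then cancelled.\<close>
        have "(\<Sum>j\<in>-B. x $ j *s Y j) \<in> ?Q"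
          using YQ by (intro int_subgroup_sum[OF Q] int_subgroup_scale[OF Q]) auto
        then have "C *s x \<in> ?Q" using kernel_basis_span[OF kb x] by simp
        moreover have "lam (C *s x) = C * lam x"
          using lattice_dual_scale[OF lam K x, of "nat C"] C0 by simp
        ultimately have "zmul C (pairing x u) = zmul C (zmul (lam x) \<one>)"
          using uc by (simp add: pairing_scale zmul_mult)
        then have "?c \<otimes> pairing x u = ?c \<otimes> zmul (lam x) \<one>" using uc by (simp add: zmul_one_mult)
        then show ?thesis using C c uc m_lcancel by (metis one_closed pairing_closed zmul_closed)
      qed
      moreover have "\<forall>i\<in>S. u i = \<zero>" using S by (auto simp: u_def u0_def)
      ultimately have "u \<in> ?L" using uc by (auto simp: level_set_def)
      moreover have "restrict u (B - S) = y"
        using y by (intro extensionalityI[of _ "B - S"]) (auto simp: u_def u0_def PiE_def)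
      ultimately show "y \<in> (\<lambda>u. restrict u (B - S)) ` ?L" by blast
    qed
  qed
  from bij_betw_same_card[OF this] show ?thesis by (simp add: card_PiE)
qed

end

section \<open>Homomorphisms on invariant monomials\<close>

definition invariant_exps :: "('n::finite \<Rightarrow> int ^ 'd::finite) \<Rightarrow> (('n + 'n) \<Rightarrow>\<^sub>0 nat) set" where
  "invariant_exps a = {e. weight e \<in> trivial_characters a}"

text \<open>The exponents of \<open>z\<^sub>i w\<^sub>i\<close> and of the monomial of weight \<open>x\<close> divisible by no \<open>z\<^sub>i w\<^sub>i\<close>.\<close>

definition cross :: "'n \<Rightarrow> ('n + 'n) \<Rightarrow>\<^sub>0 nat" where
  "cross i = Poly_Mapping.single (Inl i) 1 + Poly_Mapping.single (Inr i) 1"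

definition reduced_exp :: "int ^ 'n::finite \<Rightarrow> ('n + 'n) \<Rightarrow>\<^sub>0 nat" where
  "reduced_exp x = Abs_poly_mapping (\<lambda>v. case v of Inl i \<Rightarrow> nat (x $ i) | Inr i \<Rightarrow> nat (- x $ i))"

lemma lookup_cross [simp]:
  "Poly_Mapping.lookup (cross i) (Inl j) = (if i = j then 1 else 0)"
  "Poly_Mapping.lookup (cross i) (Inr j) = (if i = j then 1 else 0)"
  by (auto simp: cross_def lookup_add lookup_single when_def)

lemma lookup_reduced_exp [simp]:
  "Poly_Mapping.lookup (reduced_exp x) (Inl j) = nat (x $ j)"
  "Poly_Mapping.lookup (reduced_exp x) (Inr j) = nat (- x $ j)"
  by (simp_all add: reduced_exp_def)

lemma exp_eqI:
  fixes e e' :: "('n + 'n) \<Rightarrow>\<^sub>0 nat"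
  assumes "\<And>i. Poly_Mapping.lookup e (Inl i) = Poly_Mapping.lookup e' (Inl i)"
    "\<And>i. Poly_Mapping.lookup e (Inr i) = Poly_Mapping.lookup e' (Inr i)"
  shows "e = e'"
proof (rule poly_mapping_eqI)
  fix v show "Poly_Mapping.lookup e v = Poly_Mapping.lookup e' v" using assms by (cases v) auto
qed

lemma weight_simps [simp]:
  "weight 0 = 0" "weight (e + e') = weight e + weight e'" "weight (cross i) = 0"
  "weight (reduced_exp x) = x"
  by (auto simp: weight_def vec_eq_iff lookup_add)

lemma reduced_exp_0 [simp]: "reduced_exp 0 = 0"
  by (rule exp_eqI) auto

lemma exp_reduced_or_cross:
  fixes e :: "('n::finite + 'n) \<Rightarrow>\<^sub>0 nat"
  obtains "e = reduced_exp (weight e)"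
  | i e' where "e = cross i + e'"
proof (cases "\<exists>i. Poly_Mapping.lookup e (Inl i) > 0 \<and> Poly_Mapping.lookup e (Inr i) > 0")
  case True
  then obtain i where i: "Poly_Mapping.lookup e (Inl i) > 0" "Poly_Mapping.lookup e (Inr i) > 0" by blast
  have "e = cross i + (e - cross i)"
    by (rule exp_eqI) (use i in \<open>auto simp: lookup_add lookup_minus\<close>)
  then show thesis using that by blast
next
  case False
  then have "e = reduced_exp (weight e)"
  proof (intro exp_eqI)
    fix i
    have "Poly_Mapping.lookup e (Inl i) = 0 \<or> Poly_Mapping.lookup e (Inr i) = 0" using False by auto
    then show "Poly_Mapping.lookup e (Inl i) = Poly_Mapping.lookup (reduced_exp (weight e)) (Inl i)"
      "Poly_Mapping.lookup e (Inr i) = Poly_Mapping.lookup (reduced_exp (weight e)) (Inr i)"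
      by (auto simp: weight_def)
  qed
  then show thesis using that by blast
qed

text \<open>A monomial divisible by no \<open>z_i w_i\<close> is determined by its weight; otherwise
  a factor \<open>z_i w_i\<close> can be removed, which lowers the total degree in the
  \<open>z_i\<close>.\<close>

lemma exp_induct [case_names reduced cross]:
  fixes e :: "('n::finite + 'n) \<Rightarrow>\<^sub>0 nat"
  assumes red: "\<And>x. P (reduced_exp x)" and step: "\<And>i e. P e \<Longrightarrow> P (cross i + e)"
  shows "P e"
proof (induction "\<Sum>i\<in>UNIV. Poly_Mapping.lookup e (Inl i)" arbitrary: e rule: less_induct)
  case less
  show ?case
  proof (cases e rule: exp_reduced_or_cross)
    case 1 then show ?thesis using red by metis
  next
    case (2 i e')
    have "(\<Sum>j\<in>UNIV. Poly_Mapping.lookup e' (Inl j)) < (\<Sum>j\<in>UNIV. Poly_Mapping.lookup e (Inl j))"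
      by (rule sum_strict_mono_ex1) (auto simp: 2 lookup_add)
    then show ?thesis using less step 2 by blast
  qed
qed

text \<open>The monomials on which a homomorphism can be nonzero when \<open>z_i w_i\<close> goes to
  zero for all \<open>i \<in> Z\<close>: no such product divides them.\<close>

definition clean :: "'n set \<Rightarrow> (('n + 'n) \<Rightarrow>\<^sub>0 nat) \<Rightarrow> bool" where
  "clean Z e \<longleftrightarrow> (\<forall>i\<in>Z. Poly_Mapping.lookup e (Inl i) = 0 \<or> Poly_Mapping.lookup e (Inr i) = 0)"

lemma clean_reduced_exp: "clean Z (reduced_exp x)"
  by (auto simp: clean_def)

lemma clean_cross: "clean Z (cross i + e) \<longleftrightarrow> i \<notin> Z \<and> clean Z e"
  by (auto simp: clean_def lookup_add)

text \<open>In a clean monomial the sign of the weight at \<open>i \<in> Z\<close> tells which of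
  \<open>z_i\<close>, \<open>w_i\<close> occurs. So a product of clean monomials stays clean exactly
  if no signs oppose each other, which is the condition in \<open>sign_homs\<close>.\<close>

lemma clean_add:
  "clean Z (e + e') \<longleftrightarrow> clean Z e \<and> clean Z e' \<and> (\<forall>i\<in>Z. weight e $ i * weight e' $ i \<ge> 0)"
proof -
  have "(p + p' = 0 \<or> m + m' = 0) \<longleftrightarrow> (p = 0 \<or> m = 0) \<and> (p' = 0 \<or> m' = 0) \<and> (int p - int m) * (int p' - int m') \<ge> 0"
    for p p' m m' :: nat
    by (cases "p = 0"; cases "m = 0"; cases "p' = 0"; cases "m' = 0") (auto simp: zero_le_mult_iff mult_le_0_iff)
  then show ?thesis unfolding clean_def by (auto simp: lookup_add weight_def)
qed

lemma clean_zero [simp]: "clean Z 0" by (simp add: clean_def)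

lemma int_subgroup_exps:
  "e \<in> invariant_exps a \<Longrightarrow> e' \<in> invariant_exps a \<Longrightarrow> e + e' \<in> invariant_exps a"
  "0 \<in> invariant_exps a" "cross i \<in> invariant_exps a"
  "reduced_exp x \<in> invariant_exps a \<longleftrightarrow> x \<in> trivial_characters a"
  using int_subgroup_add[OF int_subgroup_trivial_characters] int_subgroup_0[OF int_subgroup_trivial_characters]
  by (auto simp: invariant_exps_def)

context field
begin

definition exp_homs :: "('n::finite \<Rightarrow> int ^ 'd::finite) \<Rightarrow> (('n + 'n \<Rightarrow>\<^sub>0 nat) \<Rightarrow> 'a) set" where
  "exp_homs a = {\<phi> \<in> invariant_exps a \<rightarrow>\<^sub>E carrier R. \<phi> 0 = \<one> \<and>
     (\<forall>e\<in>invariant_exps a. \<forall>e'\<in>invariant_exps a. \<phi> (e + e') = \<phi> e \<otimes> \<phi> e')}"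

text \<open>The value of the monomial at the point with all \<open>z_i = 1\<close> and
  \<open>w_i = u i\<close>, where zeros of \<open>u\<close> are replaced by 1. Dividing by it
  normalizes the nonzero \<open>u i\<close> to 1.\<close>

definition unit_eval :: "('n::finite \<Rightarrow> 'a) \<Rightarrow> ('n + 'n \<Rightarrow>\<^sub>0 nat) \<Rightarrow> 'a" where
  "unit_eval u e = (\<Otimes>i\<in>UNIV. (if u i = \<zero> then \<one> else u i) [^] Poly_Mapping.lookup e (Inr i))"

lemma unit_eval_unit:
  assumes "\<And>i. u i \<in> carrier R" shows "unit_eval u e \<in> carrier R" "unit_eval u e \<noteq> \<zero>"
proof -
  have *: "(\<Otimes>i\<in>A. (if u i = \<zero> then \<one> else u i) [^] Poly_Mapping.lookup e (Inr i)) \<in> carrier R - {\<zero>}"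
    if "finite A" for A
    using that
  proof induction
    case empty show ?case by simp
  next
    case (insert i A)
    have "(if u i = \<zero> then \<one> else u i) [^] Poly_Mapping.lookup e (Inr i) \<in> carrier R - {\<zero>}"
      using assms pow_nz[of "if u i = \<zero> then \<one> else u i"] by auto
    moreover have "(\<lambda>i. (if u i = \<zero> then \<one> else u i) [^] Poly_Mapping.lookup e (Inr i)) \<in> A \<rightarrow> carrier R"
      using assms by auto
    ultimately show ?case using insert by (auto simp: integral_iff)
  qed
  from *[of UNIV] show "unit_eval u e \<in> carrier R" "unit_eval u e \<noteq> \<zero>" by (auto simp: unit_eval_def)
qed

lemma unit_eval_add:
  assumes "\<And>i. u i \<in> carrier R" shows "unit_eval u (e + e') = unit_eval u e \<otimes> unit_eval u e'"
proof -
  have "unit_eval u (e + e') = (\<Otimes>i\<in>UNIV. (if u i = \<zero> then \<one> else u i) [^] Poly_Mapping.lookup e (Inr i)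
     \<otimes> (if u i = \<zero> then \<one> else u i) [^] Poly_Mapping.lookup e' (Inr i))"
    unfolding unit_eval_def using assms by (intro finprod_cong') (auto simp: lookup_add nat_pow_mult)
  also have "\<dots> = unit_eval u e \<otimes> unit_eval u e'"
    unfolding unit_eval_def using assms by (intro finprod_multf) auto
  finally show ?thesis .
qed

lemma unit_eval_0 [simp]: "unit_eval u 0 = \<one>"
  by (simp add: unit_eval_def)

lemma unit_eval_cross:
  assumes "\<And>i. u i \<in> carrier R" "u i \<noteq> \<zero>" shows "unit_eval u (cross i) = u i"
proof -
  have "unit_eval u (cross i) = (\<Otimes>j\<in>UNIV. if i = j then (if u j = \<zero> then \<one> else u j) else \<one>)"
    unfolding unit_eval_def using assms by (intro finprod_cong') auto
  also have "\<dots> = u i" using assms by (subst finprod_singleton) auto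
  finally show ?thesis .
qed

lemma exp_homsD:
  assumes "\<phi> \<in> exp_homs a"
  shows "\<And>e. e \<in> invariant_exps a \<Longrightarrow> \<phi> e \<in> carrier R" "\<phi> \<in> extensional (invariant_exps a)" "\<phi> 0 = \<one>"
    "\<And>e e'. e \<in> invariant_exps a \<Longrightarrow> e' \<in> invariant_exps a \<Longrightarrow> \<phi> (e + e') = \<phi> e \<otimes> \<phi> e'"
  using assms by (auto simp: exp_homs_def PiE_def)

lemma inv_nz: "x \<in> carrier R \<Longrightarrow> x \<noteq> \<zero> \<Longrightarrow> inv x \<in> carrier R \<and> x \<otimes> inv x = \<one> \<and> inv x \<otimes> x = \<one>"
  using field_Units by auto

text \<open>Removing a factor \<open>z_i w_i\<close> divides both \<open>\<phi>\<close> and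
  \<open>unit_eval u\<close> by \<open>u i\<close> if that is nonzero, and shows
  \<open>\<phi>\<close> to be zero otherwise. What is left is the reduced monomial of the same
  weight.\<close>

lemma exp_homs_eq:
  assumes \<phi>: "\<phi> \<in> exp_homs a" and u: "\<And>i. \<phi> (cross i) = u i" and e: "e \<in> invariant_exps a"
  shows "\<phi> e = (if clean {i. u i = \<zero>} e
    then \<phi> (reduced_exp (weight e)) \<otimes> inv unit_eval u (reduced_exp (weight e)) \<otimes> unit_eval u e else \<zero>)"
  using e
proof (induction e rule: exp_induct)
  case (reduced x)
  have uc: "u i \<in> carrier R" for i using exp_homsD(1)[OF \<phi>] u int_subgroup_exps(3) by metis
  show ?case using inv_nz[OF unit_eval_unit[of u, OF uc]] unit_eval_unit[of u, OF uc] exp_homsD(1)[OF \<phi> reduced]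
    by (simp add: clean_reduced_exp m_assoc)
next
  case (cross i e)
  have uc: "u i \<in> carrier R" for i using exp_homsD(1)[OF \<phi>] u int_subgroup_exps(3) by metis
  have e: "e \<in> invariant_exps a" using cross.prems by (simp add: invariant_exps_def)
  then have r: "reduced_exp (weight e) \<in> invariant_exps a" by (simp add: invariant_exps_def)
  have eq: "\<phi> (cross i + e) = u i \<otimes> \<phi> e"
    using exp_homsD(4)[OF \<phi> int_subgroup_exps(3) e] u by simp
  show ?case
  proof (cases "u i = \<zero>")
    case True
    then show ?thesis using eq exp_homsD(1)[OF \<phi> e] by (simp add: clean_cross)
  next
    case False
    have "unit_eval u (cross i + e) = u i \<otimes> unit_eval u e"
      using unit_eval_add[of u, OF uc] unit_eval_cross[of u, OF uc False] by simp
    then show ?thesis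
      using False eq cross.IH[OF e] exp_homsD(1)[OF \<phi> r] inv_nz[OF unit_eval_unit[of u, OF uc]] unit_eval_unit[of u, OF uc] uc
      by (simp add: clean_cross m_lcomm)
  qed
qed

text \<open>By \<open>exp_homs_eq\<close>, \<open>\<phi>\<close> is known from its values on reduced
  monomials. The product of two of these differs from the reduced monomial of the sum by powers of
  \<open>z_i w_i\<close>; division by \<open>unit_eval u\<close> removes the nonzero ones, and the
  zero ones become the sign conditions.\<close>

lemma exp_homs_bij_sign_homs:
  assumes u: "\<And>i. u i \<in> carrier R"
  shows "bij_betw (\<lambda>\<phi>. \<lambda>x\<in>trivial_characters a. \<phi> (reduced_exp x) \<otimes> inv unit_eval u (reduced_exp x))
    {\<phi> \<in> exp_homs a. \<forall>i. \<phi> (cross i) = u i} (sign_homs (trivial_characters a) {i. u i = \<zero>})"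
  (is "bij_betw ?f ?A ?B")
proof (rule bij_betwI[where g = "\<lambda>f. \<lambda>e\<in>invariant_exps a. if clean {i. u i = \<zero>} e then f (weight e) \<otimes> unit_eval u e else \<zero>"])
  let ?M = "trivial_characters a" and ?Z = "{i. u i = \<zero>}"
  let ?g = "\<lambda>f. \<lambda>e\<in>invariant_exps a. if clean ?Z e then f (weight e) \<otimes> unit_eval u e else \<zero>"
  note ev = unit_eval_unit[of u, OF u] and evi = inv_nz[OF unit_eval_unit[of u, OF u]]
  note M = int_subgroup_trivial_characters[of a]
  have rearrange: "A \<otimes> (p \<otimes> q) \<otimes> (p' \<otimes> q') = A \<otimes> ((p \<otimes> p') \<otimes> (q \<otimes> q'))"
    if "A \<in> carrier R" "p \<in> carrier R" "q \<in> carrier R" "p' \<in> carrier R" "q' \<in> carrier R" for A p q p' q'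
    using that by (simp add: m_ac)
  show "?f \<in> ?A \<rightarrow> ?B"
  proof
    fix \<phi> assume "\<phi> \<in> ?A"
    then have \<phi>: "\<phi> \<in> exp_homs a" and cr: "\<And>i. \<phi> (cross i) = u i" by auto
    have c: "\<phi> (reduced_exp x) \<in> carrier R" if "x \<in> ?M" for x
      using exp_homsD(1)[OF \<phi>] that int_subgroup_exps(4) by metis
    have prod: "?f \<phi> x \<otimes> ?f \<phi> y = (if clean ?Z (reduced_exp x + reduced_exp y) then ?f \<phi> (x + y) else \<zero>)"
      if x: "x \<in> ?M" and y: "y \<in> ?M" for x y
    proof -
      have xy: "x + y \<in> ?M" using int_subgroup_add[OF M x y] .
      let ?e = "reduced_exp x + reduced_exp y"
      have r: "reduced_exp x \<in> invariant_exps a" "reduced_exp y \<in> invariant_exps a" "?e \<in> invariant_exps a"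
        using x y xy by (auto simp: invariant_exps_def)
      have "?f \<phi> x \<otimes> ?f \<phi> y = \<phi> ?e \<otimes> (inv unit_eval u (reduced_exp x) \<otimes> inv unit_eval u (reduced_exp y))"
        using exp_homsD(4)[OF \<phi> r(1,2)] x y c evi by (simp add: m_ac)
      also have "\<dots> = (if clean ?Z ?e then \<phi> (reduced_exp (x + y)) \<otimes> inv unit_eval u (reduced_exp (x + y)) \<otimes>
        (unit_eval u (reduced_exp x) \<otimes> unit_eval u (reduced_exp y)) \<otimes> (inv unit_eval u (reduced_exp x) \<otimes> inv unit_eval u (reduced_exp y)) else \<zero>)"
        unfolding exp_homs_eq[OF \<phi> cr r(3)] using evi by (simp add: unit_eval_add[of u, OF u])
      also have "\<dots> = (if clean ?Z ?e then \<phi> (reduced_exp (x + y)) \<otimes> inv unit_eval u (reduced_exp (x + y)) \<otimes>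
        ((unit_eval u (reduced_exp x) \<otimes> inv unit_eval u (reduced_exp x)) \<otimes> (unit_eval u (reduced_exp y) \<otimes> inv unit_eval u (reduced_exp y))) else \<zero>)"
        by (subst rearrange) (use c[OF xy] ev evi in auto)
      also have "\<dots> = (if clean ?Z ?e then ?f \<phi> (x + y) else \<zero>)" using xy c[OF xy] evi by simp
      finally show ?thesis .
    qed
    show "?f \<phi> \<in> ?B"
    proof (rule sign_homsI)
      show "?f \<phi> x \<in> carrier R" if "x \<in> ?M" for x using that c evi by simp
      show "?f \<phi> 0 = \<one>" using int_subgroup_0[OF M] exp_homsD(3)[OF \<phi>] evi by simp
      show "?f \<phi> x \<otimes> ?f \<phi> y = ?f \<phi> (x + y)" if "x \<in> ?M" "y \<in> ?M" "\<And>i. i \<in> ?Z \<Longrightarrow> 0 \<le> x $ i * y $ i" for x y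
        using that prod by (simp add: clean_add clean_reduced_exp)
      show "?f \<phi> x \<otimes> ?f \<phi> y = \<zero>" if "x \<in> ?M" "y \<in> ?M" "i \<in> ?Z" "x $ i * y $ i < 0" for x y i
      proof -
        have "\<not> clean ?Z (reduced_exp x + reduced_exp y)" using that by (auto simp: clean_add not_le)
        then show ?thesis using that prod by simp
      qed
    qed simp
  qed
  show "?g \<in> ?B \<rightarrow> ?A"
  proof
    fix f assume f: "f \<in> ?B"
    have w: "weight e \<in> ?M" if "e \<in> invariant_exps a" for e using that by (simp add: invariant_exps_def)
    have fc: "f (weight e) \<in> carrier R" if "e \<in> invariant_exps a" for e
      using sign_homsD(1)[OF f] w[OF that] .
    have gc: "?g f e \<in> carrier R" if "e \<in> invariant_exps a" for e using that fc ev by simp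
    have "?g f (e + e') = ?g f e \<otimes> ?g f e'" if e: "e \<in> invariant_exps a" and e': "e' \<in> invariant_exps a" for e e'
    proof (cases "clean ?Z e \<and> clean ?Z e'")
      case True
      show ?thesis
      proof (cases "\<forall>i\<in>?Z. weight e $ i * weight e' $ i \<ge> 0")
        case t: True
        then have "f (weight e + weight e') = f (weight e) \<otimes> f (weight e')"
          using w e e' by (intro sign_homsD(4)[OF f]) auto
        then show ?thesis using True t e e' int_subgroup_exps(1)[OF e e'] fc ev
          by (simp add: clean_add unit_eval_add[of u, OF u] m_ac)
      next
        case n: False
        then obtain i where "i \<in> ?Z" "weight e $ i * weight e' $ i < 0" by (auto simp: not_le)
        then have "f (weight e) \<otimes> f (weight e') = \<zero>" using sign_homsD(5)[OF f w[OF e] w[OF e']] by blast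
        then have "f (weight e) = \<zero> \<or> f (weight e') = \<zero>" using fc e e' integral by blast
        then have "?g f e \<otimes> ?g f e' = \<zero>" using True e e' fc ev by auto
        moreover have "\<not> clean ?Z (e + e')" using n unfolding clean_add by blast
        then have "?g f (e + e') = \<zero>" using int_subgroup_exps(1)[OF e e'] by simp
        ultimately show ?thesis by simp
      qed
    next
      case False
      then have "?g f e = \<zero> \<or> ?g f e' = \<zero>" using e e' by auto
      then have "?g f e \<otimes> ?g f e' = \<zero>"
        using l_null[OF gc[OF e']] r_null[OF gc[OF e]] by (elim disjE) (simp_all only:)
      moreover have "?g f (e + e') = \<zero>" using False int_subgroup_exps(1)[OF e e'] by (auto simp: clean_add)
      ultimately show ?thesis by simp
    qed
    moreover have "?g f 0 = \<one>" using sign_homsD(3)[OF f] by (simp add: int_subgroup_exps(2))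
    ultimately have "?g f \<in> exp_homs a" using gc by (auto simp: exp_homs_def)
    moreover have "?g f (cross i) = u i" for i
    proof -
      have "clean ?Z (cross i) \<longleftrightarrow> i \<notin> ?Z" using clean_cross[of ?Z i 0] by simp
      then show ?thesis using sign_homsD(3)[OF f] unit_eval_cross[of u, OF u] u
        by (cases "u i = \<zero>") (auto simp: int_subgroup_exps(3))
    qed
    ultimately show "?g f \<in> ?A" by blast
  qed
  show "?g (?f \<phi>) = \<phi>" if "\<phi> \<in> ?A" for \<phi>
  proof (rule extensionalityI[of _ "invariant_exps a"])
    have \<phi>: "\<phi> \<in> exp_homs a" and cr: "\<And>i. \<phi> (cross i) = u i" using that by auto
    show "\<phi> \<in> extensional (invariant_exps a)" using exp_homsD(2)[OF \<phi>] .
    fix e assume e: "e \<in> invariant_exps a"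
    then have "weight e \<in> ?M" by (simp add: invariant_exps_def)
    then show "?g (?f \<phi>) e = \<phi> e" using exp_homs_eq[OF \<phi> cr e] e by simp
  qed simp
  show "?f (?g f) = f" if f: "f \<in> ?B" for f
  proof (rule extensionalityI[of _ ?M])
    show "f \<in> extensional ?M" using sign_homsD(2)[OF f] .
    fix x assume x: "x \<in> ?M"
    then show "?f (?g f) x = f x"
      using sign_homsD(1)[OF f x] evi ev
      by (simp add: int_subgroup_exps(4) clean_reduced_exp m_assoc)
  qed simp
qed

text \<open>The monomials of weights \<open>x\<close> and \<open>- x\<close> multiply to powers of
  \<open>z_i w_i\<close> with \<open>x $ i \<noteq> 0\<close>, all of which have nonzero values. The
  weight \<open>x\<close> itself need not be trivial, so the two factors may lie in opposite nonzero
  degrees.\<close>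

lemma exp_homs_nonzero:
  assumes \<phi>: "\<phi> \<in> exp_homs a" and z: "\<And>i. \<phi> (cross i) = \<zero> \<Longrightarrow> x $ i = 0"
  shows "\<phi> (reduced_exp x + reduced_exp (- x)) \<noteq> \<zero>"
proof -
  define u where "u i = \<phi> (cross i)" for i
  have uc: "u i \<in> carrier R" for i using exp_homsD(1)[OF \<phi>] u_def int_subgroup_exps(3) by metis
  let ?e = "reduced_exp x + reduced_exp (- x)"
  have e: "?e \<in> invariant_exps a"
    using int_subgroup_0[OF int_subgroup_trivial_characters] by (simp add: invariant_exps_def)
  have "clean {i. u i = \<zero>} ?e" using z by (auto simp: clean_def u_def lookup_add)
  then have "\<phi> ?e = \<phi> 0 \<otimes> inv unit_eval u 0 \<otimes> unit_eval u ?e"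
    using exp_homs_eq[OF \<phi> _ e, of u] by (simp add: u_def)
  then show ?thesis using unit_eval_unit[of u, OF uc] exp_homsD(3)[OF \<phi>] inv_one by simp
qed

end

section \<open>Field-valued points of Proj and the degree zero part\<close>

text \<open>Degrees run over all integers although Proj sees only the non-negative ones: a fraction
  of degree \<open>m\<close> is evaluated by multiplying both terms by an element of degree
  \<open>- m\<close>. The pieces may overlap inside \<open>R\<close>.\<close>

locale int_graded = R: cring R + F: field F
  for R (structure) and F (structure) +
  fixes T :: "int \<Rightarrow> 'a set"
  assumes T_additive: "\<And>m. additive_subgroup (T m) R"
    and T_mult: "\<And>l m f g. f \<in> T l \<Longrightarrow> g \<in> T m \<Longrightarrow> f \<otimes> g \<in> T (l + m)"
    and T_one: "\<one> \<in> T 0"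
begin

definition hom0 :: "('a \<Rightarrow> 'c) set" where
  "hom0 = {\<psi> \<in> T 0 \<rightarrow>\<^sub>E carrier F. \<psi> \<one> = \<one>\<^bsub>F\<^esub> \<and>
     (\<forall>f\<in>T 0. \<forall>g\<in>T 0. \<psi> (f \<oplus> g) = \<psi> f \<oplus>\<^bsub>F\<^esub> \<psi> g \<and> \<psi> (f \<otimes> g) = \<psi> f \<otimes>\<^bsub>F\<^esub> \<psi> g)}"

definition unit_pair :: "('a \<Rightarrow> 'c) \<Rightarrow> bool" where
  "unit_pair \<psi> \<longleftrightarrow> (\<exists>D>0. \<exists>e\<in>T D. \<exists>e'\<in>T (- D). \<psi> (e \<otimes> e') \<noteq> \<zero>\<^bsub>F\<^esub>)"

abbreviation S :: "nat \<Rightarrow> 'a set" where "S m \<equiv> T (int m)"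

lemma T_carrier: "f \<in> T m \<Longrightarrow> f \<in> carrier R"
  using T_additive additive_subgroup.a_Hcarr by metis

lemma T_add: "f \<in> T m \<Longrightarrow> g \<in> T m \<Longrightarrow> f \<oplus> g \<in> T m"
  using T_additive additive_subgroup.a_closed by metis

lemma T_zero: "\<zero> \<in> T m"
  using T_additive additive_subgroup.zero_closed by metis

lemma T_neg: "f \<in> T m \<Longrightarrow> \<ominus> f \<in> T m"
  using T_additive additive_subgroup.a_inv_closed by metis

lemma T_pow: "f \<in> T m \<Longrightarrow> f [^] k \<in> T (int k * m)"
proof (induction k)
  case 0 then show ?case by (simp add: T_one)
next
  case (Suc k)
  then have "f [^] k \<otimes> f \<in> T (int k * m + m)" by (intro T_mult) auto
  then show ?case by (simp add: algebra_simps)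
qed

lemma T_mult0: "f \<in> T m \<Longrightarrow> h \<in> T (- m) \<Longrightarrow> f \<otimes> h \<in> T 0"
  using T_mult[of f m h "-m"] by simp

lemma hom0D:
  assumes "\<psi> \<in> hom0"
  shows "\<And>f. f \<in> T 0 \<Longrightarrow> \<psi> f \<in> carrier F" "\<psi> \<one> = \<one>\<^bsub>F\<^esub>"
    "\<And>f g. f \<in> T 0 \<Longrightarrow> g \<in> T 0 \<Longrightarrow> \<psi> (f \<oplus> g) = \<psi> f \<oplus>\<^bsub>F\<^esub> \<psi> g"
    "\<And>f g. f \<in> T 0 \<Longrightarrow> g \<in> T 0 \<Longrightarrow> \<psi> (f \<otimes> g) = \<psi> f \<otimes>\<^bsub>F\<^esub> \<psi> g"
    "\<psi> \<in> extensional (T 0)"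
  using assms by (auto simp: hom0_def PiE_def)

lemma hom0_zero: assumes "\<psi> \<in> hom0" shows "\<psi> \<zero> = \<zero>\<^bsub>F\<^esub>"
proof -
  have "\<psi> \<zero> \<oplus>\<^bsub>F\<^esub> \<psi> \<zero> = \<psi> \<zero>"
    using hom0D(3)[OF assms T_zero T_zero] by simp
  then show ?thesis
    using hom0D(1)[OF assms T_zero] F.add.l_cancel_one by blast
qed

lemma hom0_neg: assumes "\<psi> \<in> hom0" "f \<in> T 0" shows "\<psi> (\<ominus> f) = \<ominus>\<^bsub>F\<^esub> \<psi> f"
proof -
  have "\<psi> (\<ominus> f) \<oplus>\<^bsub>F\<^esub> \<psi> f = \<zero>\<^bsub>F\<^esub>"
    using hom0D(3)[OF assms(1) T_neg[OF assms(2)] assms(2)] hom0_zero[OF assms(1)] T_carrier[OF assms(2)]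
    by (simp add: R.l_neg)
  then show ?thesis
    by (intro F.minus_equality[symmetric] hom0D(1)[OF assms(1)] T_neg assms(2)) 
qed

text \<open>Vanishing at the point of Proj above \<open>\<psi>\<close>, tested through degree 0,
  which is all that \<open>\<psi>\<close> can see.\<close>

definition prime_of :: "('a \<Rightarrow> 'c) \<Rightarrow> nat \<Rightarrow> 'a set" where
  "prime_of \<psi> m = {f \<in> S m. \<forall>h\<in>T (- int m). \<psi> (f \<otimes> h) = \<zero>\<^bsub>F\<^esub>}"

definition denom :: "('a \<Rightarrow> 'c) \<Rightarrow> nat \<Rightarrow> 'a \<Rightarrow> 'a" where
  "denom \<psi> m f = (SOME h. h \<in> T (- int m) \<and> \<psi> (f \<otimes> h) \<noteq> \<zero>\<^bsub>F\<^esub>)"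

definition res_of :: "('a \<Rightarrow> 'c) \<Rightarrow> nat \<times> 'a \<times> 'a \<Rightarrow> 'c" where
  "res_of \<psi> = restrict (\<lambda>(m, g, f). \<psi> (g \<otimes> denom \<psi> m f) \<otimes>\<^bsub>F\<^esub> inv\<^bsub>F\<^esub> \<psi> (f \<otimes> denom \<psi> m f))
     (fractions_at S (prime_of \<psi>))"

lemma denom:
  assumes "f \<in> S m - prime_of \<psi> m"
  shows "denom \<psi> m f \<in> T (- int m)" "\<psi> (f \<otimes> denom \<psi> m f) \<noteq> \<zero>\<^bsub>F\<^esub>"
proof -
  have "\<exists>h. h \<in> T (- int m) \<and> \<psi> (f \<otimes> h) \<noteq> \<zero>\<^bsub>F\<^esub>"
    using assms by (auto simp: prime_of_def)
  from someI_ex[OF this] show "denom \<psi> m f \<in> T (- int m)" "\<psi> (f \<otimes> denom \<psi> m f) \<noteq> \<zero>\<^bsub>F\<^esub>"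
    unfolding denom_def by auto
qed

lemma F_inv: "x \<in> carrier F \<Longrightarrow> x \<noteq> \<zero>\<^bsub>F\<^esub> \<Longrightarrow> inv\<^bsub>F\<^esub> x \<in> carrier F \<and> x \<otimes>\<^bsub>F\<^esub> inv\<^bsub>F\<^esub> x = \<one>\<^bsub>F\<^esub>"
  using F.field_Units by auto

lemma F_eq_div:
  assumes "x \<in> carrier F" "y \<in> carrier F" "z \<in> carrier F" "y \<noteq> \<zero>\<^bsub>F\<^esub>" "z \<otimes>\<^bsub>F\<^esub> y = x"
  shows "x \<otimes>\<^bsub>F\<^esub> inv\<^bsub>F\<^esub> y = z"
  using assms F_inv[of y] by (metis F.m_assoc F.r_one)

text \<open>Cross-multiplication shows that the value does not depend on the choice of \<open>h\<close>.\<close>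

lemma res_of_eq:
  assumes \<psi>: "\<psi> \<in> hom0" and g: "g \<in> S m" and f: "f \<in> S m"
    and h: "h \<in> T (- int m)" and nz: "\<psi> (f \<otimes> h) \<noteq> \<zero>\<^bsub>F\<^esub>"
  shows "res_of \<psi> (m, g, f) = \<psi> (g \<otimes> h) \<otimes>\<^bsub>F\<^esub> inv\<^bsub>F\<^esub> \<psi> (f \<otimes> h)"
proof -
  have fP: "f \<in> S m - prime_of \<psi> m" using f h nz by (auto simp: prime_of_def)
  define k where "k = denom \<psi> m f"
  have k: "k \<in> T (- int m)" "\<psi> (f \<otimes> k) \<noteq> \<zero>\<^bsub>F\<^esub>"
    using denom[OF fP] by (auto simp: k_def)
  note T0 = T_mult0[OF g h] T_mult0[OF g k(1)] T_mult0[OF f h] T_mult0[OF f k(1)]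
  note car = T0[THEN hom0D(1)[OF \<psi>]]
  note Rcar = T_carrier[OF g] T_carrier[OF f] T_carrier[OF h] T_carrier[OF k(1)]
  have "\<psi> (g \<otimes> k) \<otimes>\<^bsub>F\<^esub> \<psi> (f \<otimes> h) = \<psi> ((g \<otimes> k) \<otimes> (f \<otimes> h))"
    using hom0D(4)[OF \<psi>] T0 by simp
  also have "(g \<otimes> k) \<otimes> (f \<otimes> h) = (g \<otimes> h) \<otimes> (f \<otimes> k)"
    using Rcar by (simp add: R.m_ac)
  also have "\<psi> \<dots> = \<psi> (g \<otimes> h) \<otimes>\<^bsub>F\<^esub> \<psi> (f \<otimes> k)"
    using hom0D(4)[OF \<psi>] T0 by simp
  finally have eq: "\<psi> (g \<otimes> k) \<otimes>\<^bsub>F\<^esub> \<psi> (f \<otimes> h) = \<psi> (g \<otimes> h) \<otimes>\<^bsub>F\<^esub> \<psi> (f \<otimes> k)" .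
  have i: "inv\<^bsub>F\<^esub> \<psi> (f \<otimes> h) \<in> carrier F" using F_inv nz car by blast
  have "\<psi> (g \<otimes> k) \<otimes>\<^bsub>F\<^esub> inv\<^bsub>F\<^esub> \<psi> (f \<otimes> k) = \<psi> (g \<otimes> h) \<otimes>\<^bsub>F\<^esub> inv\<^bsub>F\<^esub> \<psi> (f \<otimes> h)"
  proof (rule F_eq_div)
    have "\<psi> (g \<otimes> h) \<otimes>\<^bsub>F\<^esub> inv\<^bsub>F\<^esub> \<psi> (f \<otimes> h) \<otimes>\<^bsub>F\<^esub> \<psi> (f \<otimes> k) =
        (\<psi> (g \<otimes> h) \<otimes>\<^bsub>F\<^esub> \<psi> (f \<otimes> k)) \<otimes>\<^bsub>F\<^esub> inv\<^bsub>F\<^esub> \<psi> (f \<otimes> h)"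
      using car i by (simp add: F.m_ac)
    also have "\<dots> = \<psi> (g \<otimes> k) \<otimes>\<^bsub>F\<^esub> (\<psi> (f \<otimes> h) \<otimes>\<^bsub>F\<^esub> inv\<^bsub>F\<^esub> \<psi> (f \<otimes> h))"
      using car i by (simp add: F.m_assoc flip: eq)
    also have "\<dots> = \<psi> (g \<otimes> k)" using F_inv[OF car(3) nz] car by simp
    finally show "\<psi> (g \<otimes> h) \<otimes>\<^bsub>F\<^esub> inv\<^bsub>F\<^esub> \<psi> (f \<otimes> h) \<otimes>\<^bsub>F\<^esub> \<psi> (f \<otimes> k) = \<psi> (g \<otimes> k)" .
  qed (use car k i in auto)
  then show ?thesis using fP g by (simp add: res_of_def fractions_at_def k_def)
qed

lemma prime_of_homogeneous_prime:
  assumes \<psi>: "\<psi> \<in> hom0"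
  shows "homogeneous_prime R S (prime_of \<psi>)"
  unfolding homogeneous_prime_def homogeneous_ideal_def
proof (intro conjI allI ballI impI)
  fix m show "prime_of \<psi> m \<subseteq> S m" by (auto simp: prime_of_def)
  have sub: "subgroup (prime_of \<psi> m) (add_monoid R)"
  proof (rule R.add.subgroupI)
    show "prime_of \<psi> m \<subseteq> carrier R" using T_carrier by (auto simp: prime_of_def)
    show "prime_of \<psi> m \<noteq> {}"
      using T_zero[of "int m"] T_carrier hom0_zero[OF \<psi>] by (auto simp: prime_of_def)
    show "\<ominus> f \<in> prime_of \<psi> m" if "f \<in> prime_of \<psi> m" for f
      using that T_neg T_carrier T_mult0 hom0_neg[OF \<psi>] by (auto simp: prime_of_def R.l_minus)
    show "f \<oplus> g \<in> prime_of \<psi> m" if "f \<in> prime_of \<psi> m" "g \<in> prime_of \<psi> m" for f g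
      using that T_add T_carrier T_mult0 hom0D(3)[OF \<psi>] by (auto simp: prime_of_def R.l_distr)
  qed
  then show "additive_subgroup (prime_of \<psi> m) R" by (simp add: additive_subgroup_def)
next
  fix l m f g assume f: "f \<in> S l" and g: "g \<in> prime_of \<psi> m"
  have "\<psi> (f \<otimes> g \<otimes> h) = \<zero>\<^bsub>F\<^esub>" if h: "h \<in> T (- int (l + m))" for h
  proof -
    have "f \<otimes> h \<in> T (- int m)" using T_mult[OF f h] by simp
    moreover have "f \<otimes> g \<otimes> h = g \<otimes> (f \<otimes> h)"
      using f g h T_carrier by (auto simp: prime_of_def R.m_ac)
    ultimately show ?thesis using g by (auto simp: prime_of_def)
  qed
  then show "f \<otimes> g \<in> prime_of \<psi> (l + m)"
    using T_mult[of f "int l" g "int m"] f g by (auto simp: prime_of_def)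
next
  show "\<one> \<notin> prime_of \<psi> 0" using T_one hom0D(2)[OF \<psi>] F.one_not_zero
    by (auto simp: prime_of_def intro!: bexI[of _ "\<one>"])
next
  fix l m f g assume f: "f \<in> S l" and g: "g \<in> S m" and fg: "f \<otimes> g \<in> prime_of \<psi> (l + m)"
  show "f \<in> prime_of \<psi> l \<or> g \<in> prime_of \<psi> m"
  proof (rule ccontr)
    assume "\<not> ?thesis"
    then obtain h k where h: "h \<in> T (- int l)" "\<psi> (f \<otimes> h) \<noteq> \<zero>\<^bsub>F\<^esub>"
      and k: "k \<in> T (- int m)" "\<psi> (g \<otimes> k) \<noteq> \<zero>\<^bsub>F\<^esub>"
      using f g by (auto simp: prime_of_def)
    note T0 = T_mult0[OF f h(1)] T_mult0[OF g k(1)]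
    \<comment> \<open>The product of the two elements that detect \<open>f\<close> and
      \<open>g\<close> detects \<open>f \<otimes> g\<close>.\<close>
    have "h \<otimes> k \<in> T (- int (l + m))" using T_mult[OF h(1) k(1)] by simp
    then have "\<zero>\<^bsub>F\<^esub> = \<psi> (f \<otimes> g \<otimes> (h \<otimes> k))" using fg by (auto simp: prime_of_def)
    also have "f \<otimes> g \<otimes> (h \<otimes> k) = (f \<otimes> h) \<otimes> (g \<otimes> k)"
      using T_carrier f g h k by (simp add: R.m_ac)
    also have "\<psi> \<dots> = \<psi> (f \<otimes> h) \<otimes>\<^bsub>F\<^esub> \<psi> (g \<otimes> k)" using hom0D(4)[OF \<psi>] T0 by simp
    finally show False using h k T0 hom0D(1)[OF \<psi>] F.integral by metis
  qed
qed

lemma res_of_residue_field_homs: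
  assumes \<psi>: "\<psi> \<in> hom0"
  shows "res_of \<psi> \<in> residue_field_homs R S (prime_of \<psi>) F"
proof -
  let ?P = "prime_of \<psi>"
  have val: "\<exists>h\<in>T (- int m). \<psi> (f \<otimes> h) \<in> carrier F \<and> \<psi> (f \<otimes> h) \<noteq> \<zero>\<^bsub>F\<^esub> \<and> 
      (\<forall>g\<in>S m. \<psi> (g \<otimes> h) \<in> carrier F \<and> 
         res_of \<psi> (m, g, f) = \<psi> (g \<otimes> h) \<otimes>\<^bsub>F\<^esub> inv\<^bsub>F\<^esub> \<psi> (f \<otimes> h))"
    if "f \<in> S m - ?P m" for m f
  proof (rule bexI)
    show h: "denom \<psi> m f \<in> T (- int m)" using denom[OF that] by simp
    show "\<psi> (f \<otimes> denom \<psi> m f) \<in> carrier F \<and> \<psi> (f \<otimes> denom \<psi> m f) \<noteq> \<zero>\<^bsub>F\<^esub> \<and> 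
      (\<forall>g\<in>S m. \<psi> (g \<otimes> denom \<psi> m f) \<in> carrier F \<and> 
         res_of \<psi> (m, g, f) = \<psi> (g \<otimes> denom \<psi> m f) \<otimes>\<^bsub>F\<^esub> inv\<^bsub>F\<^esub> \<psi> (f \<otimes> denom \<psi> m f))"
      using denom[OF that] hom0D(1)[OF \<psi>] T_mult0 res_of_eq[OF \<psi>] that by auto
  qed
  show ?thesis
    unfolding residue_field_homs_def
  proof (intro CollectI conjI allI ballI)
    show "res_of \<psi> \<in> fractions_at S ?P \<rightarrow>\<^sub>E carrier F"
    proof
      fix x assume "x \<in> fractions_at S ?P"
      then obtain m g f where x: "x = (m, g, f)" "g \<in> S m" "f \<in> S m - ?P m"
        by (auto simp: fractions_at_def)
      with val[OF x(3)] F_inv show "res_of \<psi> x \<in> carrier F" by fastforce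
    qed (simp add: res_of_def)
  next
    fix m f assume f: "f \<in> S m - ?P m"
    then show "res_of \<psi> (m, f, f) = \<one>\<^bsub>F\<^esub>" using val[OF f] F_inv by fastforce
  next
    fix m g g' f assume g: "g \<in> S m" "g' \<in> S m" and f: "f \<in> S m - ?P m"
    from val[OF f] obtain h where h: "h \<in> T (- int m)" "\<psi> (f \<otimes> h) \<in> carrier F" "\<psi> (f \<otimes> h) \<noteq> \<zero>\<^bsub>F\<^esub>"
      and v: "\<And>g. g \<in> S m \<Longrightarrow> \<psi> (g \<otimes> h) \<in> carrier F \<and> 
         res_of \<psi> (m, g, f) = \<psi> (g \<otimes> h) \<otimes>\<^bsub>F\<^esub> inv\<^bsub>F\<^esub> \<psi> (f \<otimes> h)" by blast
    have "\<psi> ((g \<oplus> g') \<otimes> h) = \<psi> (g \<otimes> h) \<oplus>\<^bsub>F\<^esub> \<psi> (g' \<otimes> h)"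
      using g h T_carrier T_mult0 hom0D(3)[OF \<psi>] by (simp add: R.l_distr)
    then show "res_of \<psi> (m, g \<oplus> g', f) = res_of \<psi> (m, g, f) \<oplus>\<^bsub>F\<^esub> res_of \<psi> (m, g', f)"
      using v[OF g(1)] v[OF g(2)] v[OF T_add[OF g]] F_inv[OF h(2,3)] by (simp add: F.l_distr)
  next
    fix l m g f g' f' assume g: "g \<in> S l" and f: "f \<in> S l - ?P l" and g': "g' \<in> S m" and f': "f' \<in> S m - ?P m"
    from val[OF f] obtain h where h: "h \<in> T (- int l)" "\<psi> (f \<otimes> h) \<in> carrier F" "\<psi> (f \<otimes> h) \<noteq> \<zero>\<^bsub>F\<^esub>"
      and v: "\<And>g. g \<in> S l \<Longrightarrow> \<psi> (g \<otimes> h) \<in> carrier F \<and> 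
         res_of \<psi> (l, g, f) = \<psi> (g \<otimes> h) \<otimes>\<^bsub>F\<^esub> inv\<^bsub>F\<^esub> \<psi> (f \<otimes> h)" by blast
    from val[OF f'] obtain h' where h': "h' \<in> T (- int m)" "\<psi> (f' \<otimes> h') \<in> carrier F" "\<psi> (f' \<otimes> h') \<noteq> \<zero>\<^bsub>F\<^esub>"
      and v': "\<And>g. g \<in> S m \<Longrightarrow> \<psi> (g \<otimes> h') \<in> carrier F \<and> 
         res_of \<psi> (m, g, f') = \<psi> (g \<otimes> h') \<otimes>\<^bsub>F\<^esub> inv\<^bsub>F\<^esub> \<psi> (f' \<otimes> h')" by blast
    have hh: "h \<otimes> h' \<in> T (- int (l + m))" using T_mult[OF h(1) h'(1)] by simp
    have prod: "\<psi> (x \<otimes> x' \<otimes> (h \<otimes> h')) = \<psi> (x \<otimes> h) \<otimes>\<^bsub>F\<^esub> \<psi> (x' \<otimes> h')"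
      if "x \<in> S l" "x' \<in> S m" for x x'
    proof -
      have "x \<otimes> x' \<otimes> (h \<otimes> h') = (x \<otimes> h) \<otimes> (x' \<otimes> h')"
        using T_carrier that h h' by (simp add: R.m_ac)
      then show ?thesis using hom0D(4)[OF \<psi>] T_mult0 that h h' by simp
    qed
    have nz: "\<psi> (f \<otimes> f' \<otimes> (h \<otimes> h')) \<noteq> \<zero>\<^bsub>F\<^esub>"
      using prod f f' h h' F.integral by fastforce
    have ff: "f \<otimes> f' \<in> S (l + m)" "g \<otimes> g' \<in> S (l + m)" using T_mult f f' g g' by fastforce+
    have "res_of \<psi> (l + m, g \<otimes> g', f \<otimes> f') =
      (\<psi> (g \<otimes> h) \<otimes>\<^bsub>F\<^esub> \<psi> (g' \<otimes> h')) \<otimes>\<^bsub>F\<^esub> inv\<^bsub>F\<^esub> (\<psi> (f \<otimes> h) \<otimes>\<^bsub>F\<^esub> \<psi> (f' \<otimes> h'))"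
      using res_of_eq[OF \<psi> ff(2,1) hh nz] prod f f' g g' by simp
    also have "\<dots> = res_of \<psi> (l, g, f) \<otimes>\<^bsub>F\<^esub> res_of \<psi> (m, g', f')"
    proof (rule F_eq_div)
      have c: "\<psi> (g \<otimes> h) \<in> carrier F" "\<psi> (g' \<otimes> h') \<in> carrier F" using v v' g g' by auto
      note i = F_inv[OF h(2,3)] F_inv[OF h'(2,3)]
      have "res_of \<psi> (l, g, f) \<otimes>\<^bsub>F\<^esub> res_of \<psi> (m, g', f') \<otimes>\<^bsub>F\<^esub> (\<psi> (f \<otimes> h) \<otimes>\<^bsub>F\<^esub> \<psi> (f' \<otimes> h')) =
        (\<psi> (g \<otimes> h) \<otimes>\<^bsub>F\<^esub> \<psi> (g' \<otimes> h')) \<otimes>\<^bsub>F\<^esub> ((\<psi> (f \<otimes> h) \<otimes>\<^bsub>F\<^esub> inv\<^bsub>F\<^esub> \<psi> (f \<otimes> h)) \<otimes>\<^bsub>F\<^esub> (\<psi> (f' \<otimes> h') \<otimes>\<^bsub>F\<^esub> inv\<^bsub>F\<^esub> \<psi> (f' \<otimes> h')))"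
        using v[OF g] v'[OF g'] h h' c i by (simp add: F.m_ac)
      then show "res_of \<psi> (l, g, f) \<otimes>\<^bsub>F\<^esub> res_of \<psi> (m, g', f') \<otimes>\<^bsub>F\<^esub> (\<psi> (f \<otimes> h) \<otimes>\<^bsub>F\<^esub> \<psi> (f' \<otimes> h')) =
         \<psi> (g \<otimes> h) \<otimes>\<^bsub>F\<^esub> \<psi> (g' \<otimes> h')" using i c by simp
    qed (use h h' v[OF g] v'[OF g'] F_inv F.integral in auto)
    finally show "res_of \<psi> (l + m, g \<otimes> g', f \<otimes> f') = res_of \<psi> (l, g, f) \<otimes>\<^bsub>F\<^esub> res_of \<psi> (m, g', f')" .
  next
    fix m g f assume g: "g \<in> ?P m" and f: "f \<in> S m - ?P m"
    then have gS: "g \<in> S m" by (simp add: prime_of_def)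
    with g val[OF f] F_inv show "res_of \<psi> (m, g, f) = \<zero>\<^bsub>F\<^esub>" by (fastforce simp: prime_of_def)
  qed
qed

lemma res_of_degree_0:
  assumes \<psi>: "\<psi> \<in> hom0" and g: "g \<in> T 0"
  shows "res_of \<psi> (0, g, \<one>) = \<psi> g"
  using res_of_eq[OF \<psi>, of g 0 "\<one>" "\<one>"] g T_one T_carrier hom0D(1,2)[OF \<psi>]
  by simp

lemma residue_field_homsD:
  assumes "\<theta> \<in> residue_field_homs R S P F"
  shows "\<And>m g f. f \<in> S m - P m \<Longrightarrow> g \<in> S m \<Longrightarrow> \<theta> (m, g, f) \<in> carrier F"
    "\<And>m f. f \<in> S m - P m \<Longrightarrow> \<theta> (m, f, f) = \<one>\<^bsub>F\<^esub>"
    "\<And>m g g' f. g \<in> S m \<Longrightarrow> g' \<in> S m \<Longrightarrow> f \<in> S m - P m \<Longrightarrow>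
       \<theta> (m, g \<oplus> g', f) = \<theta> (m, g, f) \<oplus>\<^bsub>F\<^esub> \<theta> (m, g', f)"
    "\<And>l m g f g' f'. g \<in> S l \<Longrightarrow> f \<in> S l - P l \<Longrightarrow> g' \<in> S m \<Longrightarrow> f' \<in> S m - P m \<Longrightarrow>
       \<theta> (l + m, g \<otimes> g', f \<otimes> f') = \<theta> (l, g, f) \<otimes>\<^bsub>F\<^esub> \<theta> (m, g', f')"
    "\<And>m g f. g \<in> P m \<Longrightarrow> f \<in> S m - P m \<Longrightarrow> \<theta> (m, g, f) = \<zero>\<^bsub>F\<^esub>"
    "\<theta> \<in> extensional (fractions_at S P)"
  using assms by (simp_all add: residue_field_homs_def PiE_def Pi_def fractions_at_def)

section \<open>Recovering a point of Proj from degree zero\<close>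

lemma proj_field_point_hom0:
  assumes "(P, \<theta>) \<in> proj_field_points R S F"
  shows "(\<lambda>g\<in>T 0. \<theta> (0, g, \<one>)) \<in> hom0"
proof -
  have P: "homogeneous_prime R S P" and th: "\<theta> \<in> residue_field_homs R S P F"
    using assms by (auto simp: proj_field_points_def proj_points_def)
  have one: "\<one> \<in> S 0 - P 0" using P T_one by (simp add: homogeneous_prime_def)
  note D = residue_field_homsD[OF th]
  have "\<theta> (0, g \<otimes> g', \<one>) = \<theta> (0, g, \<one>) \<otimes>\<^bsub>F\<^esub> \<theta> (0, g', \<one>)" if "g \<in> T 0" "g' \<in> T 0" for g g'
    using D(4)[of g 0 "\<one>" g' 0 "\<one>"] one that by simp
  moreover have "\<theta> (0, g, \<one>) \<in> carrier F" if "g \<in> T 0" for g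
    using D(1)[OF one] that by simp
  moreover have "\<theta> (0, g \<oplus> g', \<one>) = \<theta> (0, g, \<one>) \<oplus>\<^bsub>F\<^esub> \<theta> (0, g', \<one>)" if "g \<in> T 0" "g' \<in> T 0" for g g'
    using D(3)[OF _ _ one] that by simp
  moreover have "\<theta> (0, \<one>, \<one>) = \<one>\<^bsub>F\<^esub>" using D(2)[OF one] .
  moreover have "f \<otimes> g \<in> T 0" if "f \<in> T 0" "g \<in> T 0" for f g using T_mult[OF that] by simp
  ultimately show ?thesis using T_one T_add by (auto simp: hom0_def)
qed

lemma homogeneous_prime_pow:
  assumes P: "homogeneous_prime R S P" and f: "f \<in> S m - P m" 
  shows "f [^] k \<in> S (k * m) - P (k * m)"
proof (induction k)
  case 0 then show ?case using P T_one by (simp add: homogeneous_prime_def)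
next
  case (Suc k)
  have "f [^] k \<otimes> f \<notin> P (k * m + m)" using Suc P f unfolding homogeneous_prime_def by blast
  moreover have "f [^] k \<otimes> f \<in> S (k * m + m)" using T_mult[of _ "int (k * m)" f "int m"] Suc f by simp
  ultimately show ?case by (simp add: add.commute)
qed

lemma homogeneous_prime_pow_mem:
  assumes P: "homogeneous_prime R S P" and f: "f \<in> P m" and k: "k > 0"
  shows "f [^] k \<in> P (k * m)"
proof -
  obtain j where j: "k = Suc j" using k gr0_implies_Suc by blast
  have fS: "f \<in> S m" using f P by (auto simp: homogeneous_prime_def homogeneous_ideal_def)
  have "f [^] j \<in> S (j * m)" using T_pow[OF fS] by simp
  then have "f [^] j \<otimes> f \<in> P (j * m + m)"
    using P f by (auto simp: homogeneous_prime_def homogeneous_ideal_def)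
  then show ?thesis by (simp add: j algebra_simps)
qed

text \<open>The pair \<open>e\<close>, \<open>e'\<close> translates between degree 0 and multiples
  of its degree, and powers bring every degree to such a multiple. In degree 0, \<open>P\<close> is
  the kernel of \<open>\<psi>\<close>, so \<open>P\<close> is determined. Then
  \<open>\<theta>\<close> is forced, since a fraction keeps its value when both terms are multiplied
  by an element of opposite degree.\<close>

lemma proj_field_point_determined:
  assumes x: "(P, \<theta>) \<in> proj_field_points R S F"
    and u: "unit_pair (\<lambda>g\<in>T 0. \<theta> (0, g, \<one>))"
  shows "P = prime_of (\<lambda>g\<in>T 0. \<theta> (0, g, \<one>))" "\<theta> = res_of (\<lambda>g\<in>T 0. \<theta> (0, g, \<one>))"
proof -
  define \<psi> where "\<psi> = (\<lambda>g\<in>T 0. \<theta> (0, g, \<one>))"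
  have \<psi>: "\<psi> \<in> hom0" using proj_field_point_hom0[OF x] by (simp add: \<psi>_def)
  have P: "homogeneous_prime R S P" and th: "\<theta> \<in> residue_field_homs R S P F" and "\<exists>m>0. P m \<noteq> S m"
    using x by (auto simp: proj_field_points_def proj_points_def)
  have PS: "P m \<subseteq> S m" for m using P by (auto simp: homogeneous_prime_def homogeneous_ideal_def)
  have Pmult: "f \<in> S l \<Longrightarrow> g \<in> P m \<Longrightarrow> f \<otimes> g \<in> P (l + m)" for f g l m
    using P by (auto simp: homogeneous_prime_def homogeneous_ideal_def)
  have Pprime: "f \<in> S l \<Longrightarrow> g \<in> S m \<Longrightarrow> f \<otimes> g \<in> P (l + m) \<Longrightarrow> f \<in> P l \<or> g \<in> P m" for f g l m
    using P by (auto simp: homogeneous_prime_def)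
  have one: "\<one> \<in> S 0 - P 0" using P T_one by (simp add: homogeneous_prime_def)
  note th_mult = residue_field_homsD(4)[OF th] and th_one = residue_field_homsD(2)[OF th]
    and th_car = residue_field_homsD(1)[OF th]
  \<comment> \<open>A homomorphism from a field is injective: if \<open>g\<close> is not in
    \<open>P 0\<close>, the fraction \<open>\<one> / g\<close> is an inverse of
    \<open>g / \<one>\<close>.\<close>
  have ker: "\<psi> g = \<zero>\<^bsub>F\<^esub> \<longleftrightarrow> g \<in> P 0" if g: "g \<in> T 0" for g
  proof
    assume "g \<in> P 0" then show "\<psi> g = \<zero>\<^bsub>F\<^esub>" using residue_field_homsD(5)[OF th _ one] g by (simp add: \<psi>_def)
  next
    assume 0: "\<psi> g = \<zero>\<^bsub>F\<^esub>"
    show "g \<in> P 0"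
    proof (rule ccontr)
      assume n: "g \<notin> P 0"
      have "\<theta> (0 + 0, g \<otimes> \<one>, \<one> \<otimes> g) = \<theta> (0, g, \<one>) \<otimes>\<^bsub>F\<^esub> \<theta> (0, \<one>, g)"
        using n g one by (intro th_mult) auto
      then have "\<theta> (0, g, g) = \<zero>\<^bsub>F\<^esub>" using 0 g n T_carrier th_car[of g 0 "\<one>"] one by (simp add: \<psi>_def)
      then show False using th_one[of g 0] n g by simp
    qed
  qed
  obtain D e e' where D: "D > 0" and e: "e \<in> T D" and e': "e' \<in> T (- D)" and ee: "\<psi> (e \<otimes> e') \<noteq> \<zero>\<^bsub>F\<^esub>"
    using u by (auto simp: unit_pair_def \<psi>_def)
  define d where "d = nat D"
  have d: "d > 0" "D = int d" using D by (auto simp: d_def)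
  have eeP: "e \<otimes> e' \<in> S 0 - P 0" using ker ee T_mult0[OF e e'] by simp
  have car: "e \<in> carrier R" "e' \<in> carrier R" using T_carrier e e' by auto
  have fd: "f [^] d \<otimes> e' [^] m \<in> S 0" if "f \<in> S m" for f m
  proof -
    have "f [^] d \<in> T (int d * int m)" using T_pow[OF that] .
    moreover have "e' [^] m \<in> T (- (int d * int m))" using T_pow[OF e', of m] d by (simp add: algebra_simps)
    ultimately show ?thesis using T_mult0 by auto
  qed
  have em: "e [^] m \<in> S (m * d)" for m using T_pow[OF e, of m] d by simp
  have fd': "(f [^] d \<otimes> e' [^] m) \<otimes> e [^] m \<notin> P (m * d)" if "f \<in> S m - P m" for f m
  proof
    assume "(f [^] d \<otimes> e' [^] m) \<otimes> e [^] m \<in> P (m * d)"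
    moreover have "(f [^] d \<otimes> e' [^] m) \<otimes> e [^] m = f [^] d \<otimes> (e \<otimes> e') [^] m"
      using car T_carrier[of f "int m"] that by (simp add: R.nat_pow_distrib R.m_ac)
    ultimately have "f [^] d \<otimes> (e \<otimes> e') [^] m \<in> P (d * m + m * 0)" by (simp add: mult.commute)
    then show False
      using Pprime[of _ "d * m" _ "m * 0"] homogeneous_prime_pow[OF P that, of d] homogeneous_prime_pow[OF P eeP, of m] by blast
  qed
  obtain m0 f0 where "m0 > 0" "f0 \<in> S m0 - P m0" using \<open>\<exists>m>0. P m \<noteq> S m\<close> PS by blast
  \<comment> \<open>If \<open>e\<close> were in \<open>P\<close>, so would be
    \<open>e [^] m0\<close> and its multiple
    \<open>f0 [^] d \<otimes> (e \<otimes> e') [^] m0\<close>, a product of elements outside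
    \<open>P\<close>. The element \<open>f0\<close> of positive degree exists because
    \<open>P\<close> does not contain the irrelevant ideal.\<close>
  have eP: "e \<in> S d - P d"
  proof (rule ccontr)
    assume "e \<notin> S d - P d"
    then have "e [^] m0 \<in> P (m0 * d)" using homogeneous_prime_pow_mem[OF P _ \<open>m0 > 0\<close>] e d by simp
    then show False using fd'[OF \<open>f0 \<in> _\<close>] Pmult[OF fd] \<open>f0 \<in> _\<close> by fastforce
  qed
  have Peq: "f \<in> P m \<longleftrightarrow> f \<in> prime_of \<psi> m" if fS: "f \<in> S m" for f m
  proof
    assume f: "f \<in> P m"
    \<comment> \<open>\<open>P\<close> has no pieces in negative degrees, so \<open>h\<close> cannot
      be used as a multiplier. But \<open>h [^] d \<otimes> e [^] m\<close> has degree 0, which puts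
      \<open>(f \<otimes> h) [^] d \<otimes> e [^] m\<close> into \<open>P\<close>; as
      \<open>e\<close> is outside, primality leads back to \<open>f \<otimes> h\<close>.\<close>
    have "\<psi> (f \<otimes> h) = \<zero>\<^bsub>F\<^esub>" if h: "h \<in> T (- int m)" for h
    proof -
      have fh: "f \<otimes> h \<in> T 0" using T_mult0 fS h by simp
      have "h [^] d \<otimes> e [^] m \<in> S 0"
        using T_mult[OF T_pow[OF h, of d] em[of m]] by (simp add: mult.commute)
      then have "(h [^] d \<otimes> e [^] m) \<otimes> f [^] d \<in> P (0 + d * m)"
        using Pmult homogeneous_prime_pow_mem[OF P f d(1)] by blast
      moreover have "(h [^] d \<otimes> e [^] m) \<otimes> f [^] d = (f \<otimes> h) [^] d \<otimes> e [^] m"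
        using car T_carrier[OF h] T_carrier[OF fS] by (simp add: R.nat_pow_distrib R.m_ac)
      ultimately have "(f \<otimes> h) [^] d \<otimes> e [^] m \<in> P (d * 0 + m * d)" by (simp add: mult.commute)
      then have "(f \<otimes> h) [^] d \<in> P (d * 0)"
        using Pprime[of "(f \<otimes> h) [^] d" "d * 0"] T_pow[OF fh, of d] em homogeneous_prime_pow[OF P eP, of m] by fastforce
      then have "f \<otimes> h \<in> P 0" using homogeneous_prime_pow[OF P, of "f \<otimes> h" 0 d] fh by fastforce
      then show ?thesis using ker fh by blast
    qed
    then show "f \<in> prime_of \<psi> m" using fS by (simp add: prime_of_def)
  next
    assume f: "f \<in> prime_of \<psi> m"
    show "f \<in> P m"
    proof (rule ccontr)
      assume n: "f \<notin> P m"
      have "(f [^] d \<otimes> e' [^] m) \<notin> P 0"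
      proof
        assume "(f [^] d \<otimes> e' [^] m) \<in> P 0"
        from Pmult[OF em this, of m] have "(f [^] d \<otimes> e' [^] m) \<otimes> e [^] m \<in> P (m * d)"
          using car T_carrier[OF fS] by (simp add: R.m_ac)
        then show False using fd' n fS by blast
      qed
      then have nz: "\<psi> (f [^] d \<otimes> e' [^] m) \<noteq> \<zero>\<^bsub>F\<^esub>" using ker fd[OF fS] by simp
      \<comment> \<open>Splitting off one factor \<open>f\<close> leaves an element of degree
        \<open>(d - 1) m - d m = - m\<close>, a legitimate test element for
        \<open>prime_of\<close>.\<close>
      obtain j where j: "d = Suc j" using d gr0_implies_Suc by blast
      have "f [^] j \<otimes> e' [^] m \<in> T (int j * int m + int m * - D)"
        using T_mult[OF T_pow[OF fS] T_pow[OF e']] by simp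
      then have h: "f [^] j \<otimes> e' [^] m \<in> T (- int m)" using d j by (simp add: algebra_simps)
      have "f \<otimes> (f [^] j \<otimes> e' [^] m) = f [^] d \<otimes> e' [^] m"
        using car T_carrier[OF fS] by (simp add: j R.m_ac)
      then show False using f h nz by (auto simp: prime_of_def)
    qed
  qed
  have PP: "P = prime_of \<psi>"
    using Peq PS by (fastforce simp: prime_of_def)
  then show "P = prime_of (\<lambda>g\<in>T 0. \<theta> (0, g, \<one>))" by (simp add: \<psi>_def)
  have "\<theta> y = res_of \<psi> y" for y
  proof (cases "y \<in> fractions_at S P")
    case False
    then have "\<theta> y = undefined" using residue_field_homsD(6)[OF th] by (rule extensional_arb[rotated])
    then show ?thesis using False by (simp add: res_of_def flip: PP)
  next
    case True
    then obtain m g f where y: "y = (m, g, f)" and g: "g \<in> S m" and f: "f \<in> S m - P m"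
      by (auto simp: fractions_at_def)
    have f': "f \<in> S m - prime_of \<psi> m" using f PP by simp
    note h = denom[OF f']
    define h where "h = denom \<psi> m f"
    have h: "h \<in> T (- int m)" "\<psi> (f \<otimes> h) \<noteq> \<zero>\<^bsub>F\<^esub>" using h by (auto simp: h_def)
    have T0: "f \<otimes> h \<in> T 0" "g \<otimes> h \<in> T 0" using T_mult0 f g h by auto
    note c = T_carrier[OF g] T_carrier[of f m] T_carrier[OF h(1)]
    have "\<theta> (m, g, f) \<otimes>\<^bsub>F\<^esub> \<psi> (f \<otimes> h) = \<theta> (m + 0, g \<otimes> (f \<otimes> h), f \<otimes> \<one>)"
      using th_mult[of g m f "f \<otimes> h" 0 "\<one>"] g f one T0 by (simp add: \<psi>_def)
    also have "\<dots> = \<theta> (0 + m, (g \<otimes> h) \<otimes> f, \<one> \<otimes> f)"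
      using c f by (simp add: R.m_ac)
    also have "\<dots> = \<psi> (g \<otimes> h)"
      using th_mult[of "g \<otimes> h" 0 "\<one>" f m f] f one T0 th_one[OF f] hom0D(1)[OF \<psi> T0(2)] by (simp add: \<psi>_def)
    finally have "\<psi> (g \<otimes> h) \<otimes>\<^bsub>F\<^esub> inv\<^bsub>F\<^esub> \<psi> (f \<otimes> h) = \<theta> (m, g, f)"
      using F_eq_div hom0D(1)[OF \<psi>] T0 h(2) th_car[OF f g] by simp
    then show ?thesis using res_of_eq[OF \<psi> g _ h] f y by simp
  qed
  then have "\<theta> = res_of \<psi>" by (rule ext)
  then show "\<theta> = res_of (\<lambda>g\<in>T 0. \<theta> (0, g, \<one>))" unfolding \<psi>_def .
qed

theorem proj_field_points_bij:
  assumes u: "\<And>\<psi>. \<psi> \<in> hom0 \<Longrightarrow> unit_pair \<psi>"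
  shows "bij_betw (\<lambda>(P, \<theta>). \<lambda>g\<in>T 0. \<theta> (0, g, \<one>)) (proj_field_points R S F) hom0"
proof (rule bij_betwI[where g = "\<lambda>\<psi>. (prime_of \<psi>, res_of \<psi>)"])
  show "(\<lambda>(P, \<theta>). \<lambda>g\<in>T 0. \<theta> (0, g, \<one>)) \<in> proj_field_points R S F \<rightarrow> hom0"
    using proj_field_point_hom0 by auto
next
  show "(\<lambda>\<psi>. (prime_of \<psi>, res_of \<psi>)) \<in> hom0 \<rightarrow> proj_field_points R S F"
  proof
    fix \<psi> assume \<psi>: "\<psi> \<in> hom0"
    obtain D e e' where D: "D > 0" and e: "e \<in> T D" and e': "e' \<in> T (- D)" and ee: "\<psi> (e \<otimes> e') \<noteq> \<zero>\<^bsub>F\<^esub>"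
      using u[OF \<psi>] by (auto simp: unit_pair_def)
    \<comment> \<open>The member of positive degree lies outside the prime, which therefore does not
      contain the irrelevant ideal.\<close>
    have "e \<in> S (nat D)" "e \<notin> prime_of \<psi> (nat D)" using D e e' ee by (auto simp: prime_of_def)
    then have "\<exists>m>0. prime_of \<psi> m \<noteq> S m" using D by (intro exI[of _ "nat D"]) auto
    then show "(prime_of \<psi>, res_of \<psi>) \<in> proj_field_points R S F"
      using prime_of_homogeneous_prime[OF \<psi>] res_of_residue_field_homs[OF \<psi>]
      by (auto simp: proj_field_points_def proj_points_def)
  qed
next
  fix x assume "x \<in> proj_field_points R S F"
  then show "(\<lambda>\<psi>. (prime_of \<psi>, res_of \<psi>)) ((\<lambda>(P, \<theta>). \<lambda>g\<in>T 0. \<theta> (0, g, \<one>)) x) = x"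
    using proj_field_point_determined u proj_field_point_hom0 by (cases x) fastforce
next
  fix \<psi> assume "\<psi> \<in> hom0"
  then show "(\<lambda>(P, \<theta>). \<lambda>g\<in>T 0. \<theta> (0, g, \<one>)) (prime_of \<psi>, res_of \<psi>) = \<psi>"
    using res_of_degree_0 hom0D(5) by (auto intro!: extensionalityI[of _ "T 0"])
qed

end

section \<open>The coordinate ring of the fibre\<close>

lemma univ_ring_simps [simp]:
  "carrier univ_ring = UNIV" "x \<otimes>\<^bsub>univ_ring\<^esub> y = x * y" "x \<oplus>\<^bsub>univ_ring\<^esub> y = x + y"
  "\<one>\<^bsub>univ_ring\<^esub> = 1" "\<zero>\<^bsub>univ_ring\<^esub> = 0"
  by (simp_all add: univ_ring_def)

lemma cring_univ_ring: "cring (univ_ring :: 'a::comm_ring_1 ring)"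
proof (rule cringI)
  show "abelian_group (univ_ring :: 'a ring)"
    by (rule abelian_groupI) (auto simp: algebra_simps intro: exI[of _ "- x" for x])
  show "comm_monoid (univ_ring :: 'a ring)"
    by (rule comm_monoidI) (auto simp: algebra_simps)
qed (auto simp: algebra_simps)

lemma univ_ring_uminus [simp]: "\<ominus>\<^bsub>univ_ring\<^esub> x = (- x :: 'a::comm_ring_1)"
proof -
  interpret cring "univ_ring :: 'a ring" by (rule cring_univ_ring)
  show ?thesis by (rule minus_equality) auto
qed

lemma univ_ring_minus [simp]: "x \<ominus>\<^bsub>univ_ring\<^esub> y = (x - y :: 'a::comm_ring_1)"
  by (simp add: a_minus_def)

lemma ideal_fibre_ideal: "ideal (fibre_ideal a lam) univ_ring"
  unfolding fibre_ideal_def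
  by (rule ring.genideal_ideal[OF cring.axioms(1)[OF cring_univ_ring]]) simp

lemma cring_fibre_ring: "cring (fibre_ring a lam)"
  unfolding fibre_ring_def by (rule ideal.quotient_is_cring[OF ideal_fibre_ideal cring_univ_ring])

definition fibre_class ::
  "('n::finite \<Rightarrow> int ^ 'd) \<Rightarrow> (int ^ 'n \<Rightarrow> int) \<Rightarrow> 'n cot_poly \<Rightarrow> 'n cot_poly set" where
  "fibre_class a lam f = fibre_ideal a lam +>\<^bsub>univ_ring\<^esub> f"

lemma fibre_class_hom: "fibre_class a lam \<in> ring_hom univ_ring (fibre_ring a lam)"
  using ideal.rcos_ring_hom[OF ideal_fibre_ideal[of a lam]]
  by (simp add: fibre_class_def[abs_def] fibre_ring_def)

lemma fibre_class_simps:
  "fibre_class a lam f \<in> carrier (fibre_ring a lam)"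
  "fibre_class a lam (f + g) = fibre_class a lam f \<oplus>\<^bsub>fibre_ring a lam\<^esub> fibre_class a lam g"
  "fibre_class a lam (f * g) = fibre_class a lam f \<otimes>\<^bsub>fibre_ring a lam\<^esub> fibre_class a lam g"
  "fibre_class a lam 1 = \<one>\<^bsub>fibre_ring a lam\<^esub>"
  using ring_hom_closed[OF fibre_class_hom, of f a lam] ring_hom_add[OF fibre_class_hom, of f g a lam]
    ring_hom_mult[OF fibre_class_hom, of f g a lam] ring_hom_one[OF fibre_class_hom, of a lam]
  by simp_all

lemma fibre_class_eq_iff: "fibre_class a lam f = fibre_class a lam g \<longleftrightarrow> f - g \<in> fibre_ideal a lam"
  unfolding fibre_class_def
  using ring.quotient_eq_iff_same_a_r_cos[OF cring.axioms(1)[OF cring_univ_ring] ideal_fibre_ideal, of f g a lam]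
  by simp

lemma fibre_class_zero: "fibre_class a lam 0 = \<zero>\<^bsub>fibre_ring a lam\<^esub>"
proof -
  interpret Q: cring "fibre_ring a lam" by (rule cring_fibre_ring)
  show ?thesis using fibre_class_simps(2)[of a lam 0 0] fibre_class_simps(1)[of a lam 0] by simp
qed

lemma fibre_class_uminus: "fibre_class a lam (- f) = \<ominus>\<^bsub>fibre_ring a lam\<^esub> fibre_class a lam f"
proof -
  interpret Q: cring "fibre_ring a lam" by (rule cring_fibre_ring)
  show ?thesis
    using fibre_class_simps(2)[of a lam "- f" f] fibre_class_zero[of a lam]
    by (intro Q.minus_equality[symmetric]) (auto simp: fibre_class_simps(1))
qed

lemma weight_space_closed:
  "0 \<in> weight_space a x" "f \<in> weight_space a x \<Longrightarrow> g \<in> weight_space a x \<Longrightarrow> f + g \<in> weight_space a x"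
  "f \<in> weight_space a x \<Longrightarrow> - f \<in> weight_space a x" "1 \<in> weight_space a 0"
  using int_subgroup_0[OF int_subgroup_trivial_characters, of a] Poly_Mapping.keys_add[of f g]
  by (auto simp: weight_space_def)

lemma weight_space_mult:
  assumes f: "f \<in> weight_space a x" and g: "g \<in> weight_space a y"
  shows "f * g \<in> weight_space a (x + y)"
  unfolding weight_space_def
proof (intro CollectI ballI)
  fix e assume "e \<in> Poly_Mapping.keys (f * g)"
  then obtain e1 e2 where e: "e = e1 + e2" "e1 \<in> Poly_Mapping.keys f" "e2 \<in> Poly_Mapping.keys g"
    using keys_mult[of f g] by blast
  have "(weight e1 - x) + (weight e2 - y) \<in> trivial_characters a"
    using f g e by (intro int_subgroup_add[OF int_subgroup_trivial_characters]) (auto simp: weight_space_def)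
  then show "weight e - (x + y) \<in> trivial_characters a" by (simp add: e algebra_simps)
qed

lemma weight_space_single:
  "frag_of e \<in> weight_space a x \<longleftrightarrow> weight e - x \<in> trivial_characters a"
  by (simp add: weight_space_def)

lemma weight_space_0_iff: "f \<in> weight_space a 0 \<longleftrightarrow> Poly_Mapping.keys f \<subseteq> invariant_exps a"
  by (auto simp: weight_space_def invariant_exps_def)

text \<open>Continues the semi-invariants to negative multiples of the character, as
  \<open>int_graded\<close> requires.\<close>

definition graded_piece ::
  "('n::finite \<Rightarrow> int ^ 'd::finite) \<Rightarrow> (int ^ 'n \<Rightarrow> int) \<Rightarrow> int ^ 'n \<Rightarrow> int \<Rightarrow> 'n cot_poly set set" where
  "graded_piece a lam r m = fibre_class a lam ` weight_space a (m *s r)"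

lemma semi_invariants_eq: "semi_invariants a lam r m = graded_piece a lam r (int m)"
  by (simp add: semi_invariants_def graded_piece_def fibre_class_def)

lemma int_graded_fibre_ring:
  fixes F (structure)
  assumes "field F"
  shows "int_graded (fibre_ring a lam) F (graded_piece a lam r)"
proof -
  interpret Q: cring "fibre_ring a lam" by (rule cring_fibre_ring)
  interpret F: field F by fact
  show ?thesis
  proof (rule int_graded.intro[OF Q.is_cring F.field_axioms int_graded_axioms.intro])
    fix m
    have "subgroup (graded_piece a lam r m) (add_monoid (fibre_ring a lam))"
    proof (rule Q.add.subgroupI)
      show "graded_piece a lam r m \<subseteq> carrier (fibre_ring a lam)"
        using fibre_class_simps(1) by (auto simp: graded_piece_def)
      show "graded_piece a lam r m \<noteq> {}" using weight_space_closed(1) by (auto simp: graded_piece_def)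
    next
      fix f assume "f \<in> graded_piece a lam r m"
      then show "\<ominus>\<^bsub>fibre_ring a lam\<^esub> f \<in> graded_piece a lam r m"
        using weight_space_closed(3)[of _ a "m *s r"] by (auto simp: graded_piece_def simp flip: fibre_class_uminus)
    next
      fix f g assume "f \<in> graded_piece a lam r m" "g \<in> graded_piece a lam r m"
      then show "f \<oplus>\<^bsub>fibre_ring a lam\<^esub> g \<in> graded_piece a lam r m"
        using weight_space_closed(2)[of _ a "m *s r"] by (auto simp: graded_piece_def simp flip: fibre_class_simps(2))
    qed
    then show "additive_subgroup (graded_piece a lam r m) (fibre_ring a lam)" by (rule additive_subgroup.intro)
  next
    fix l m f g assume "f \<in> graded_piece a lam r l" "g \<in> graded_piece a lam r m"
    then obtain f' g' where f: "f = fibre_class a lam f'" "f' \<in> weight_space a (l *s r)"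
      and g: "g = fibre_class a lam g'" "g' \<in> weight_space a (m *s r)" by (auto simp: graded_piece_def)
    have "l *s r + m *s r = (l + m) *s r" by (simp add: vec_eq_iff algebra_simps)
    then have "f' * g' \<in> weight_space a ((l + m) *s r)" using weight_space_mult[OF f(2) g(2)] by simp
    then show "f \<otimes>\<^bsub>fibre_ring a lam\<^esub> g \<in> graded_piece a lam r (l + m)"
      by (auto simp: f g graded_piece_def simp flip: fibre_class_simps(3))
  next
    have "0 *s r = 0" by (simp add: vec_eq_iff)
    then show "\<one>\<^bsub>fibre_ring a lam\<^esub> \<in> graded_piece a lam r 0"
      using weight_space_closed(4) by (auto simp: graded_piece_def simp flip: fibre_class_simps(4))
  qed
qed

lemma graded_piece_0: "graded_piece a lam r 0 = fibre_class a lam ` weight_space a 0"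
proof -
  have "0 *s r = 0" by (simp add: vec_eq_iff)
  then show ?thesis by (simp add: graded_piece_def)
qed

lemma moment_coord: "moment (\<lambda>i. coord (Inl i)) (\<lambda>i. coord (Inr i)) x = (\<Sum>i\<in>UNIV. of_int (x $ i) * frag_of (cross i))"
  by (simp add: moment_def coord_def cross_def mult_single mult.assoc)

lemma moment_coord_add:
  "moment (\<lambda>i. coord (Inl i)) (\<lambda>i. coord (Inr i)) (x + y) =
    moment (\<lambda>i. coord (Inl i)) (\<lambda>i. coord (Inr i)) x + (moment (\<lambda>i. coord (Inl i)) (\<lambda>i. coord (Inr i)) y :: 'n::finite cot_poly)"
  by (simp add: moment_coord algebra_simps sum.distrib)

lemma moment_coord_axis:
  "moment (\<lambda>i. coord (Inl i)) (\<lambda>i. coord (Inr i)) (axis j 1) = (frag_of (cross j) :: 'n::finite cot_poly)"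
proof -
  have "(\<Sum>i\<in>UNIV. of_int (axis j 1 $ i) * frag_of (cross i)) = (\<Sum>i\<in>UNIV. if i = j then frag_of (cross j) else (0 :: 'n cot_poly))"
    by (intro sum.cong) (auto simp: axis_def)
  then show ?thesis by (simp add: moment_coord)
qed

lemma of_int_weight_space: "of_int k \<in> weight_space a 0"
proof -
  have "Poly_Mapping.keys (of_int k :: 'a cot_poly) \<subseteq> {0}" by (auto simp: in_keys_iff lookup_of_int)
  then show ?thesis using int_subgroup_exps(2) by (auto simp: weight_space_0_iff)
qed

lemma moment_weight_space: "moment (\<lambda>i. coord (Inl i)) (\<lambda>i. coord (Inr i)) x \<in> weight_space a 0"
proof -
  have "of_int (x $ i) * frag_of (cross i) \<in> weight_space a 0" for i
    using weight_space_mult[OF of_int_weight_space, of "frag_of (cross i)" a 0 "x $ i"]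
      int_subgroup_0[OF int_subgroup_trivial_characters, of a] by (simp add: weight_space_single)
  then have "(\<Sum>i\<in>I. of_int (x $ i) * frag_of (cross i)) \<in> weight_space a 0" for I
    by (induction I rule: infinite_finite_induct) (auto simp: weight_space_closed)
  then show ?thesis by (simp add: moment_coord)
qed

context field
begin

text \<open>
  The linear extension of an exponent homomorphism by 0 outside the invariant exponents. It is linear
  over the invariant polynomials, so it kills the ideal of the fibre as soon as it kills its
  generators, which are invariant.
\<close>

lemma ex_lin_ext:
  "\<exists>h :: 'n::finite cot_poly \<Rightarrow> 'a. (\<forall>f. h f \<in> carrier R) \<and> (\<forall>f g. h (f + g) = h f \<oplus> h g) \<and>
     (\<forall>e. h (frag_of e) = (if e \<in> invariant_exps a then \<phi> e else \<zero>))"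
  if \<phi>: "\<phi> \<in> exp_homs (a :: 'n \<Rightarrow> int ^ 'd::finite)"
proof -
  let ?f = "\<lambda>e. if e \<in> invariant_exps a then \<phi> e else \<zero>"
  have "?f ` UNIV \<subseteq> carrier (add_monoid R)" using exp_homsD(1)[OF \<phi>] by auto
  then obtain h where h: "h \<in> hom (free_Abelian_group UNIV) (add_monoid R)" "\<And>e. h (frag_of e) = ?f e"
    by (rule comm_group.free_Abelian_group_universal[OF a_comm_group]) blast
  then show ?thesis by (intro exI[of _ h]) (auto simp: hom_def Pi_def)
qed

definition lin_ext :: "('n::finite \<Rightarrow> int ^ 'd::finite) \<Rightarrow> (('n + 'n \<Rightarrow>\<^sub>0 nat) \<Rightarrow> 'a) \<Rightarrow> 'n cot_poly \<Rightarrow> 'a" where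
  "lin_ext a \<phi> = (SOME h. (\<forall>f. h f \<in> carrier R) \<and> (\<forall>f g. h (f + g) = h f \<oplus> h g) \<and>
     (\<forall>e. h (frag_of e) = (if e \<in> invariant_exps a then \<phi> e else \<zero>)))"

lemma lin_ext:
  assumes "\<phi> \<in> exp_homs a"
  shows "lin_ext a \<phi> f \<in> carrier R" "lin_ext a \<phi> (f + g) = lin_ext a \<phi> f \<oplus> lin_ext a \<phi> g"
    "lin_ext a \<phi> (frag_of e) = (if e \<in> invariant_exps a then \<phi> e else \<zero>)"
  using someI_ex[OF ex_lin_ext[OF assms]] unfolding lin_ext_def by blast+

lemma additive_zero:
  fixes h :: "'x::ab_group_add \<Rightarrow> 'a"
  assumes "\<And>f. h f \<in> carrier R" "\<And>f g. h (f + g) = h f \<oplus> h g"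
  shows "h 0 = \<zero>"
  using assms(2)[of 0 0] assms(1)[of 0] by (metis add.l_cancel_one add_0)

lemma additive_diff:
  fixes h :: "'x::ab_group_add \<Rightarrow> 'a"
  assumes "\<And>f. h f \<in> carrier R" "\<And>f g. h (f + g) = h f \<oplus> h g"
  shows "h (f - g) = h f \<ominus> h g"
  using assms(2)[of "f - g" g] assms(1) by (simp add: a_minus_def a_assoc r_neg)

text \<open>\<open>lin_ext\<close> is evaluation after projection to the invariant part, so only one
  factor has to be invariant: multiplication by an invariant monomial preserves both invariance and
  its failure. Additivity in each factor reduces the claim to monomials.\<close>

lemma lin_ext_mult:
  assumes \<phi>: "\<phi> \<in> exp_homs a" and f: "f \<in> weight_space a 0"
  shows "lin_ext a \<phi> (f * g) = lin_ext a \<phi> f \<otimes> lin_ext a \<phi> g"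
proof -
  note L = lin_ext[OF \<phi>] and L0 = additive_zero[of "lin_ext a \<phi>", OF lin_ext(1,2)[OF \<phi>]]
    and Ld = additive_diff[of "lin_ext a \<phi>", OF lin_ext(1,2)[OF \<phi>]]
  have mono: "lin_ext a \<phi> (frag_of e * frag_of e') = lin_ext a \<phi> (frag_of e) \<otimes> lin_ext a \<phi> (frag_of e')"
    if e: "e \<in> invariant_exps a" for e e'
  proof -
    have "e + e' \<in> invariant_exps a \<longleftrightarrow> e' \<in> invariant_exps a"
    proof
      assume "e + e' \<in> invariant_exps a"
      then have "(weight e + weight e') - weight e \<in> trivial_characters a"
        using e by (intro int_subgroup_diff[OF int_subgroup_trivial_characters]) (auto simp: invariant_exps_def)
      then show "e' \<in> invariant_exps a" by (simp add: invariant_exps_def)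
    qed (use int_subgroup_exps(1) e in blast)
    then show ?thesis using e exp_homsD(4)[OF \<phi> e] exp_homsD(1)[OF \<phi> e] by (simp add: mult_single L(3))
  qed
  have 1: "lin_ext a \<phi> (frag_of e * g) = lin_ext a \<phi> (frag_of e) \<otimes> lin_ext a \<phi> g" if e: "e \<in> invariant_exps a" for e g
  proof -
    have "Poly_Mapping.keys g \<subseteq> UNIV" by simp
    then show ?thesis
    proof (induction g rule: frag_induction)
      case zero show ?case using L(1) by (simp add: L0)
    next
      case (one e') show ?case by (rule mono[OF e])
    next
      case (diff f g) then show ?case using L(1) by (simp add: right_diff_distrib Ld a_minus_def r_distr r_minus)
    qed
  qed
  have "Poly_Mapping.keys f \<subseteq> invariant_exps a" using f by (simp add: weight_space_0_iff)
  then show ?thesis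
  proof (induction f rule: frag_induction)
    case zero show ?case using L(1) by (simp add: L0)
  next
    case (one e) then show ?case by (rule 1)
  next
    case (diff f h) then show ?case using L(1) by (simp add: left_diff_distrib Ld a_minus_def l_distr l_minus)
  qed
qed

lemma additive_of_int:
  fixes h :: "'x::ring_1 \<Rightarrow> 'a"
  assumes h: "\<And>f. h f \<in> carrier R" "\<And>f g. h (f + g) = h f \<oplus> h g" "h 1 = \<one>"
  shows "h (of_int k) = zmul k \<one>"
proof -
  have n: "h (of_int (int m)) = zmul (int m) \<one>" for m
  proof (induction m)
    case 0 show ?case using additive_zero[of h] h by simp
  next
    case (Suc m)
    have "h (of_int (int (Suc m))) = h (of_int (int m)) \<oplus> h 1" using h(2)[of "of_int (int m)" 1] by (simp add: add.commute)
    moreover have "zmul (int (Suc m)) \<one> = zmul (int m) \<one> \<oplus> \<one>"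
      using zmul_add[of \<one> "int m" 1] by (simp add: add.commute)
    ultimately show ?case using Suc h(3) by simp
  qed
  show ?thesis
  proof (cases "k \<ge> 0")
    case True then show ?thesis using n[of "nat k"] by simp
  next
    case False
    define m where "m = nat (- k)"
    have k: "k = - int m" using False by (simp add: m_def)
    have "h (of_int k) = h (0 - of_int (int m))" by (simp add: k)
    also have "\<dots> = h 0 \<ominus> h (of_int (int m))" using additive_diff[of h] h by blast
    finally have "h (of_int k) = \<zero> \<ominus> zmul (int m) \<one>" using n additive_zero[of h] h by simp
    then show ?thesis by (simp add: k zmul_neg a_minus_def)
  qed
qed

lemma lin_ext_one: "\<phi> \<in> exp_homs a \<Longrightarrow> lin_ext a \<phi> 1 = \<one>"
  using lin_ext(3)[of \<phi> a 0] exp_homsD(3)[of \<phi> a] int_subgroup_exps(2)[of a] by simp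

lemma lin_ext_moment:
  fixes x :: "int ^ 'n::finite"
  assumes \<phi>: "\<phi> \<in> exp_homs a"
  shows "lin_ext a \<phi> (moment (\<lambda>i. coord (Inl i)) (\<lambda>i. coord (Inr i)) x) = pairing x (\<lambda>i. \<phi> (cross i))"
  using additive_eq_pairing[of "\<lambda>x. lin_ext a \<phi> (moment (\<lambda>i. coord (Inl i)) (\<lambda>i. coord (Inr i)) x)" x]
    lin_ext[OF \<phi>] by (simp add: moment_coord_add moment_coord_axis int_subgroup_exps(3))

lemma lin_ext_fibre_ideal:
  fixes a :: "'n::finite \<Rightarrow> int ^ 'd::finite"
  assumes \<phi>: "\<phi> \<in> exp_homs a" and lev: "(\<lambda>i. \<phi> (cross i)) \<in> level_set R a lam"
    and f: "f \<in> fibre_ideal a lam"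
  shows "lin_ext a \<phi> f = \<zero>"
proof -
  interpret U: cring "univ_ring :: 'n cot_poly ring" by (rule cring_univ_ring)
  note L = lin_ext[OF \<phi>] and L0 = additive_zero[of "lin_ext a \<phi>", OF lin_ext(1,2)[OF \<phi>]]
    and Ld = additive_diff[of "lin_ext a \<phi>", OF lin_ext(1,2)[OF \<phi>]]
  \<comment> \<open>The kernel of \<open>lin_ext\<close> need not be an ideal; \<open>?J\<close> is
    the largest ideal inside it, and it is enough to find the generators there.\<close>
  let ?J = "{f. \<forall>g. lin_ext a \<phi> (f * g) = \<zero>}"
  let ?g = "\<lambda>x. moment (\<lambda>i. coord (Inl i)) (\<lambda>i. coord (Inr i)) x - of_int (lam x) :: 'n cot_poly"
  have J: "ideal ?J univ_ring"
  proof (rule idealI)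
    show "subgroup ?J (add_monoid univ_ring)"
    proof (rule U.add.subgroupI)
      fix f assume f: "f \<in> ?J"
      have "lin_ext a \<phi> (- f * g) = \<zero>" for g
        using f Ld[of 0 "f * g"] L0 by (simp add: a_minus_def)
      then show "\<ominus>\<^bsub>univ_ring\<^esub> f \<in> ?J" by simp
    qed (auto simp: L0 L(2) distrib_right intro!: exI[of _ 0])
  qed (auto simp: mult.assoc mult.left_commute U.ring_axioms)
  have "?g ` kernel_lattice a \<subseteq> ?J"
  proof clarify
    fix x h assume x: "x \<in> kernel_lattice a"
    have "lin_ext a \<phi> (?g x) = pairing x (\<lambda>i. \<phi> (cross i)) \<ominus> zmul (lam x) \<one>"
      using lin_ext_moment[OF \<phi>] additive_of_int[of "lin_ext a \<phi>", OF L(1,2) lin_ext_one[OF \<phi>]] by (simp add: Ld)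
    also have "\<dots> = \<zero>" using lev x by (simp add: level_set_def)
    finally have "lin_ext a \<phi> (?g x) = \<zero>" .
    moreover have "?g x \<in> weight_space a 0"
    proof -
      have "- of_int (lam x) \<in> weight_space a 0" by (rule weight_space_closed(3)[OF of_int_weight_space])
      from weight_space_closed(2)[OF moment_weight_space this, of x] show ?thesis by simp
    qed
    ultimately show "lin_ext a \<phi> (?g x * h) = \<zero>" using lin_ext_mult[OF \<phi>] L(1) by simp
  qed
  then have "fibre_ideal a lam \<subseteq> ?J" unfolding fibre_ideal_def by (rule U.genideal_minimal[OF J])
  then have "lin_ext a \<phi> (f * 1) = \<zero>" using f by blast
  then show ?thesis by simp
qed

end

text \<open>Degree 0 consists of classes of invariant polynomials, so invariant monomials determine
  a homomorphism, and the generators of the fibre ideal impose the moment equations on the values at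
  \<open>cross i\<close>. That the ideal, taken in the full polynomial ring, imposes nothing further
  on invariants is \<open>lin_ext_fibre_ideal\<close>.\<close>

lemma hom0_bij_exp_homs:
  fixes F (structure) and a :: "'n::finite \<Rightarrow> int ^ 'd::finite"
  assumes F: "field F"
  shows "bij_betw (\<lambda>\<psi>. \<lambda>e\<in>invariant_exps a. \<psi> (fibre_class a lam (frag_of e)))
    (int_graded.hom0 (fibre_ring a lam) F (graded_piece a lam r))
    {\<phi> \<in> field.exp_homs F a. (\<lambda>i. \<phi> (cross i)) \<in> level_set F a lam}"
  (is "bij_betw ?b ?H ?E")
proof -
  interpret F: field F by fact
  interpret G: int_graded "fibre_ring a lam" F "graded_piece a lam r" by (rule int_graded_fibre_ring[OF F])
  let ?\<pi> = "fibre_class a lam"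
  have T0: "graded_piece a lam r 0 = ?\<pi> ` weight_space a 0" by (rule graded_piece_0)
  have hom0: "G.hom0 = {\<psi> \<in> (?\<pi> ` weight_space a 0) \<rightarrow>\<^sub>E carrier F. \<psi> (?\<pi> 1) = \<one> \<and>
     (\<forall>f\<in>weight_space a 0. \<forall>g\<in>weight_space a 0. \<psi> (?\<pi> (f + g)) = \<psi> (?\<pi> f) \<oplus> \<psi> (?\<pi> g) \<and> \<psi> (?\<pi> (f * g)) = \<psi> (?\<pi> f) \<otimes> \<psi> (?\<pi> g))}"
    unfolding G.hom0_def T0 by (simp add: fibre_class_simps)
  have inv: "frag_of e \<in> weight_space a 0 \<longleftrightarrow> e \<in> invariant_exps a" for e by (simp add: weight_space_0_iff)
  have psi_diff: "\<psi> (?\<pi> (f - g)) = \<psi> (?\<pi> f) \<ominus> \<psi> (?\<pi> g)"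
    if \<psi>: "\<psi> \<in> G.hom0" and f: "f \<in> weight_space a 0" and g: "g \<in> weight_space a 0" for \<psi> f g
  proof -
    have fg: "f - g \<in> weight_space a 0" using weight_space_closed(2)[OF f weight_space_closed(3)[OF g]] by simp
    then have "\<psi> (?\<pi> ((f - g) + g)) = \<psi> (?\<pi> (f - g)) \<oplus> \<psi> (?\<pi> g)" using \<psi> g unfolding hom0 by blast
    moreover have "\<psi> (?\<pi> (f - g)) \<in> carrier F" "\<psi> (?\<pi> g) \<in> carrier F"
      using \<psi> fg g unfolding hom0 by (blast dest: PiE_mem)+
    ultimately show ?thesis by (simp add: a_minus_def F.a_assoc F.r_neg)
  qed
  have psi_car: "\<psi> (?\<pi> f) \<in> carrier F" if "\<psi> \<in> G.hom0" "f \<in> weight_space a 0" for \<psi> f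
    using that unfolding hom0 by (blast dest: PiE_mem)
  show ?thesis
  proof (rule bij_betw_imageI)
    show "inj_on ?b ?H"
    proof (rule inj_onI)
      fix \<psi> \<psi>' assume \<psi>: "\<psi> \<in> ?H" and \<psi>': "\<psi>' \<in> ?H" and eq: "?b \<psi> = ?b \<psi>'"
      have same: "\<psi> (?\<pi> f) = \<psi>' (?\<pi> f)" if "f \<in> weight_space a 0" for f
      proof -
        have "Poly_Mapping.keys f \<subseteq> invariant_exps a" using that by (simp add: weight_space_0_iff)
        then have "f \<in> weight_space a 0 \<and> \<psi> (?\<pi> f) = \<psi>' (?\<pi> f)"
        proof (induction f rule: frag_induction)
          case zero
          have "\<psi> (?\<pi> (0 - 0)) = \<psi>' (?\<pi> (0 - 0))"
            using psi_diff[OF \<psi> weight_space_closed(1) weight_space_closed(1)]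
              psi_diff[OF \<psi>' weight_space_closed(1) weight_space_closed(1)]
              psi_car[OF \<psi> weight_space_closed(1)] psi_car[OF \<psi>' weight_space_closed(1)]
            by (simp add: a_minus_def F.r_neg)
          then show ?case by (simp add: weight_space_closed(1))
        next
          case (one e) then show ?case using fun_cong[OF eq, of e] by (simp add: inv)
        next
          case (diff f g)
          then have "f - g \<in> weight_space a 0" using weight_space_closed(2)[of f a 0 "- g"] weight_space_closed(3) by auto
          then show ?case using psi_diff[OF \<psi>] psi_diff[OF \<psi>'] diff by simp
        qed
        then show ?thesis ..
      qed
      show "\<psi> = \<psi>'"
      proof (rule extensionalityI[of _ "?\<pi> ` weight_space a 0"])
        show "\<psi> \<in> extensional (?\<pi> ` weight_space a 0)" "\<psi>' \<in> extensional (?\<pi> ` weight_space a 0)"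
          using \<psi> \<psi>' unfolding hom0 by (auto simp: PiE_def)
      qed (use same in auto)
    qed
    show "?b ` ?H = ?E"
    proof (intro equalityI subsetI)
      fix \<phi> assume "\<phi> \<in> ?b ` ?H"
      then obtain \<psi> where \<psi>: "\<psi> \<in> ?H" and \<phi>: "\<phi> = ?b \<psi>" by blast
      have \<phi>E: "\<phi> \<in> F.exp_homs a"
        unfolding F.exp_homs_def
      proof (intro CollectI conjI ballI)
        show "\<phi> \<in> invariant_exps a \<rightarrow>\<^sub>E carrier F" using psi_car[OF \<psi>] inv by (auto simp: \<phi>)
        have "\<psi> (?\<pi> 1) = \<one>" using \<psi> unfolding hom0 by blast
        then show "\<phi> 0 = \<one>" by (simp add: \<phi> int_subgroup_exps(2))
        fix e e' assume e: "e \<in> invariant_exps a" "e' \<in> invariant_exps a"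
        then have "\<psi> (?\<pi> (frag_of e * frag_of e')) = \<psi> (?\<pi> (frag_of e)) \<otimes> \<psi> (?\<pi> (frag_of e'))"
          using \<psi> inv unfolding hom0 by blast
        then show "\<phi> (e + e') = \<phi> e \<otimes> \<phi> e'" using e int_subgroup_exps(1)[OF e] by (simp add: \<phi> mult_single)
      qed
      let ?m = "moment (\<lambda>i. coord (Inl i)) (\<lambda>i. coord (Inr i)) :: int ^ 'n \<Rightarrow> 'n cot_poly"
      have "F.pairing x (\<lambda>i. \<phi> (cross i)) = F.zmul (lam x) \<one>" if x: "x \<in> kernel_lattice a" for x
      proof -
        have "?m x - of_int (lam x) \<in> fibre_ideal a lam"
          using x ring.genideal_self[OF cring.axioms(1)[OF cring_univ_ring], of "(\<lambda>x. ?m x - of_int (lam x)) ` kernel_lattice a"]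
          unfolding fibre_ideal_def by auto
        then have "?\<pi> (?m x) = ?\<pi> (of_int (lam x))" by (simp add: fibre_class_eq_iff)
        moreover have "\<psi> (?\<pi> (?m x)) = F.pairing x (\<lambda>i. \<phi> (cross i))"
        proof -
          have add: "\<psi> (?\<pi> (?m (x + y))) = \<psi> (?\<pi> (?m x)) \<oplus> \<psi> (?\<pi> (?m y))" for x y
            using \<psi> moment_weight_space[of x a] moment_weight_space[of y a] unfolding hom0 moment_coord_add by blast
          have "\<psi> (?\<pi> (?m x)) = F.pairing x (\<lambda>i. \<psi> (?\<pi> (?m (axis i 1))))"
            by (rule F.additive_eq_pairing[of "\<lambda>x. \<psi> (?\<pi> (?m x))"]) (use add psi_car[OF \<psi> moment_weight_space] in auto)
          then show ?thesis by (simp add: moment_coord_axis \<phi> int_subgroup_exps(3))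
        qed
        moreover have "\<psi> (?\<pi> (of_int k)) = F.zmul k \<one>" for k
        proof (rule F.additive_of_int[of "\<lambda>k::int. \<psi> (?\<pi> (of_int k))" k, simplified])
          show "\<psi> (?\<pi> (of_int k)) \<in> carrier F" for k using psi_car[OF \<psi> of_int_weight_space] .
          show "\<psi> (?\<pi> (of_int k + of_int l)) = \<psi> (?\<pi> (of_int k)) \<oplus> \<psi> (?\<pi> (of_int l))" for k l
            using \<psi> of_int_weight_space[of k a] of_int_weight_space[of l a] unfolding hom0 by blast
          show "\<psi> (?\<pi> 1) = \<one>" using \<psi> unfolding hom0 by blast
        qed
        ultimately show ?thesis by simp
      qed
      moreover have "range (\<lambda>i. \<phi> (cross i)) \<subseteq> carrier F" using F.exp_homsD(1)[OF \<phi>E] int_subgroup_exps(3) by auto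
      ultimately show "\<phi> \<in> ?E" using \<phi>E by (simp add: level_set_def)
    next
      fix \<phi> assume "\<phi> \<in> ?E"
      then have \<phi>: "\<phi> \<in> F.exp_homs a" and lev: "(\<lambda>i. \<phi> (cross i)) \<in> level_set F a lam" by auto
      note L = F.lin_ext[OF \<phi>]
      \<comment> \<open>The value is read off a chosen invariant representative. Two choices differ
        by an element of the fibre ideal, on which \<open>lin_ext\<close> is zero.\<close>
      define \<psi> where "\<psi> = (\<lambda>c\<in>?\<pi> ` weight_space a 0. F.lin_ext a \<phi> (SOME f. f \<in> weight_space a 0 \<and> ?\<pi> f = c))"
      have v: "\<psi> (?\<pi> f) = F.lin_ext a \<phi> f" if f: "f \<in> weight_space a 0" for f
      proof -
        define g where "g = (SOME g. g \<in> weight_space a 0 \<and> ?\<pi> g = ?\<pi> f)"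
        have "g \<in> weight_space a 0 \<and> ?\<pi> g = ?\<pi> f" unfolding g_def by (rule someI[of _ f]) (simp add: f)
        then have "g - f \<in> fibre_ideal a lam" by (simp add: fibre_class_eq_iff)
        then have "F.lin_ext a \<phi> (g - f) = \<zero>" using F.lin_ext_fibre_ideal[OF \<phi> lev] by blast
        then have "F.lin_ext a \<phi> g = F.lin_ext a \<phi> f" using L(2)[of "g - f" f] L(1) by simp
        then show ?thesis using f by (simp add: \<psi>_def g_def)
      qed
      have "\<psi> \<in> ?H"
        unfolding hom0
      proof (intro CollectI conjI ballI)
        show "\<psi> \<in> ?\<pi> ` weight_space a 0 \<rightarrow>\<^sub>E carrier F" using L(1) by (auto simp: \<psi>_def)
        show "\<psi> (?\<pi> 1) = \<one>" using v[OF weight_space_closed(4)] F.lin_ext_one[OF \<phi>] by simp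
        fix f g assume f: "f \<in> weight_space a 0" and g: "g \<in> weight_space a 0"
        show "\<psi> (?\<pi> (f + g)) = \<psi> (?\<pi> f) \<oplus> \<psi> (?\<pi> g)" using v f g weight_space_closed(2)[OF f g] L(2) by simp
        show "\<psi> (?\<pi> (f * g)) = \<psi> (?\<pi> f) \<otimes> \<psi> (?\<pi> g)"
          using v f g weight_space_mult[OF f g] F.lin_ext_mult[OF \<phi> f] by simp
      qed
      moreover have "?b \<psi> = \<phi>"
        using F.exp_homsD(2)[OF \<phi>] by (intro extensionalityI[of _ "invariant_exps a"]) (auto simp: v inv L(3))
      ultimately show "\<phi> \<in> ?b ` ?H" by blast
    qed
  qed
qed

section \<open>The point count\<close>

text \<open>The dual vectors, scaled to a common diagonal value \<open>D\<close>, combine to any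
  values prescribed on \<open>Z\<close> up to the factor \<open>D\<close>. It serves to change
  \<open>D *s r\<close> by a trivial character to a weight that is zero on \<open>Z\<close>.\<close>

lemma coords_indep_solve:
  fixes r :: "int ^ 'n::finite"
  assumes G: "int_subgroup G" and ind: "coords_indep G Z"
  shows "\<exists>D>0. \<exists>x\<in>G. \<forall>i\<in>Z. x $ i = D * r $ i"
proof -
  obtain y where y: "\<And>i. i \<in> Z \<Longrightarrow> y i \<in> G" "\<And>i. i \<in> Z \<Longrightarrow> y i $ i > 0" "\<And>i j. i \<in> Z \<Longrightarrow> j \<in> Z - {i} \<Longrightarrow> y i $ j = 0"
    using ind unfolding coords_indep_def by metis
  define D where "D = (\<Prod>i\<in>Z. y i $ i)"
  define x where "x = (\<Sum>i\<in>Z. (r $ i * (D div y i $ i)) *s y i)"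
  have "D > 0" using y(2) by (auto simp: D_def intro: prod_pos)
  moreover have "x \<in> G" unfolding x_def using y(1) by (intro int_subgroup_sum[OF G] int_subgroup_scale[OF G])
  moreover have "x $ j = D * r $ j" if j: "j \<in> Z" for j
  proof -
    have "x $ j = (\<Sum>i\<in>Z. if i = j then r $ j * (D div y j $ j) * y j $ j else 0)"
      unfolding x_def sum_component using y(3) j by (intro sum.cong) auto
    also have "\<dots> = r $ j * (D div y j $ j * y j $ j)" using j by simp
    also have "D div y j $ j * y j $ j = D" using dvd_prodI[of Z j "\<lambda>i. y i $ i"] j by (simp add: D_def)
    finally show ?thesis by simp
  qed
  ultimately show ?thesis by blast
qed

text \<open>Each factor \<open>2q - 1\<close> is expanded as \<open>q + (q - 1)\<close>, and
  \<open>S\<close> records the indices where \<open>q\<close> is chosen.\<close>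

lemma sum_Pow_weighted:
  fixes q :: real
  assumes "finite Z" "card Z \<le> d"
  shows "(\<Sum>S\<in>Pow Z. q ^ card S * (q - 1) ^ (d - card S)) = (2 * q - 1) ^ card Z * (q - 1) ^ (d - card Z)"
proof -
  have "(2 * q - 1) ^ card Z = (\<Prod>i\<in>Z. q + (q - 1))" by simp
  also have "\<dots> = (\<Sum>S\<in>Pow Z. (\<Prod>i\<in>S. q) * (\<Prod>i\<in>Z - S. q - 1))" by (rule prod_add[OF assms(1)])
  finally have "(2 * q - 1) ^ card Z * (q - 1) ^ (d - card Z) =
    (\<Sum>S\<in>Pow Z. q ^ card S * (q - 1) ^ card (Z - S)) * (q - 1) ^ (d - card Z)" by simp
  also have "\<dots> = (\<Sum>S\<in>Pow Z. q ^ card S * (q - 1) ^ (d - card S))"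
    unfolding sum_distrib_right
  proof (rule sum.cong)
    fix S assume "S \<in> Pow Z"
    then have S: "S \<subseteq> Z" "finite S" "card S \<le> card Z" using assms finite_subset card_mono by auto
    then have "card (Z - S) + (d - card Z) = d - card S" using assms by (simp add: card_Diff_subset)
    then show "q ^ card S * (q - 1) ^ card (Z - S) * (q - 1) ^ (d - card Z) = q ^ card S * (q - 1) ^ (d - card S)"
      by (simp add: mult.assoc flip: power_add)
  qed simp
  finally show ?thesis by simp
qed

text \<open>The integers that have to be nonzero in a field for the point count to hold over it: \<open>w S\<close> is a
  common denominator of a basis of relations if \<open>S\<close> is independent, and otherwise it obstructs the
  vanishing of all \<open>u\<^sub>i\<close>, \<open>i \<in> S\<close>, on the level set.\<close>

definition good_witness :: "('n::finite \<Rightarrow> int ^ 'd::finite) \<Rightarrow> (int ^ 'n \<Rightarrow> int) \<Rightarrow> 'n set \<Rightarrow> int \<Rightarrow> bool" where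
  "good_witness a lam S w \<longleftrightarrow> w \<noteq> 0 \<and>
     (if rel_free a S then \<exists>B Y. kernel_basis a B w Y \<and> S \<subseteq> B
      else \<exists>x\<in>kernel_lattice a. (\<forall>i. i \<notin> S \<longrightarrow> x $ i = 0) \<and> lam x = w)"

lemma ex_good_witness:
  fixes a :: "'n::finite \<Rightarrow> int ^ 'd::finite"
  assumes "lam \<in> lattice_dual (kernel_lattice a)" "regular_value a lam"
  shows "\<exists>w. good_witness a lam S w"
proof (cases "rel_free a S")
  case True
  from ex_kernel_basis[of a S] obtain B C Y where "kernel_basis a B C Y" "S \<subseteq> B" using True by blast
  then show ?thesis using kernel_basisD(2)[of a B C Y] True by (auto simp: good_witness_def intro!: exI[of _ C])
next
  case False
  then show ?thesis using regular_value_witness[OF assms False] by (auto simp: good_witness_def)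
qed

lemma hypertoric_points_card:
  fixes F (structure) and a :: "'n::finite \<Rightarrow> int ^ 'd::finite"
  assumes F: "field F" and fin: "finite (carrier F)"
    and rank: "rank (\<chi> j i. real_of_int (a i $ j) :: real ^ 'n ^ 'd) = CARD('d)"
    and lam: "lam \<in> lattice_dual (kernel_lattice a)"
    and good: "\<And>S. \<exists>w. good_witness a lam S w \<and> ring.zmul F w \<one> \<noteq> \<zero>"
  shows "finite (hypertoric_points a r lam F)"
    "real (card (hypertoric_points a r lam F)) =
      (\<Sum>S | rel_free a S. real (card (carrier F)) ^ CARD('d) * (real (card (carrier F)) - 1) ^ (CARD('d) - card S))"
proof -
  interpret F: field F by fact
  interpret G: int_graded "fibre_ring a lam" F "graded_piece a lam r" by (rule int_graded_fibre_ring[OF F])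
  let ?M = "trivial_characters a" and ?q = "card (carrier F)" and ?L = "level_set F a lam"
  let ?d = "CARD('d)"
  let ?E = "{\<phi> \<in> F.exp_homs a. (\<lambda>i. \<phi> (cross i)) \<in> ?L}"
  let ?Z = "\<lambda>u :: 'n \<Rightarrow> 'a. {i. u i = \<zero>}"
  note M = int_subgroup_trivial_characters[of a]
  note bij = hom0_bij_exp_homs[OF F, of a lam r]
  have free: "rel_free a (?Z u)" if u: "u \<in> ?L" for u
  proof (rule ccontr)
    assume n: "\<not> rel_free a (?Z u)"
    obtain w where w: "good_witness a lam (?Z u) w" "F.zmul w \<one> \<noteq> \<zero>" using good by blast
    then obtain x where x: "x \<in> kernel_lattice a" "\<forall>i. i \<notin> ?Z u \<longrightarrow> x $ i = 0" "lam x = w"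
      using n by (auto simp: good_witness_def)
    have "F.zmul (lam x) \<one> = \<zero>" using x by (intro F.level_set_rel_free[OF u x(1)]) auto
    then show False using w x by simp
  qed
  have unit: "G.unit_pair \<psi>" if \<psi>: "\<psi> \<in> G.hom0" for \<psi>
  proof -
    define \<phi> where "\<phi> = (\<lambda>e\<in>invariant_exps a. \<psi> (fibre_class a lam (frag_of e)))"
    have "\<phi> \<in> ?E" using bij_betwE[OF bij] \<psi> unfolding \<phi>_def by blast
    then have \<phi>: "\<phi> \<in> F.exp_homs a" and u: "(\<lambda>i. \<phi> (cross i)) \<in> ?L" by auto
    obtain D x where D: "D > 0" and x: "x \<in> ?M" "\<And>i. \<phi> (cross i) = \<zero> \<Longrightarrow> x $ i = D * r $ i"
      using coords_indep_solve[OF M rel_free_coords_indep[OF free[OF u]], of r] by auto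
    \<comment> \<open>\<open>y\<close> restricts to the same character of \<open>T^k\<close> as
      \<open>D *s r\<close> but is zero wherever \<open>z_i w_i\<close> is. The monomials of weights
      \<open>y\<close> and \<open>- y\<close> thus have degrees \<open>D\<close> and
      \<open>- D\<close> and a product with nonzero value.\<close>
    define y where "y = D *s r - x"
    have y0: "y $ i = 0" if "\<phi> (cross i) = \<zero>" for i using x(2)[OF that] by (simp add: y_def)
    have e: "frag_of (reduced_exp y) \<in> weight_space a (D *s r)"
      using int_subgroup_neg[OF M x(1)] by (simp add: weight_space_single y_def)
    have "weight (reduced_exp (- y)) - (- D) *s r = x" by (simp add: y_def vec_eq_iff)
    then have e': "frag_of (reduced_exp (- y)) \<in> weight_space a ((- D) *s r)"
      using x(1) by (simp add: weight_space_single)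
    let ?e = "reduced_exp y + reduced_exp (- y)"
    have "fibre_class a lam (frag_of (reduced_exp y)) \<otimes>\<^bsub>fibre_ring a lam\<^esub> fibre_class a lam (frag_of (reduced_exp (- y)))
      = fibre_class a lam (frag_of ?e)"
      by (simp add: mult_single flip: fibre_class_simps(3))
    moreover have "\<psi> (fibre_class a lam (frag_of ?e)) = \<phi> ?e"
      using int_subgroup_0[OF M] by (simp add: \<phi>_def invariant_exps_def)
    moreover have "\<phi> ?e \<noteq> \<zero>" using y0 by (rule F.exp_homs_nonzero[OF \<phi>])
    ultimately show ?thesis
      using D e e' unfolding G.unit_pair_def graded_piece_def by (intro exI[of _ D] conjI bexI) auto
  qed
  have X: "hypertoric_points a r lam F = proj_field_points (fibre_ring a lam) (\<lambda>m. graded_piece a lam r (int m)) F"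
    unfolding hypertoric_points_def by (rule arg_cong[where f = "\<lambda>S. proj_field_points _ S _"]) (simp add: fun_eq_iff semi_invariants_eq)
  have XE: "finite (hypertoric_points a r lam F) \<longleftrightarrow> finite ?E" "card (hypertoric_points a r lam F) = card ?E"
    using bij_betw_finite[OF bij_betw_trans[OF G.proj_field_points_bij[OF unit] bij]]
      bij_betw_same_card[OF bij_betw_trans[OF G.proj_field_points_bij[OF unit] bij]] unfolding X by blast+
  have q: "?q \<ge> 2"
  proof -
    have "card {\<zero>, \<one>} \<le> ?q" using fin by (intro card_mono) auto
    then show ?thesis by simp
  qed
  have torus: "finite (F.sign_homs ?M {})" "card (F.sign_homs ?M {}) = (?q - 1) ^ ?d"
  proof -
    from ex_kernel_basis[of a "{}"] obtain B C Y where kb: "kernel_basis a B C Y" by blast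
    have B: "card B = ?d" "rel_free a B" using basis_real(1)[OF rank kb] kernel_basisD(1)[OF kb] by auto
    have "x = 0" if x: "x \<in> ?M" "\<And>i. i \<in> B \<Longrightarrow> x $ i = 0" for x
    proof -
      have "x $ j = 0" for j
      proof (cases "j \<in> B")
        case False
        \<comment> \<open>Pairing with the circuit \<open>Y j\<close> isolates the entry at
          \<open>j\<close>, as \<open>x\<close> is zero on \<open>B\<close> and the circuit is zero
          at the other indices outside \<open>B\<close>.\<close>
        have "(\<Sum>i\<in>UNIV. Y j $ i * x $ i) = (\<Sum>i\<in>UNIV. if i = j then C * x $ j else 0)"
          using x(2) kernel_basisD(4,5)[OF kb False] by (intro sum.cong) auto
        then have "C * x $ j = 0"
          using trivial_characters_orthogonal[OF x(1) kernel_basisD(3)[OF kb False]] by simp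
        then show ?thesis using kernel_basisD(2)[OF kb] by simp
      qed (use x in auto)
      then show ?thesis by (simp add: vec_eq_iff)
    qed
    from F.card_sign_homs_free[OF M rel_free_coords_indep[OF B(2)] this fin]
    show "finite (F.sign_homs ?M {})" "card (F.sign_homs ?M {}) = (?q - 1) ^ ?d" using B by auto
  qed
  let ?\<Phi> = "\<lambda>u. {\<phi> \<in> F.exp_homs a. \<forall>i. \<phi> (cross i) = u i}"
  have fibre: "finite (?\<Phi> u)"
    "real (card (?\<Phi> u)) = (\<Sum>S\<in>Pow (?Z u). real ?q ^ card S * (real ?q - 1) ^ (?d - card S))" if u: "u \<in> ?L" for u
  proof -
    have uc: "\<And>i. u i \<in> carrier F" using u by (auto simp: level_set_def)
    note b = F.exp_homs_bij_sign_homs[of u a, OF uc]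
    note s = F.card_sign_homs[OF M rel_free_coords_indep[OF free[OF u]] torus(1) fin]
    show "finite (?\<Phi> u)" using bij_betw_finite[OF b] s by blast
    have z: "card (?Z u) \<le> ?d" using rel_free_card[OF free[OF u]] .
    have "(?q - 1) ^ card (?Z u) * card (?\<Phi> u) = (2 * ?q - 1) ^ card (?Z u) * (?q - 1) ^ ?d"
      using s torus(2) bij_betw_same_card[OF b] by simp
    then have "real ((?q - 1) ^ card (?Z u) * card (?\<Phi> u)) = real ((2 * ?q - 1) ^ card (?Z u) * (?q - 1) ^ ?d)" by simp
    then have "(real ?q - 1) ^ card (?Z u) * real (card (?\<Phi> u)) = (2 * real ?q - 1) ^ card (?Z u) * (real ?q - 1) ^ ?d"
      using q by (simp add: of_nat_diff)
    also have "(real ?q - 1) ^ ?d = (real ?q - 1) ^ card (?Z u) * (real ?q - 1) ^ (?d - card (?Z u))"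
      using z by (simp flip: power_add)
    finally have "real (card (?\<Phi> u)) = (2 * real ?q - 1) ^ card (?Z u) * (real ?q - 1) ^ (?d - card (?Z u))"
      using q by simp
    then show "real (card (?\<Phi> u)) = (\<Sum>S\<in>Pow (?Z u). real ?q ^ card S * (real ?q - 1) ^ (?d - card S))"
      using sum_Pow_weighted[of "?Z u" ?d "real ?q"] z by simp
  qed
  have finL: "finite ?L" by (rule F.finite_level_set[OF fin])
  have E: "?E = (\<Union>u\<in>?L. ?\<Phi> u)"
  proof (intro equalityI subsetI)
    fix \<phi> assume "\<phi> \<in> (\<Union>u\<in>?L. ?\<Phi> u)"
    then obtain u where "u \<in> ?L" "\<phi> \<in> F.exp_homs a" "\<And>i. \<phi> (cross i) = u i" by blast
    moreover from this have "(\<lambda>i. \<phi> (cross i)) = u" by blast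
    ultimately show "\<phi> \<in> ?E" by simp
  qed auto
  show "finite (hypertoric_points a r lam F)" unfolding XE E using finL fibre(1) by blast
  have disj: "?\<Phi> u \<inter> ?\<Phi> v = {}" if "u \<noteq> v" for u v using that by (auto simp: fun_eq_iff)
  have "card ?E = (\<Sum>u\<in>?L. card (?\<Phi> u))"
    unfolding E using finL fibre(1) disj by (intro card_UN_disjoint) auto
  then have "real (card (hypertoric_points a r lam F)) =
      (\<Sum>u\<in>?L. \<Sum>S\<in>Pow (?Z u). real ?q ^ card S * (real ?q - 1) ^ (?d - card S))"
    using fibre(2) XE(2) by simp
  also have "\<dots> = (\<Sum>u\<in>?L. \<Sum>S | S \<in> UNIV \<and> (\<forall>i\<in>S. u i = \<zero>). real ?q ^ card S * (real ?q - 1) ^ (?d - card S))"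
    by (intro sum.cong) auto
  also have "\<dots> = (\<Sum>S\<in>UNIV. \<Sum>u | u \<in> ?L \<and> (\<forall>i\<in>S. u i = \<zero>). real ?q ^ card S * (real ?q - 1) ^ (?d - card S))"
    by (rule sum.swap_restrict) (use finL in auto)
  also have "\<dots> = (\<Sum>S\<in>UNIV. real ?q ^ card S * (real ?q - 1) ^ (?d - card S) * real (card {u \<in> ?L. \<forall>i\<in>S. u i = \<zero>}))"
    by (simp add: mult.commute)
  also have "\<dots> = (\<Sum>S | rel_free a S. real ?q ^ card S * (real ?q - 1) ^ (?d - card S) * real (card {u \<in> ?L. \<forall>i\<in>S. u i = \<zero>}))"
  proof (rule sum.mono_neutral_right)
    show "\<forall>S\<in>UNIV - {S. rel_free a S}. real ?q ^ card S * (real ?q - 1) ^ (?d - card S) * real (card {u \<in> ?L. \<forall>i\<in>S. u i = \<zero>}) = 0"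
    proof
      fix S assume "S \<in> UNIV - {S. rel_free a S}"
      then have "{u \<in> ?L. \<forall>i\<in>S. u i = \<zero>} = {}"
        using free rel_free_subset[of a _ S] by blast
      then have "card {u \<in> ?L. \<forall>i\<in>S. u i = \<zero>} = 0" by (simp only: card.empty)
      then show "real ?q ^ card S * (real ?q - 1) ^ (?d - card S) * real (card {u \<in> ?L. \<forall>i\<in>S. u i = \<zero>}) = 0"
        by (simp only: of_nat_0 mult_zero_right)
    qed
  qed auto
  \<comment> \<open>The \<open>q ^ (d - card S)\<close> points of the level set that vanish on
    \<open>S\<close> absorb the weight \<open>q ^ card S\<close>. Each \<open>S\<close> uses a basis
    of its own, with its own denominator \<open>w\<close>.\<close>
  also have "\<dots> = (\<Sum>S | rel_free a S. real ?q ^ ?d * (real ?q - 1) ^ (?d - card S))"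
  proof (rule sum.cong)
    fix S assume "S \<in> {S. rel_free a S}"
    then have S: "rel_free a S" by simp
    obtain w where w: "good_witness a lam S w" "F.zmul w \<one> \<noteq> \<zero>" using good by blast
    then obtain B Y where kb: "kernel_basis a B w Y" "S \<subseteq> B" using S by (auto simp: good_witness_def)
    have "card {u \<in> ?L. \<forall>i\<in>S. u i = \<zero>} = ?q ^ card (B - S)"
      by (rule F.card_level_set[OF lam kb w(2)])
    moreover have "card (B - S) = ?d - card S"
      using basis_real(1)[OF rank kb(1)] kb(2) by (simp add: card_Diff_subset finite_subset)
    moreover have "real ?q ^ card S * real ?q ^ (?d - card S) = real ?q ^ ?d"
      using rel_free_card[OF S] by (simp flip: power_add)
    ultimately show "real ?q ^ card S * (real ?q - 1) ^ (?d - card S) * real (card {u \<in> ?L. \<forall>i\<in>S. u i = \<zero>})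
       = real ?q ^ ?d * (real ?q - 1) ^ (?d - card S)" by (simp add: mult.assoc mult.left_commute)
  qed simp
  finally show "real (card (hypertoric_points a r lam F)) = (\<Sum>S | rel_free a S. real ?q ^ ?d * (real ?q - 1) ^ (?d - card S))" .
qed

text \<open>The term for faces of cardinality \<open>i\<close> carries
  \<open>q^(2d) q^(-i) (1 - 1/q)^(d - i) = q^d (q - 1)^(d - i)\<close>, and the face numbers regroup
  into a sum over faces.\<close>

lemma poly_h_poly_inverse:
  fixes a :: "'n::finite \<Rightarrow> int ^ 'd::finite"
  assumes q: "q \<noteq> 0" and card: "\<And>S. S \<in> matroid_complex a \<Longrightarrow> card S \<le> CARD('d)"
  shows "q ^ (2 * CARD('d)) * poly (h_poly a) (inverse q) =
    (\<Sum>S\<in>matroid_complex a. q ^ CARD('d) * (q - 1) ^ (CARD('d) - card S))"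
proof -
  let ?d = "CARD('d)"
  have summand: "q ^ (2 * ?d) * (inverse q ^ i * (1 - inverse q) ^ (?d - i)) = q ^ ?d * (q - 1) ^ (?d - i)" if "i \<le> ?d" for i
  proof -
    have "q ^ (2 * ?d) = q ^ ?d * (q ^ i * q ^ (?d - i))" using that by (simp add: mult_2 flip: power_add)
    moreover have "(q * inverse q) ^ i = 1" "(q * (1 - inverse q)) ^ (?d - i) = (q - 1) ^ (?d - i)"
      using q by (simp_all add: right_diff_distrib)
    ultimately show ?thesis by (simp add: power_mult_distrib mult_ac)
  qed
  have "q ^ (2 * ?d) * poly (h_poly a) (inverse q) =
     (\<Sum>i\<le>?d. real (face_number a i) * (q ^ (2 * ?d) * (inverse q ^ i * (1 - inverse q) ^ (?d - i))))"
    by (simp add: h_poly_def poly_sum sum_distrib_left mult_ac)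
  also have "\<dots> = (\<Sum>i\<le>?d. \<Sum>S | S \<in> matroid_complex a \<and> card S = i. q ^ ?d * (q - 1) ^ (?d - card S))"
    by (intro sum.cong) (auto simp: summand face_number_def)
  also have "\<dots> = (\<Sum>S\<in>matroid_complex a. q ^ ?d * (q - 1) ^ (?d - card S))"
    using card by (intro sum.group) auto
  finally show ?thesis .
qed

theorem proposition3p4:
  fixes a :: "'n::finite \<Rightarrow> int ^ 'd::finite"
    and r :: "int ^ 'n"
    and lam :: "int ^ 'n \<Rightarrow> int"
  assumes nonzero: "\<And>i. a i \<noteq> 0"
    and rank: "rank (\<chi> j i. real_of_int (a i $ j) :: real ^ 'n ^ 'd) = CARD('d)"
    and simplification: "simple_arrangement a r"
    and lam: "lam \<in> lattice_dual (kernel_lattice a)"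
    and regular: "regular_value a lam"
  shows "\<exists>\<nu>. polynomial_point_count (hypertoric_points a r lam) \<nu> \<and>
             (\<forall>q. q \<noteq> 0 \<longrightarrow> poly \<nu> q = q ^ (2 * CARD('d)) * poly (h_poly a) (inverse q))"
proof -
  let ?d = "CARD('d)"
  have mc: "matroid_complex a = {S. rel_free a S}" using matroid_complex_iff_rel_free[OF rank] by blast
  \<comment> \<open>The sum over faces is visibly a polynomial, unlike the expression in
    \<open>1 / q\<close>.\<close>
  define \<nu> :: "real poly" where "\<nu> = (\<Sum>S\<in>matroid_complex a. [:0, 1:] ^ ?d * [:- 1, 1:] ^ (?d - card S))"
  have \<nu>: "poly \<nu> q = (\<Sum>S\<in>matroid_complex a. q ^ ?d * (q - 1) ^ (?d - card S))" for q
    by (simp add: \<nu>_def poly_sum)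
  obtain w where w: "\<And>S. good_witness a lam S (w S)" using ex_good_witness[OF lam regular] by metis
  \<comment> \<open>A prime above every \<open>|w S|\<close> divides none of these finitely many
    nonzero integers.\<close>
  define N where "N = Max (range (\<lambda>S. nat \<bar>w S\<bar>))"
  have "polynomial_point_count (hypertoric_points a r lam) \<nu>"
    unfolding polynomial_point_count_def
  proof (intro exI[of _ N] allI impI)
    fix p e :: nat and F :: "nat ring"
    assume "Factorial_Ring.prime p \<and> N < p \<and> 0 < e \<and> field F \<and> finite (carrier F) \<and> card (carrier F) = p ^ e"
    then have p: "Factorial_Ring.prime p" "N < p" and F: "field F" "finite (carrier F)" "card (carrier F) = p ^ e" by auto
    have "ring.zmul F (w S) \<one>\<^bsub>F\<^esub> \<noteq> \<zero>\<^bsub>F\<^esub>" for S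
    proof (rule field.zmul_one_nz[OF F(1) p(1) F(3)])
      have "nat \<bar>w S\<bar> \<le> N" unfolding N_def by (rule Max_ge) auto
      moreover have "w S \<noteq> 0" using w[of S] by (simp add: good_witness_def)
      ultimately show "\<not> int p dvd w S" using p(2) zdvd_not_zless[of "\<bar>w S\<bar>" "int p"] by auto
    qed
    then have "\<exists>v. good_witness a lam S v \<and> ring.zmul F v \<one>\<^bsub>F\<^esub> \<noteq> \<zero>\<^bsub>F\<^esub>" for S using w by blast
    from hypertoric_points_card[OF F(1,2) rank lam this, of r]
    show "finite (hypertoric_points a r lam F) \<and> real (card (hypertoric_points a r lam F)) = poly \<nu> (real (p ^ e))"
      by (simp add: \<nu> mc F(3))
  qed
  moreover have "poly \<nu> q = q ^ (2 * ?d) * poly (h_poly a) (inverse q)" if "q \<noteq> 0" for q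
    using poly_h_poly_inverse[OF that, of a] rel_free_card[of a] by (simp add: \<nu> mc)
  ultimately show ?thesis by blast
qed

end
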